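(* Let $V:\mathbb R^d\to\mathbb R$ be $\mathbb Z^d$-periodic and measurable, with $V\in L_2(\Omega)$ if $d\le3$ and $V\in L_q(\Omega)$ for some $q>d/2$ if $d\ge4$. Then: (i) if $\lambda(p)$ is an eigenvalue of the operator $H(p)$, $p\in\mathbb R^d$, then any eigenfunction $b(x,p)$ of $H(p)$ corresponding to $\lambda(p)$ belongs to $C(\Omega)$; (ii) if the family of operators $H(p)$ has a holomorphic branch of eigenvalues $\lambda(p)$ in a connected neighborhood $\mathcal O(p_0)\subset\mathbb C^d$ of a point $p_0\in\mathbb R^d$, and for each $p\in\mathcal O(p_0)$ it is possible to choose an eigenfunction $b(\cdot,p)\ne0$ of $H(p)$ corresponding to $\lambda(p)$ such that the mapping $p\mapsto b(\cdot,p)\in L_2(\Omega)$ is holomorphic in $\mathcal O(p_0)$, then the mapping $p\mapsto b(\cdot,p)\in C(\Omega)$ is holomorphic in $\mathcal O(p_0)$.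
   Context: $\Omega=[-1/2,1/2]^d$ is the fundamental domain of the lattice $\mathbb Z^d$. For $p\in\mathbb C^d$, $\mathcal H_p$ is the Hilbert space of functions $u\in L_{2,loc}(\mathbb R^d)$ satisfying $u(x+l)=\exp(ip\cdot l)u(x)$ for $l\in\mathbb Z^d$, with inner product $(f,g)_2=\int_\Omega f\bar g\,dx$ (identified by restriction with $L_2(\Omega)$), and $H(p)$ is the operator generated by $-\Delta+V$ in $\mathcal H_p$ with domain $W^2_{2,loc}(\mathbb R^d)\cap\mathcal H_p$, where $W_2^2$ is the Sobolev space of order 2 based on $L_2$. For real $p$ (i.e. $p\in\mathbb T^d=\mathbb R^d/(2\pi\mathbb Z)^d$) this operator is self-adjoint with discrete spectrum. $C(\Omega)$ carries the sup norm. *)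

theory Defs
  imports "HOL-Analysis.Analysis"
begin

text \<open>
  The dimension d is \<open>CARD('n)\<close>. Functions are representatives: elements of the Lebesgue and
  Sobolev spaces below are individual functions, and equality in these spaces is almost
  everywhere equality.
\<close>

definition Omega :: "(real ^ 'n) set" where
  "Omega = cbox (\<chi> i. -1/2) (\<chi> i. 1/2)"

definition lattice_periodic :: "(real ^ 'n \<Rightarrow> real) \<Rightarrow> bool" where
  "lattice_periodic V \<longleftrightarrow> (\<forall>(k :: int ^ 'n) x. V (x + (\<chi> j. of_int (k $ j))) = V x)"


definition Lp :: "real \<Rightarrow> 'a::euclidean_space set \<Rightarrow> ('a \<Rightarrow> 'b::real_normed_vector) set" where
  "Lp q A = {f \<in> borel_measurable (lebesgue_on A). integrable (lebesgue_on A) (\<lambda>x. norm (f x) powr q)}"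

definition Lp_norm :: "real \<Rightarrow> 'a::euclidean_space set \<Rightarrow> ('a \<Rightarrow> 'b::real_normed_vector) \<Rightarrow> real" where
  "Lp_norm q A f = (LINT x|lebesgue_on A. norm (f x) powr q) powr (1 / q)"

definition L2_loc :: "('a::euclidean_space \<Rightarrow> complex) set" where
  "L2_loc = {f. \<forall>K. compact K \<longrightarrow> f \<in> Lp 2 K}"


definition partial_deriv :: "'n \<Rightarrow> (real ^ 'n \<Rightarrow> real) \<Rightarrow> real ^ 'n \<Rightarrow> real" where
  "partial_deriv i f x = frechet_derivative f (at x) (axis i 1)"

primrec C_diff :: "nat \<Rightarrow> (real ^ 'n \<Rightarrow> real) \<Rightarrow> bool" where
  "C_diff 0 f \<longleftrightarrow> continuous_on UNIV f"
| "C_diff (Suc m) f \<longleftrightarrow> (\<forall>x. f differentiable (at x)) \<and> (\<forall>i. C_diff m (partial_deriv i f))"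

definition test_function :: "(real ^ 'n \<Rightarrow> real) \<Rightarrow> bool" where
  "test_function \<phi> \<longleftrightarrow> (\<forall>m. C_diff m \<phi>) \<and> compact (closure {x. \<phi> x \<noteq> 0})"

definition weak_partial :: "'n \<Rightarrow> (real ^ 'n \<Rightarrow> complex) \<Rightarrow> (real ^ 'n \<Rightarrow> complex) \<Rightarrow> bool" where
  "weak_partial i u v \<longleftrightarrow>
     (\<forall>\<phi>. test_function \<phi> \<longrightarrow>
        (LINT x|lebesgue. partial_deriv i \<phi> x *\<^sub>R u x) = - (LINT x|lebesgue. \<phi> x *\<^sub>R v x))"

text \<open>Here \<open>D i\<close> is the weak derivative of \<open>u\<close> in direction \<open>i\<close>, and \<open>D2 i j\<close> that of \<open>D i\<close>
  in direction \<open>j\<close>.\<close>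

definition sobolev_derivs ::
  "(real ^ 'n \<Rightarrow> complex) \<Rightarrow> ('n \<Rightarrow> real ^ 'n \<Rightarrow> complex) \<Rightarrow> ('n \<Rightarrow> 'n \<Rightarrow> real ^ 'n \<Rightarrow> complex) \<Rightarrow> bool"
where
  "sobolev_derivs u D D2 \<longleftrightarrow>
     u \<in> L2_loc \<and>
     (\<forall>i. D i \<in> L2_loc \<and> weak_partial i u (D i)) \<and>
     (\<forall>i j. D2 i j \<in> L2_loc \<and> weak_partial j (D i) (D2 i j))"

definition W22_loc :: "(real ^ 'n \<Rightarrow> complex) set" where
  "W22_loc = {u. \<exists>D D2. sobolev_derivs u D D2}"


definition bloch_space :: "complex ^ 'n \<Rightarrow> (real ^ 'n \<Rightarrow> complex) set" where
  "bloch_space p = {u \<in> L2_loc. \<forall>k :: int ^ 'n. AE x in lebesgue.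
      u (x + (\<chi> j. of_int (k $ j))) = exp (\<i> * (\<Sum>j\<in>UNIV. p $ j * of_int (k $ j))) * u x}"

text \<open>The graph of the operator \<open>H(p) = -\<Delta> + V\<close>; the weak derivatives are unique up to null sets.\<close>

definition H_graph ::
  "(real ^ 'n \<Rightarrow> real) \<Rightarrow> complex ^ 'n \<Rightarrow> ((real ^ 'n \<Rightarrow> complex) \<times> (real ^ 'n \<Rightarrow> complex)) set"
where
  "H_graph V p = {(u, f). u \<in> W22_loc \<inter> bloch_space p \<and> f \<in> bloch_space p \<and>
      (\<exists>D D2. sobolev_derivs u D D2 \<and>
        (AE x in lebesgue. f x = - (\<Sum>i\<in>UNIV. D2 i i x) + complex_of_real (V x) * u x))}"

definition eigenfunction ::
  "(real ^ 'n \<Rightarrow> real) \<Rightarrow> complex ^ 'n \<Rightarrow> complex \<Rightarrow> (real ^ 'n \<Rightarrow> complex) \<Rightarrow> bool" where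
  "eigenfunction V p \<mu> u \<longleftrightarrow>
     (u, \<lambda>x. \<mu> * u x) \<in> H_graph V p \<and> \<not> (AE x in lebesgue. u x = 0)"

definition eigenvalue :: "(real ^ 'n \<Rightarrow> real) \<Rightarrow> complex ^ 'n \<Rightarrow> complex \<Rightarrow> bool" where
  "eigenvalue V p \<mu> \<longleftrightarrow> (\<exists>u. eigenfunction V p \<mu> u)"


definition C_space :: "'a::topological_space set \<Rightarrow> ('a \<Rightarrow> complex) set" where
  "C_space A = {f. continuous_on A f}"

definition sup_norm :: "'a set \<Rightarrow> ('a \<Rightarrow> complex) \<Rightarrow> real" where
  "sup_norm A f = (SUP x\<in>A. norm (f x))"

text \<open>Continuous representative on \<open>A\<close> of the almost everywhere class of \<open>f\<close>.\<close>

definition C_rep :: "'a::euclidean_space set \<Rightarrow> ('a \<Rightarrow> complex) \<Rightarrow> ('a \<Rightarrow> complex) \<Rightarrow> bool" where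
  "C_rep A f g \<longleftrightarrow> g \<in> C_space A \<and> (AE x in lebesgue_on A. g x = f x)"

text \<open>
  Holomorphy on an open subset of \<open>\<complex>\<^sup>d\<close> is complex Frechet differentiability at every point.
  Every complex linear map from \<open>\<complex>\<^sup>d\<close> to a space \<open>X\<close> has the form \<open>h \<mapsto> \<Sum>\<^sub>j h\<^sub>j D\<^sub>j\<close> with
  \<open>D\<^sub>j \<in> X\<close>. In the second definition \<open>X\<close> is a space of functions with (semi)norm \<open>N\<close>.
\<close>

definition holomorphic_scalar :: "(complex ^ 'n) set \<Rightarrow> (complex ^ 'n \<Rightarrow> complex) \<Rightarrow> bool" where
  "holomorphic_scalar U g \<longleftrightarrow>
     (\<forall>p\<in>U. \<exists>a :: complex ^ 'n. (g has_derivative (\<lambda>h. \<Sum>j\<in>UNIV. h $ j * a $ j)) (at p))"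

definition holomorphic_into ::
  "('a \<Rightarrow> complex) set \<Rightarrow> (('a \<Rightarrow> complex) \<Rightarrow> real) \<Rightarrow>
   (complex ^ 'n) set \<Rightarrow> (complex ^ 'n \<Rightarrow> 'a \<Rightarrow> complex) \<Rightarrow> bool"
where
  "holomorphic_into X N U F \<longleftrightarrow>
     (\<forall>p\<in>U. F p \<in> X) \<and>
     (\<forall>p\<in>U. \<exists>D :: 'n \<Rightarrow> 'a \<Rightarrow> complex. (\<forall>j. D j \<in> X) \<and>
        ((\<lambda>h. N (\<lambda>x. F (p + h) x - F p x - (\<Sum>j\<in>UNIV. h $ j * D j x)) / norm h) \<longlongrightarrow> 0) (at 0))"

end

theory Submission
  imports Defs
begin

text \<open>
  An eigenfunction satisfies \<open>\<Delta>u = (V - \<mu>)u\<close> with both sides locally square integrable. The idea is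
  to convert this into an integral equation with small kernel on the unit cube and to solve that
  equation a second time, among bounded continuous functions; uniqueness of its solution in a larger
  space identifies the continuous solution with \<open>u\<close>, and the dependence on \<open>p\<close> can be read off from
  the equation.

  \<^emph>\<open>Kernel.\<close> For a radial bump \<open>\<psi>(z) = G(|z|\<^sup>2)\<close> put \<open>\<eta>(z) = - 2G'(|z|\<^sup>2)\<close>, so that \<open>z \<eta>(z) = - \<nabla>\<psi>(z)\<close>.
  With \<open>\<eta>\<^sub>r(z) = r\<^bsup>-d\<^esup>\<eta>(z/r)\<close>, and \<open>\<psi>\<^sub>r\<close> likewise, this says \<open>\<partial>\<eta>\<^sub>r/\<partial>r = r \<Delta>\<psi>\<^sub>r\<close>; integration over
  \<open>1/2 \<le> r \<le> 1\<close> produces a test function \<open>\<kappa>\<close> with \<open>\<Delta>\<kappa> = \<eta> - \<eta>\<^bsub>1/2\<^esub>\<close> (\<open>kernel_pair_exists\<close>). The copies of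
  \<open>\<kappa>\<close> at the scales \<open>s/2\<^sup>n\<close> telescope: their sum \<open>ker s\<close> is supported in the ball of radius \<open>s\<close> and
  satisfies \<open>u = \<eta>\<^sub>s * u - ker s * \<Delta>u\<close> (\<open>mollified_equation\<close>, \<open>mollified_limit\<close>). It is, up to
  sign, a truncated fundamental solution, and its construction is uniform in the dimension.

  \<^emph>\<open>Smallness.\<close> The integrals of \<open>ker s (z - y) |V(y)|\<close> over the unit cell are bounded by a multiple of
  \<open>s\<^bsup>2 - d/q\<^esup>\<close>, uniformly in \<open>z\<close> (\<open>ker_weight_bound\<close>), and the exponent is positive because \<open>q > d/2\<close>.

  \<^emph>\<open>Folding.\<close> Since \<open>u(x + k) = e\<^bsup>ip\<cdot>k\<^esup>u(x)\<close>, the integrals over the whole space reduce to the unit cell and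
  its neighbours, and the equation takes the form \<open>u = T u + G u\<close> on the cell. Here \<open>T\<close> integrates
  against \<open>ker s\<close> and \<open>V - \<mu>\<close>, \<open>G\<close> integrates against the smooth kernel \<open>\<eta>\<^sub>s\<close>, and both depend on \<open>p\<close> and \<open>\<mu>\<close>
  only through finitely many scalars \<open>e\<^bsup>ip\<cdot>k\<^esup>\<close> and \<open>\<mu> e\<^bsup>ip\<cdot>k\<^esup>\<close> (\<open>eigenfunction_cell_equation\<close>).

  \<^emph>\<open>Continuity.\<close> For small \<open>s\<close> the operator \<open>T\<close> is a contraction of the bounded continuous functions, hence
  \<open>f = T f + G u\<close> has a continuous solution. As the kernel is symmetric, \<open>T\<close> is also a contraction for the
  \<open>L\<^sub>1\<close> norm with weight \<open>1 + |V|\<close>, and \<open>u\<close> has finite norm there; therefore \<open>u = f\<close> almost everywhere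
  (\<open>T_op_solution_unique\<close>).

  \<^emph>\<open>Holomorphy.\<close> The norm of \<open>G w\<close> in the space of bounded continuous functions is controlled by
  the \<open>L\<^sub>1\<close> norm of \<open>w\<close> on the cell, so \<open>G b(\<cdot>, p)\<close> is complex differentiable in that space as soon as
  \<open>b(\<cdot>, p)\<close> is so in \<open>L\<^sub>2\<close>. The solution of a fixed point equation with uniformly contracting,
  differentiable coefficients is differentiable (\<open>contraction_fixed_point_has_derivative\<close>).
\<close>

section \<open>Smooth functions and compactly supported kernels\<close>

text \<open>A smooth function of one variable is carried along with the sequence of all its derivatives, so
  that differentiation becomes an index shift and closure properties need no higher derivatives.\<close>
definition deriv_chain :: "(nat \<Rightarrow> real \<Rightarrow> real) \<Rightarrow> bool" where
  "deriv_chain S \<longleftrightarrow> (\<forall>m t. (S m has_real_derivative S (Suc m) t) (at t))"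

text \<open>The derivatives of \<open>exp (-1/t)\<close> on \<open>t > 0\<close> have the form \<open>P(1/t) exp (-1/t)\<close>, and one more
  differentiation replaces \<open>P(x)\<close> by \<open>x\<^sup>2 (P(x) - P'(x))\<close>.\<close>
primrec flat_poly :: "nat \<Rightarrow> real poly" where
  "flat_poly 0 = 1"
| "flat_poly (Suc m) = pCons 0 (pCons 0 (flat_poly m - pderiv (flat_poly m)))"

definition flat :: "nat \<Rightarrow> real \<Rightarrow> real" where
  "flat m t = (if t > 0 then poly (flat_poly m) (1/t) * exp (- (1/t)) else 0)"

lemma poly_times_exp_tendsto_0:
  fixes P :: "real poly"
  shows "((\<lambda>x. poly P x * exp (- x)) \<longlongrightarrow> 0) at_top"
proof -
  have "((\<lambda>x. \<Sum>i\<le>degree P. coeff P i * (x ^ i / exp x)) \<longlongrightarrow> (\<Sum>i\<le>degree P. coeff P i * 0)) at_top"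
    by (intro tendsto_intros tendsto_power_div_exp_0)
  moreover have "(\<lambda>x. \<Sum>i\<le>degree P. coeff P i * (x ^ i / exp x)) = (\<lambda>x. poly P x * exp (- x))"
    by (simp add: poly_altdef sum_distrib_right exp_minus divide_inverse mult.assoc)
  ultimately show ?thesis by simp
qed

text \<open>Away from 0 this is the recursion for the polynomials; at 0 the difference quotient is again a
  polynomial in \<open>1/h\<close> times \<open>exp (-1/h)\<close>, which the exponential drives to 0.\<close>
lemma flat_deriv: "(flat m has_real_derivative flat (Suc m) t) (at t)"
proof -
  consider "t > 0" | "t < 0" | "t = 0" by linarith
  then show ?thesis
  proof cases
    case 1
    have "((\<lambda>t. poly (flat_poly m) (1/t) * exp (- (1/t))) has_real_derivative flat (Suc m) t) (at t)"
      using 1 unfolding flat_def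
      by (auto intro!: derivative_eq_intros poly_DERIV[THEN DERIV_chain2] simp: field_simps power2_eq_square)
    moreover have "\<forall>\<^sub>F s in nhds t. (\<lambda>t. poly (flat_poly m) (1/t) * exp (- (1/t))) s = flat m s"
      using eventually_nhds_in_open[of "{0<..}" t] 1 by (auto elim!: eventually_mono simp: flat_def)
    ultimately show ?thesis
      by (subst DERIV_cong_ev[OF refl _ refl, symmetric]) 
  next
    case 2
    have "((\<lambda>t. 0) has_real_derivative flat (Suc m) t) (at t)"
      using 2 by (simp add: flat_def)
    moreover have "\<forall>\<^sub>F s in nhds t. (\<lambda>t. 0) s = flat m s"
      using eventually_nhds_in_open[of "{..<0}" t] 2 by (auto elim!: eventually_mono simp: flat_def)
    ultimately show ?thesis
      by (subst DERIV_cong_ev[OF refl _ refl, symmetric]) 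
  next
    case 3
    have r: "((\<lambda>h. flat m h / h) \<longlongrightarrow> 0) (at_right 0)"
    proof -
      have "((\<lambda>x. poly (pCons 0 (flat_poly m)) x * exp (- x)) \<longlongrightarrow> 0) at_top"
        by (rule poly_times_exp_tendsto_0)
      then have "((\<lambda>h. poly (pCons 0 (flat_poly m)) (inverse h) * exp (- inverse h)) \<longlongrightarrow> 0) (at_right 0)"
        by (rule filterlim_compose[OF _ filterlim_inverse_at_top_right])
      moreover have "\<forall>\<^sub>F h in at_right (0::real). poly (pCons 0 (flat_poly m)) (inverse h) * exp (- inverse h) = flat m h / h"
        by (auto simp: eventually_at_filter flat_def field_simps)
      ultimately show ?thesis by (rule Lim_transform_eventually)
    qed
    have l: "((\<lambda>h. flat m h / h) \<longlongrightarrow> 0) (at_left 0)"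
      by (rule Lim_transform_eventually[OF tendsto_const]) (auto simp: eventually_at_filter flat_def)
    have "((\<lambda>h. flat m h / h) \<longlongrightarrow> 0) (at 0)"
      using l r by (simp add: filterlim_split_at)
    with 3 show ?thesis by (simp add: DERIV_def flat_def)
  qed
qed

lemma deriv_chain_chain:
  assumes "deriv_chain S" "(f has_real_derivative D) (at x)"
  shows "((\<lambda>x. S m (f x)) has_real_derivative S (Suc m) (f x) * D) (at x)"
  using assms unfolding deriv_chain_def by (intro DERIV_chain2[where f="S m"]) auto

lemma smooth_bump_exists:
  "\<exists>G. deriv_chain G \<and> (\<forall>m t. t \<ge> 1 \<longrightarrow> G m t = 0) \<and> (\<forall>t. G 0 t \<ge> 0) \<and> (\<forall>t<1. G 1 t < 0)"
proof (intro exI conjI)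
  define G where "G m t = (-1)^m * flat m (1 - t)" for m t
  show "deriv_chain G"
    unfolding deriv_chain_def G_def
  proof (intro allI)
    fix m t
    have "((\<lambda>t. flat m (1 - t)) has_real_derivative flat (Suc m) (1 - t) * (- 1)) (at t)"
      by (rule deriv_chain_chain) (auto simp: deriv_chain_def flat_deriv intro!: derivative_eq_intros)
    from DERIV_cmult[OF this, of "(-1)^m"]
    show "((\<lambda>t. (-1)^m * flat m (1 - t)) has_real_derivative (-1)^Suc m * flat (Suc m) (1 - t)) (at t)"
      by simp
  qed
  show "\<forall>m t. t \<ge> 1 \<longrightarrow> G m t = 0" "\<forall>t. G 0 t \<ge> 0" "\<forall>t<1. G 1 t < 0"
    by (auto simp: G_def flat_def)
qed

lemma deriv_chain_cont: "deriv_chain S \<Longrightarrow> continuous_on A (S m)"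
  unfolding deriv_chain_def by (metis DERIV_continuous_on has_field_derivative_at_within)

lemma deriv_chain_cont2: "deriv_chain S \<Longrightarrow> continuous_on A f \<Longrightarrow> continuous_on A (\<lambda>x. S m (f x))"
  using continuous_on_compose2[OF deriv_chain_cont[of S UNIV m]] by auto

text \<open>At level 0 and \<open>t = |z|\<^sup>2\<close> this is the integral of \<open>r\<^bsup>1-d\<^esup> G(|z|\<^sup>2/r\<^sup>2)\<close> over \<open>1/2 \<le> r \<le> 1\<close>, a mean
  of dilations of the bump; each derivative in \<open>t\<close> brings out another factor \<open>r\<^bsup>-2\<^esup>\<close>.\<close>
definition avg_chain :: "nat \<Rightarrow> (nat \<Rightarrow> real \<Rightarrow> real) \<Rightarrow> nat \<Rightarrow> real \<Rightarrow> real" where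
  "avg_chain d G m t = integral {1/2..1} (\<lambda>r. inverse r ^ (d - 1 + 2*m) * G m (t * inverse r ^ 2))"

lemma deriv_chain_avg:
  assumes G: "deriv_chain G"
  shows "deriv_chain (avg_chain d G)"
  unfolding deriv_chain_def
proof (intro allI)
  fix m t
  let ?f = "\<lambda>t r. inverse r ^ (d - 1 + 2*m) * G m (t * inverse r ^ 2)"
  let ?f' = "\<lambda>t r. inverse r ^ (d - 1 + 2*Suc m) * G (Suc m) (t * inverse r ^ 2)"
  have "((\<lambda>t. integral (cbox (1/2) 1) (?f t)) has_field_derivative integral (cbox (1/2) 1) (?f' t)) (at t within UNIV)"
  proof (rule leibniz_rule_field_derivative)
    fix t r :: real
    have "((\<lambda>t. G m (t * inverse r ^ 2)) has_real_derivative G (Suc m) (t * inverse r ^ 2) * inverse r ^ 2) (at t within UNIV)"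
      by (rule derivative_eq_intros deriv_chain_chain[OF G] refl)+ simp
    from DERIV_cmult[OF this, of "inverse r ^ (d - 1 + 2*m)"]
    show "((\<lambda>t. ?f t r) has_field_derivative ?f' t r) (at t within UNIV)"
      by (simp add: power_add mult_ac power2_eq_square)
  next
    fix t :: real
    show "?f t integrable_on cbox (1 / 2) 1"
      by (rule integrable_continuous) (auto intro!: continuous_intros deriv_chain_cont2[OF G])
  next
    show "continuous_on (UNIV \<times> cbox (1 / 2) 1) (\<lambda>(x, r). ?f' x r)"
      unfolding split_beta
      by (intro continuous_intros deriv_chain_cont2[OF G]) auto
  qed auto
  then show "(avg_chain d G m has_real_derivative avg_chain d G (Suc m) t) (at t)"
    unfolding avg_chain_def[abs_def] by simp
qed

text \<open>On functions of \<open>t = |z|\<^sup>2\<close> the Laplacian of \<open>\<real>\<^sup>d\<close> acts as \<open>4t d\<^sup>2/dt\<^sup>2 + 2d d/dt\<close>. Applied under the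
  integral it yields the \<open>r\<close>-derivative of \<open>- 2r\<^bsup>-d\<^esup>G'(t/r\<^sup>2)\<close>, so only the values at \<open>r = 1\<close> and
  \<open>r = 1/2\<close> survive.\<close>
lemma avg_chain_laplace:
  assumes G: "deriv_chain G" and d: "d > 0"
  shows "4 * t * avg_chain d G 2 t + 2 * d * avg_chain d G 1 t = 2 * 2 ^ d * G 1 (4 * t) - 2 * G 1 t"
proof -
  let ?F = "\<lambda>r. inverse r ^ d * (- 2 * G 1 (t * inverse r ^ 2))"
  let ?I = "\<lambda>m r. inverse r ^ (d - 1 + 2*m) * G m (t * inverse r ^ 2)"
  have int: "?I m integrable_on {1/2..1}" for m
    by (rule integrable_continuous_real) (auto intro!: continuous_intros deriv_chain_cont2[OF G])
  have n: "d - 1 + 2 * 1 = Suc d" "d - 1 + 2 * 2 = d + 3"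
    using d by auto
  have e1: "inverse r ^ (d - 1 + 2 * 1) = inverse r ^ d * inverse r" for r :: real
    unfolding n by simp
  have e2: "inverse r ^ (d - 1 + 2 * 2) = inverse r ^ d * inverse r ^ 3" for r :: real
    unfolding n by (rule power_add)
  have "((\<lambda>r. 4 * t * ?I 2 r + 2 * d * ?I 1 r) has_integral ?F 1 - ?F (1/2)) {1/2..1}"
  proof (rule fundamental_theorem_of_calculus)
    fix r :: real assume r: "r \<in> {1/2..1}"
    have "((\<lambda>r. G 1 (t * inverse r ^ 2)) has_real_derivative G 2 (t * inverse r ^ 2) * (- 2 * t * inverse r ^ 3)) (at r)"
    proof -
      have "((\<lambda>r. t * inverse r ^ 2) has_real_derivative - 2 * t * inverse r ^ 3) (at r)"
        using r by (auto intro!: derivative_eq_intros simp: field_simps power2_eq_square power3_eq_cube)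
      from deriv_chain_chain[OF G this, of 1] show ?thesis
        by (simp add: numeral_2_eq_2)
    qed
    moreover have "((\<lambda>r. inverse r ^ d) has_real_derivative - d * inverse r ^ d * inverse r) (at r)"
    proof -
      have "(inverse has_real_derivative - (inverse r ^ 2)) (at r)"
        using r by (auto intro!: derivative_eq_intros simp: power2_eq_square field_simps)
      from DERIV_power[OF this, of d] have "((\<lambda>r. inverse r ^ d) has_real_derivative d * (- (inverse r ^ 2) * inverse r ^ (d - Suc 0))) (at r)" .
      moreover have "inverse r ^ d = inverse r * inverse r ^ (d - Suc 0)"
        using d by (cases d) auto
      ultimately show ?thesis by (simp add: power2_eq_square mult_ac)
    qed
    ultimately have D: "(?F has_real_derivative inverse r ^ d * (- 2 * (G 2 (t * inverse r ^ 2) * (- 2 * t * inverse r ^ 3)))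
        + (- d * inverse r ^ d * inverse r) * (- 2 * G 1 (t * inverse r ^ 2))) (at r)"
      by (intro DERIV_mult' DERIV_cmult)
    have "4 * t * ?I 2 r + 2 * d * ?I 1 r = inverse r ^ d * (- 2 * (G 2 (t * inverse r ^ 2) * (- 2 * t * inverse r ^ 3)))
        + (- d * inverse r ^ d * inverse r) * (- 2 * G 1 (t * inverse r ^ 2))"
      by (simp only: e1 e2) (simp add: algebra_simps)
    from D[folded this]
    show "(?F has_vector_derivative 4 * t * ?I 2 r + 2 * d * ?I 1 r) (at r within {1/2..1})"
      by (rule has_vector_derivative_at_within[OF has_real_derivative_iff_has_vector_derivative[THEN iffD1]])
  qed simp
  then have "integral {1/2..1} (\<lambda>r. 4 * t * ?I 2 r + 2 * d * ?I 1 r) = ?F 1 - ?F (1/2)"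
    by (rule integral_unique)
  also have "integral {1/2..1} (\<lambda>r. 4 * t * ?I 2 r + 2 * d * ?I 1 r) = 4 * t * avg_chain d G 2 t + 2 * d * avg_chain d G 1 t"
  proof -
    have "integral {1/2..1} (\<lambda>r. 4 * t * ?I 2 r + 2 * d * ?I 1 r)
        = integral {1/2..1} (\<lambda>r. 4 * t * ?I 2 r) + integral {1/2..1} (\<lambda>r. 2 * d * ?I 1 r)"
      by (intro integral_add integrable_on_mult_right int)
    then show ?thesis
      by (simp only: avg_chain_def integral_mult_right)
  qed
  finally show ?thesis
    by (simp add: power2_eq_square mult_ac)
qed

lemma avg_chain_nonneg:
  assumes G: "deriv_chain G" and "\<And>t. G 0 t \<ge> 0"
  shows "avg_chain d G 0 t \<ge> 0"
  unfolding avg_chain_def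
proof (rule integral_nonneg)
  show "(\<lambda>r. inverse r ^ (d - 1 + 2 * 0) * G 0 (t * (inverse r)\<^sup>2)) integrable_on {1/2..1}"
    by (rule integrable_continuous_real) (auto intro!: continuous_intros deriv_chain_cont2[OF G])
qed (simp add: assms)

lemma avg_chain_zero:
  assumes "\<And>m t. t \<ge> 1 \<Longrightarrow> G m t = 0" "t \<ge> 1"
  shows "avg_chain d G m t = 0"
proof -
  have "t * inverse r ^ 2 \<ge> 1" if "r \<in> {1/2..1}" for r :: real
  proof -
    have "inverse r \<ge> 1" using that by (simp add: one_le_inverse)
    then have "inverse r ^ 2 \<ge> 1" by (simp add: one_le_power)
    then show ?thesis using assms(2) mult_mono[of 1 t 1 "inverse r ^ 2"] by simp
  qed
  then have "integral {1/2..1} (\<lambda>r. inverse r ^ (d - 1 + 2*m) * G m (t * inverse r ^ 2)) = integral {1/2..1::real} (\<lambda>r. 0)"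
    by (intro integral_cong) (simp add: assms(1))
  then show ?thesis unfolding avg_chain_def by simp
qed

lemma partial_deriv_eq:
  assumes "(f has_derivative f') (at x)"
  shows "partial_deriv i f x = f' (axis i 1)"
  using frechet_derivative_at[OF assms] by (simp add: partial_deriv_def)

lemma C_diff_imp_continuous: "C_diff m f \<Longrightarrow> continuous_on UNIV f"
  by (cases m) (simp_all add: differentiable_imp_continuous_on differentiable_on_def)

lemma C_diff_SucD: "C_diff (Suc m) f \<Longrightarrow> C_diff m f"
proof (induction m arbitrary: f)
  case 0
  from C_diff_imp_continuous[OF this] show ?case by simp
next
  case (Suc m)
  have "C_diff m (partial_deriv i f)" for i
    using Suc.prems by (intro Suc.IH) (simp del: C_diff.simps add: C_diff.simps(2)[of "Suc m"])
  with Suc.prems show ?case by (simp only: C_diff.simps) blast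
qed

lemma C_diff_SucI:
  assumes "\<And>x. (f has_derivative f' x) (at x)" "\<And>i. C_diff m (\<lambda>x. f' x (axis i 1))"
  shows "C_diff (Suc m) f"
proof -
  have "partial_deriv i f = (\<lambda>x. f' x (axis i 1))" for i
    using partial_deriv_eq[OF assms(1)] by (intro ext) auto
  with assms show ?thesis by (auto simp: differentiable_def)
qed

lemma C_diff_SucE:
  assumes "C_diff (Suc m) f"
  shows "(f has_derivative (\<lambda>h. frechet_derivative f (at x) h)) (at x)" "C_diff m (partial_deriv i f)"
  using assms frechet_derivative_works by (auto simp: eta_contract_eq)

lemma C_diff_const: "C_diff m (\<lambda>x. c)"
proof (induction m arbitrary: c)
  case (Suc m)
  show ?case by (rule C_diff_SucI[where f'="\<lambda>_ _. 0"]) (auto intro: Suc)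
qed auto

lemma C_diff_add: "C_diff m f \<Longrightarrow> C_diff m g \<Longrightarrow> C_diff m (\<lambda>x. f x + g x)"
proof (induction m arbitrary: f g)
  case 0
  then show ?case by (auto intro: continuous_intros)
next
  case (Suc m)
  have "C_diff m (\<lambda>x. partial_deriv i f x + partial_deriv i g x)" for i
    using Suc.prems by (intro Suc.IH C_diff_SucE(2))
  then show ?case
    unfolding partial_deriv_def
    by (rule C_diff_SucI[OF has_derivative_add[OF C_diff_SucE(1)[OF Suc.prems(1)] C_diff_SucE(1)[OF Suc.prems(2)]]])
qed

lemma C_diff_mult: "C_diff m f \<Longrightarrow> C_diff m g \<Longrightarrow> C_diff m (\<lambda>x. f x * g x)"
proof (induction m arbitrary: f g)
  case 0
  then show ?case by (auto intro: continuous_intros)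
next
  case (Suc m)
  have "C_diff m (\<lambda>x. f x * partial_deriv i g x + partial_deriv i f x * g x)" for i
    by (rule C_diff_add[OF Suc.IH Suc.IH])
       (rule C_diff_SucD[OF Suc.prems(1)] C_diff_SucD[OF Suc.prems(2)]
          C_diff_SucE(2)[OF Suc.prems(1)] C_diff_SucE(2)[OF Suc.prems(2)])+
  then show ?case
    unfolding partial_deriv_def
    by (rule C_diff_SucI[OF has_derivative_mult[OF C_diff_SucE(1)[OF Suc.prems(1)] C_diff_SucE(1)[OF Suc.prems(2)]]])
qed

lemma C_diff_component: "C_diff m (\<lambda>x. x $ i)"
proof (cases m)
  case 0
  then show ?thesis by (auto intro!: continuous_intros)
next
  case (Suc n)
  show ?thesis unfolding Suc
    by (rule C_diff_SucI[where f'="\<lambda>_ h. h $ i"])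
       (intro C_diff_const bounded_linear_imp_has_derivative bounded_linear_vec_nth)+
qed

lemma C_diff_affine: "C_diff m f \<Longrightarrow> C_diff m (\<lambda>x. f (c *\<^sub>R x + a))"
proof (induction m arbitrary: f)
  case 0
  then show ?case by (auto intro!: continuous_intros continuous_on_compose2[of UNIV f])
next
  case (Suc m)
  have D: "((\<lambda>x. f (c *\<^sub>R x + a)) has_derivative (\<lambda>h. frechet_derivative f (at (c *\<^sub>R x + a)) (c *\<^sub>R h))) (at x)" for x
    by (rule has_derivative_compose[OF _ C_diff_SucE(1)[OF Suc.prems]])
       (auto intro!: derivative_eq_intros)
  have "C_diff m (\<lambda>x. c * partial_deriv i f (c *\<^sub>R x + a))" for i
    by (rule C_diff_mult[OF C_diff_const Suc.IH[OF C_diff_SucE(2)[OF Suc.prems]]])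
  moreover have "frechet_derivative f (at y) (c *\<^sub>R axis i 1) = c * partial_deriv i f y" for i y
    using linear_cmul[OF has_derivative_linear[OF C_diff_SucE(1)[OF Suc.prems, of y]]]
    by (simp add: partial_deriv_def)
  ultimately show ?case by (intro C_diff_SucI[OF D]) simp
qed

lemma partial_deriv_affine:
  assumes "C_diff (Suc 0) f"
  shows "partial_deriv i (\<lambda>x. b * f (c *\<^sub>R x + a)) x = b * c * partial_deriv i f (c *\<^sub>R x + a)"
proof -
  let ?y = "c *\<^sub>R x + a"
  have "((\<lambda>x. f (c *\<^sub>R x + a)) has_derivative (\<lambda>h. frechet_derivative f (at ?y) (c *\<^sub>R h))) (at x)"
    by (rule has_derivative_compose[OF _ C_diff_SucE(1)[OF assms]])
       (auto intro!: derivative_eq_intros)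
  then have "((\<lambda>x. b * f (c *\<^sub>R x + a)) has_derivative (\<lambda>h. b * frechet_derivative f (at ?y) (c *\<^sub>R h))) (at x)"
    by (rule has_derivative_mult_right)
  moreover have "frechet_derivative f (at ?y) (c *\<^sub>R axis i 1) = c * partial_deriv i f ?y"
    using linear_cmul[OF has_derivative_linear[OF C_diff_SucE(1)[OF assms, of ?y]]]
    by (simp add: partial_deriv_def)
  ultimately show ?thesis by (simp add: partial_deriv_eq)
qed

lemma radial_has_derivative:
  fixes S :: "nat \<Rightarrow> real \<Rightarrow> real" and z :: "real ^ 'n"
  assumes "deriv_chain S"
  shows "((\<lambda>z. S j (z \<bullet> z)) has_derivative (\<lambda>h. S (Suc j) (z \<bullet> z) * (2 * (z \<bullet> h)))) (at z)"
proof -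
  have "((\<lambda>z. z \<bullet> z) has_derivative (\<lambda>h. 2 * (z \<bullet> h))) (at z)"
    by (auto intro!: derivative_eq_intros simp: inner_commute)
  moreover have "(S j has_derivative (\<lambda>t. S (Suc j) (z \<bullet> z) * t)) (at (z \<bullet> z))"
    using assms by (simp add: deriv_chain_def has_field_derivative_def)
  ultimately show ?thesis by (rule has_derivative_compose)
qed

lemma C_diff_radial:
  assumes "deriv_chain S"
  shows "C_diff m (\<lambda>z :: real ^ 'n. S j (z \<bullet> z))"
proof (induction m arbitrary: j)
  case 0
  show ?case by (auto intro!: continuous_intros deriv_chain_cont2[OF assms])
next
  case (Suc m)
  show ?case
  proof (rule C_diff_SucI[OF radial_has_derivative[OF assms]])
    fix i
    have "C_diff m (\<lambda>z :: real ^ 'n. S (Suc j) (z \<bullet> z) * (2 * z $ i))"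
      by (intro C_diff_mult[OF Suc C_diff_mult[OF C_diff_const C_diff_component]])
    then show "C_diff m (\<lambda>z :: real ^ 'n. S (Suc j) (z \<bullet> z) * (2 * (z \<bullet> axis i 1)))"
      by (simp add: inner_axis)
  qed
qed

definition laplacian :: "(real ^ 'n \<Rightarrow> real) \<Rightarrow> real ^ 'n \<Rightarrow> real" where
  "laplacian f x = (\<Sum>i\<in>UNIV. partial_deriv i (partial_deriv i f) x)"

lemma laplacian_radial:
  fixes S :: "nat \<Rightarrow> real \<Rightarrow> real" and z :: "real ^ 'n"
  assumes "deriv_chain S"
  shows "laplacian (\<lambda>z. S 0 (z \<bullet> z)) z = 4 * (z \<bullet> z) * S 2 (z \<bullet> z) + 2 * CARD('n) * S 1 (z \<bullet> z)"
proof -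
  have 1: "partial_deriv i (\<lambda>z. S 0 (z \<bullet> z)) = (\<lambda>z :: real ^ 'n. S (Suc 0) (z \<bullet> z) * (2 * z $ i))" for i
    by (rule ext) (simp add: partial_deriv_eq[OF radial_has_derivative[OF assms]] inner_axis)
  have "partial_deriv i (\<lambda>z. S (Suc 0) (z \<bullet> z) * (2 * z $ i)) z
      = 4 * (z $ i * z $ i) * S 2 (z \<bullet> z) + 2 * S 1 (z \<bullet> z)" for i
  proof -
    have "((\<lambda>z. S (Suc 0) (z \<bullet> z) * (2 * z $ i)) has_derivative
        (\<lambda>h. S (Suc 0) (z \<bullet> z) * (2 * h $ i) + S (Suc (Suc 0)) (z \<bullet> z) * (2 * (z \<bullet> h)) * (2 * z $ i))) (at z)"
      by (intro has_derivative_mult radial_has_derivative[OF assms] has_derivative_mult_right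
          bounded_linear_imp_has_derivative bounded_linear_vec_nth)
    from partial_deriv_eq[OF this, of i] show ?thesis
      by (simp add: inner_axis numeral_2_eq_2 algebra_simps)
  qed
  then have "laplacian (\<lambda>z. S 0 (z \<bullet> z)) z = (\<Sum>i\<in>UNIV. 4 * (z $ i * z $ i) * S 2 (z \<bullet> z) + 2 * S 1 (z \<bullet> z))"
    unfolding laplacian_def 1 by simp
  also have "\<dots> = 4 * (z \<bullet> z) * S 2 (z \<bullet> z) + 2 * CARD('n) * S 1 (z \<bullet> z)"
    by (simp add: sum.distrib inner_vec_def sum_distrib_left sum_distrib_right)
  finally show ?thesis .
qed

lemma compact_support_bounded:
  fixes \<phi> :: "real ^ 'n \<Rightarrow> real"
  assumes "continuous_on UNIV \<phi>" "\<And>z. norm z \<ge> R \<Longrightarrow> \<phi> z = 0"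
  shows "\<exists>B\<ge>0. \<forall>z. \<bar>\<phi> z\<bar> \<le> B"
proof -
  have "bounded (\<phi> ` cball 0 R)"
    by (rule compact_imp_bounded[OF compact_continuous_image[OF continuous_on_subset[OF assms(1) subset_UNIV] compact_cball]])
  then obtain B where B: "\<forall>z\<in>cball 0 R. \<bar>\<phi> z\<bar> \<le> B" by (auto simp: bounded_iff)
  have "\<bar>\<phi> z\<bar> \<le> \<bar>B\<bar>" for z
    using B assms(2)[of z] by (cases "norm z \<le> R") force+
  then show ?thesis by (intro exI[of _ "\<bar>B\<bar>"]) auto
qed

lemma continuous_compact_support_integrable:
  fixes f :: "'a::euclidean_space \<Rightarrow> 'b::{banach, second_countable_topology}"
  assumes "continuous_on UNIV f" "\<And>x. norm x \<ge> R \<Longrightarrow> f x = 0"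
  shows "integrable lborel f"
proof -
  have "(\<lambda>x. indicator (cball 0 R) x *\<^sub>R f x) = f"
  proof
    fix x show "indicator (cball 0 R) x *\<^sub>R f x = f x"
      using assms(2)[of x] by (cases "norm x \<le> R") auto
  qed
  moreover have "integrable lborel (\<lambda>x. indicator (cball 0 R) x *\<^sub>R f x)"
    by (rule borel_integrable_compact[OF compact_cball continuous_on_subset[OF assms(1) subset_UNIV]])
  ultimately show ?thesis by simp
qed

text \<open>The last condition says that \<open>\<kappa>\<close> is a compactly supported potential for the difference of the
  mollifier \<open>\<eta>\<close> and its contraction by the factor 2. Sums over dyadic dilations of it telescope.\<close>
locale kernel_pair =
  fixes \<kappa> \<eta> :: "real ^ 'n \<Rightarrow> real"
  assumes C_diff_kappa: "C_diff m \<kappa>"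
    and kappa_nonneg: "\<kappa> z \<ge> 0"
    and kappa_zero: "norm z \<ge> 1 \<Longrightarrow> \<kappa> z = 0"
    and kappa_minus: "\<kappa> (- z) = \<kappa> z"
    and eta_cont: "continuous_on UNIV \<eta>"
    and eta_nonneg: "\<eta> z \<ge> 0"
    and eta_zero: "norm z \<ge> 1 \<Longrightarrow> \<eta> z = 0"
    and eta_integral: "(LINT z|lborel. \<eta> z) = 1"
    and laplacian_kappa: "laplacian \<kappa> z = \<eta> z - 2 ^ CARD('n) * \<eta> (2 *\<^sub>R z)"

text \<open>The averaged bump serves as \<open>\<kappa>\<close> and \<open>- 2G'(|z|\<^sup>2)\<close> as \<open>\<eta>\<close>, both divided by the integral of the
  latter, which is positive because \<open>G' < 0\<close> on the open unit ball.\<close>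
lemma kernel_pair_exists: "\<exists>\<kappa> \<eta> :: real ^ 'n \<Rightarrow> real. kernel_pair \<kappa> \<eta>"
proof -
  obtain G where G: "deriv_chain G" "\<And>m t. t \<ge> 1 \<Longrightarrow> G m t = 0" "\<And>t. G 0 t \<ge> 0" "\<And>t. t < 1 \<Longrightarrow> G 1 t < 0"
    using smooth_bump_exists by auto
  define k where "k = avg_chain (CARD('n)) G"
  have k: "deriv_chain k" unfolding k_def by (rule deriv_chain_avg[OF G(1)])
  define \<eta>0 where "\<eta>0 z = - 2 * G 1 (z \<bullet> z)" for z :: "real ^ 'n"
  define c where "c = (LINT z|lborel. \<eta>0 z)"
  have n1: "z \<bullet> z \<ge> 1" if "norm z \<ge> 1" for z :: "real ^ 'n"
    using that by (simp add: dot_square_norm one_le_power)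
  have cont: "continuous_on UNIV \<eta>0"
    unfolding \<eta>0_def[abs_def] by (intro continuous_intros deriv_chain_cont2[OF G(1)])
  have nn: "\<eta>0 z \<ge> 0" for z
    using G(4)[of "z \<bullet> z"] G(2)[of "z \<bullet> z" 1] by (cases "z \<bullet> z < 1") (auto simp: \<eta>0_def)
  have z: "\<eta>0 z = 0" if "norm z \<ge> 1" for z
    using G(2)[OF n1[OF that]] by (simp add: \<eta>0_def)
  have int: "integrable lborel \<eta>0"
    by (rule continuous_compact_support_integrable[OF cont z])
  have "c \<ge> 0" unfolding c_def using nn by (intro integral_nonneg_AE) auto
  moreover have "c \<noteq> 0"
  proof
    assume "c = 0"
    then have "AE z in lborel. \<eta>0 z = 0"
      unfolding c_def using integral_nonneg_eq_0_iff_AE[OF int] nn by auto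
    moreover have "z \<notin> ball 0 1" if "\<eta>0 z = 0" for z
      using that G(4)[of "z \<bullet> z"] by (auto simp: \<eta>0_def dot_square_norm abs_square_less_1)
    ultimately have "AE z in lborel. z \<notin> ball (0 :: real ^ 'n) 1"
      by (rule eventually_mono)
    then have "ball (0 :: real ^ 'n) 1 \<in> null_sets lborel"
      by (subst (asm) AE_iff_null) (auto simp: ball_def)
    then have "negligible (ball (0 :: real ^ 'n) 1)"
      by (simp add: negligible_iff_null_sets null_sets_completionI)
    then show False
      using open_not_negligible[OF open_ball, of "0 :: real ^ 'n" 1] by simp
  qed
  ultimately have c: "c > 0" by simp
  define \<kappa> where "\<kappa> z = (1/c) * k 0 (z \<bullet> z)" for z :: "real ^ 'n"
  define \<eta> where "\<eta> z = (1/c) * \<eta>0 z" for z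
  have sm: "C_diff m (\<lambda>z :: real ^ 'n. k 0 (z \<bullet> z))" for m
    by (rule C_diff_radial[OF k])
  have "kernel_pair \<kappa> \<eta>"
  proof
    show "C_diff m \<kappa>" for m unfolding \<kappa>_def[abs_def] by (intro C_diff_mult C_diff_const sm)
    show "\<kappa> z \<ge> 0" for z
      using avg_chain_nonneg[OF G(1) G(3)] c by (simp add: \<kappa>_def k_def)
    show "\<kappa> z = 0" if "norm z \<ge> 1" for z
      using avg_chain_zero[OF G(2) n1[OF that]] by (simp add: \<kappa>_def k_def)
    show "\<kappa> (- z) = \<kappa> z" for z by (simp add: \<kappa>_def)
    show "continuous_on UNIV \<eta>" unfolding \<eta>_def[abs_def] by (intro continuous_intros cont)
    show "\<eta> z \<ge> 0" for z using nn c by (simp add: \<eta>_def)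
    show "\<eta> z = 0" if "norm z \<ge> 1" for z using z[OF that] by (simp add: \<eta>_def)
    show "(LINT z|lborel. \<eta> z) = 1" using c by (simp add: \<eta>_def c_def)
    show "laplacian \<kappa> z = \<eta> z - 2 ^ CARD('n) * \<eta> (2 *\<^sub>R z)" for z
    proof -
      have p1: "partial_deriv i \<kappa> = (\<lambda>z. (1/c) * partial_deriv i (\<lambda>z. k 0 (z \<bullet> z)) (1 *\<^sub>R z + 0))" for i
        unfolding \<kappa>_def[abs_def] using partial_deriv_affine[OF sm, where b="1/c" and c=1 and a=0 and i=i] by (intro ext) simp
      have p2: "partial_deriv i (partial_deriv i \<kappa>) z = (1/c) * partial_deriv i (partial_deriv i (\<lambda>z. k 0 (z \<bullet> z))) z" for i
        unfolding p1 using partial_deriv_affine[OF C_diff_SucE(2)[OF sm], where b="1/c" and c=1 and a=0] by simp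
      have "laplacian \<kappa> z = (1/c) * laplacian (\<lambda>z. k 0 (z \<bullet> z)) z"
        unfolding laplacian_def p2 by (simp add: sum_distrib_left)
      also have "\<dots> = (1/c) * (2 * 2 ^ CARD('n) * G 1 (4 * (z \<bullet> z)) - 2 * G 1 (z \<bullet> z))"
        using avg_chain_laplace[OF G(1), of "CARD('n)" "z \<bullet> z"]
        by (simp add: laplacian_radial[OF k] k_def[symmetric])
      also have "\<dots> = \<eta> z - 2 ^ CARD('n) * \<eta> (2 *\<^sub>R z)"
        by (simp add: \<eta>_def \<eta>0_def algebra_simps)
      finally show ?thesis .
    qed
  qed
  then show ?thesis by blast
qed

section \<open>The mollified Laplace equation\<close>

lemma partial_deriv_outside_support:
  assumes "x \<notin> closure {x. \<phi> x \<noteq> 0}"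
  shows "partial_deriv i \<phi> x = 0"
proof -
  have "((\<lambda>_. 0) has_derivative (\<lambda>_. 0)) (at x)" by simp
  then have "(\<phi> has_derivative (\<lambda>_. 0)) (at x)"
  proof (rule has_derivative_transform_within_open)
    show "open (- closure {x. \<phi> x \<noteq> 0})" by auto
    show "0 = \<phi> y" if "y \<in> - closure {x. \<phi> x \<noteq> 0}" for y
      using that closure_subset[of "{x. \<phi> x \<noteq> 0}"] by auto
  qed (use assms in auto)
  then show ?thesis by (simp add: partial_deriv_eq)
qed

lemma test_function_partial_deriv:
  assumes "test_function \<phi>"
  shows "test_function (partial_deriv i \<phi>)"
  unfolding test_function_def
proof
  show "\<forall>m. C_diff m (partial_deriv i \<phi>)"
  proof
    fix m
    have "C_diff (Suc m) \<phi>" using assms unfolding test_function_def by blast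
    then show "C_diff m (partial_deriv i \<phi>)" by (rule C_diff_SucE(2))
  qed
  have "closure {x. partial_deriv i \<phi> x \<noteq> 0} \<subseteq> closure {x. \<phi> x \<noteq> 0}"
    using partial_deriv_outside_support[of _ \<phi> i] by (intro closure_minimal) auto
  then show "compact (closure {x. partial_deriv i \<phi> x \<noteq> 0})"
    using assms compact_Int_closed[of "closure {x. \<phi> x \<noteq> 0}" "closure {x. partial_deriv i \<phi> x \<noteq> 0}"]
    by (simp add: test_function_def Int_absorb1)
qed

lemma Lp2_imp_set_integrable:
  fixes u :: "real ^ 'n \<Rightarrow> complex"
  assumes u: "u \<in> Lp 2 S" and S: "S \<in> sets lebesgue" "emeasure lebesgue S < \<infinity>"
  shows "set_integrable lebesgue S u"
proof -
  interpret finite_measure "lebesgue_on S"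
    using S by (intro finite_measureI) (simp add: emeasure_restrict_space)
  have "integrable (lebesgue_on S) (\<lambda>x. 1 + norm (u x) powr 2)"
    using u by (simp add: Lp_def)
  then have "integrable (lebesgue_on S) u"
  proof (rule Bochner_Integration.integrable_bound)
    show "u \<in> borel_measurable (lebesgue_on S)" using u by (simp add: Lp_def)
    have "t \<le> 1 + t^2" if "t \<ge> 0" for t :: real
      using sum_squares_bound[of t 1] zero_le_power2[of t] that by simp
    then show "AE x in lebesgue_on S. norm (u x) \<le> norm (1 + norm (u x) powr 2)"
      by (simp add: powr_numeral)
  qed
  then show ?thesis
    using S by (simp add: integrable_restrict_space set_integrable_def)
qed

lemma L2_loc_imp_set_integrable:
  fixes u :: "real ^ 'n \<Rightarrow> complex"
  assumes "u \<in> L2_loc" "compact S"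
  shows "set_integrable lebesgue S u"
proof (rule Lp2_imp_set_integrable)
  show "u \<in> Lp 2 S" using assms by (auto simp: L2_loc_def)
  have "S \<in> lmeasurable" by (rule lmeasurable_compact[OF assms(2)])
  then show "S \<in> sets lebesgue" "emeasure lebesgue S < \<infinity>" by (auto simp: fmeasurable_def)
qed

lemma set_integrable_bounded_mult:
  fixes u :: "real ^ 'n \<Rightarrow> complex" and \<phi> :: "real ^ 'n \<Rightarrow> real"
  assumes u: "set_integrable lebesgue S u" and S: "compact S"
    and \<phi>: "continuous_on UNIV \<phi>" "\<And>x. x \<notin> S \<Longrightarrow> \<phi> x = 0"
  shows "integrable lebesgue (\<lambda>x. \<phi> x *\<^sub>R u x)"
proof -
  obtain B where B: "\<And>x. x \<in> S \<Longrightarrow> \<bar>\<phi> x\<bar> \<le> B"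
    using compact_continuous_image[OF continuous_on_subset[OF \<phi>(1) subset_UNIV] S]
    by (force dest!: compact_imp_bounded simp: bounded_iff)
  have m: "\<phi> \<in> borel_measurable lebesgue"
    using \<phi>(1) by (simp add: borel_measurable_continuous_onI measurable_completion)
  have "integrable lebesgue (\<lambda>x. \<phi> x *\<^sub>R (indicator S x *\<^sub>R u x))"
  proof (rule Bochner_Integration.integrable_bound[OF integrable_mult_right[OF integrable_norm[OF u[unfolded set_integrable_def]], of B]])
    show "(\<lambda>x. \<phi> x *\<^sub>R indicat_real S x *\<^sub>R u x) \<in> borel_measurable lebesgue"
      using u unfolding set_integrable_def
      by (intro borel_measurable_scaleR[OF m borel_measurable_integrable])
    show "AE x in lebesgue. norm (\<phi> x *\<^sub>R indicat_real S x *\<^sub>R u x) \<le> norm (B * norm (indicat_real S x *\<^sub>R u x))"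
    proof (intro AE_I2)
      fix x
      show "norm (\<phi> x *\<^sub>R indicat_real S x *\<^sub>R u x) \<le> norm (B * norm (indicat_real S x *\<^sub>R u x))"
        using B[of x] by (cases "x \<in> S") (auto simp: abs_mult intro!: mult_right_mono)
    qed
  qed
  moreover have "(\<lambda>x. \<phi> x *\<^sub>R (indicator S x *\<^sub>R u x)) = (\<lambda>x. \<phi> x *\<^sub>R u x)"
  proof
    fix x show "\<phi> x *\<^sub>R (indicator S x *\<^sub>R u x) = \<phi> x *\<^sub>R u x"
      using \<phi>(2)[of x] by (cases "x \<in> S") auto
  qed
  ultimately show ?thesis by (simp only:)
qed

lemma test_function_mult_integrable:
  assumes "test_function \<phi>" "u \<in> L2_loc"
  shows "integrable lebesgue (\<lambda>x. \<phi> x *\<^sub>R u x)"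
proof (rule set_integrable_bounded_mult)
  show "compact (closure {x. \<phi> x \<noteq> 0})" using assms(1) by (simp add: test_function_def)
  then show "set_integrable lebesgue (closure {x. \<phi> x \<noteq> 0}) u"
    by (rule L2_loc_imp_set_integrable[OF assms(2)])
  show "continuous_on UNIV \<phi>" using assms(1) C_diff_imp_continuous by (auto simp: test_function_def)
  show "\<phi> x = 0" if "x \<notin> closure {x. \<phi> x \<noteq> 0}" for x
    using that closure_subset[of "{x. \<phi> x \<noteq> 0}"] by auto
qed

text \<open>A partial derivative of a test function is a test function, so the definition of the weak
  derivative applies twice.\<close>
lemma weak_laplacian:
  assumes u: "sobolev_derivs u D D2" and \<phi>: "test_function \<phi>"
  shows "(LINT x|lebesgue. laplacian \<phi> x *\<^sub>R u x) = (LINT x|lebesgue. \<phi> x *\<^sub>R (\<Sum>i\<in>UNIV. D2 i i x))"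
proof -
  have loc: "u \<in> L2_loc" "D2 i i \<in> L2_loc" for i using u by (auto simp: sobolev_derivs_def)
  have \<phi>1: "test_function (partial_deriv i \<phi>)" for i using test_function_partial_deriv[OF \<phi>] .
  have \<phi>2: "test_function (partial_deriv i (partial_deriv i \<phi>))" for i using test_function_partial_deriv[OF \<phi>1] .
  have "(LINT x|lebesgue. partial_deriv i (partial_deriv i \<phi>) x *\<^sub>R u x) = - (LINT x|lebesgue. partial_deriv i \<phi> x *\<^sub>R D i x)" for i
    using u \<phi>1 by (auto simp: sobolev_derivs_def weak_partial_def)
  moreover have "(LINT x|lebesgue. partial_deriv i \<phi> x *\<^sub>R D i x) = - (LINT x|lebesgue. \<phi> x *\<^sub>R D2 i i x)" for i
    using u \<phi> by (auto simp: sobolev_derivs_def weak_partial_def)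
  ultimately have *: "(LINT x|lebesgue. partial_deriv i (partial_deriv i \<phi>) x *\<^sub>R u x) = (LINT x|lebesgue. \<phi> x *\<^sub>R D2 i i x)" for i
    by simp
  have "(LINT x|lebesgue. laplacian \<phi> x *\<^sub>R u x) = (\<Sum>i\<in>UNIV. LINT x|lebesgue. partial_deriv i (partial_deriv i \<phi>) x *\<^sub>R u x)"
    unfolding laplacian_def scaleR_sum_left
    by (intro Bochner_Integration.integral_sum test_function_mult_integrable[OF \<phi>2 loc(1)])
  also have "\<dots> = (\<Sum>i\<in>UNIV. LINT x|lebesgue. \<phi> x *\<^sub>R D2 i i x)" by (simp add: *)
  also have "\<dots> = (LINT x|lebesgue. \<phi> x *\<^sub>R (\<Sum>i\<in>UNIV. D2 i i x))"
    unfolding scaleR_sum_right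
    by (intro Bochner_Integration.integral_sum[symmetric] test_function_mult_integrable[OF \<phi> loc(2)])
  finally show ?thesis .
qed

lemma set_integrable_sum_L2_loc:
  fixes f :: "'i \<Rightarrow> real ^ 'n \<Rightarrow> complex"
  assumes f: "\<And>i. i \<in> I \<Longrightarrow> f i \<in> L2_loc" and S: "compact S"
  shows "set_integrable lebesgue S (\<lambda>x. \<Sum>i\<in>I. f i x)"
  unfolding set_integrable_def scaleR_sum_right
  using L2_loc_imp_set_integrable[OF f S]
  by (intro Bochner_Integration.integrable_sum) (simp add: set_integrable_def)

context kernel_pair
begin

text \<open>The powers of \<open>r\<close> are chosen such that \<open>eta r\<close> has integral 1 and the Laplacian of
  \<open>kap r\<close> is \<open>eta r - eta (r / 2)\<close>.\<close>
definition kap :: "real \<Rightarrow> real ^ 'n \<Rightarrow> real" where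
  "kap r z = r\<^sup>2 * (1 / r) ^ CARD('n) * \<kappa> ((1 / r) *\<^sub>R z)"

definition eta :: "real \<Rightarrow> real ^ 'n \<Rightarrow> real" where
  "eta r z = (1 / r) ^ CARD('n) * \<eta> ((1 / r) *\<^sub>R z)"

lemma kappa_cont: "continuous_on UNIV \<kappa>"
  by (rule C_diff_imp_continuous[OF C_diff_kappa])

lemma kap_cont: "continuous_on UNIV (kap r)"
  unfolding kap_def[abs_def]
  by (intro continuous_intros continuous_on_compose2[OF kappa_cont]) auto

lemma eta_scaled_cont: "continuous_on UNIV (eta r)"
  unfolding eta_def[abs_def]
  by (intro continuous_intros continuous_on_compose2[OF eta_cont]) auto

lemma kap_zero: "r > 0 \<Longrightarrow> norm z \<ge> r \<Longrightarrow> kap r z = 0"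
  by (simp add: kap_def kappa_zero)

lemma eta_scaled_zero: "r > 0 \<Longrightarrow> norm z \<ge> r \<Longrightarrow> eta r z = 0"
  by (simp add: eta_def eta_zero)

lemma kap_nonneg: "r > 0 \<Longrightarrow> kap r z \<ge> 0"
  by (simp add: kap_def kappa_nonneg)

lemma eta_scaled_nonneg: "r > 0 \<Longrightarrow> eta r z \<ge> 0"
  by (simp add: eta_def eta_nonneg)

lemma kap_minus: "kap r (- z) = kap r z"
  by (simp add: kap_def kappa_minus)

lemma kap_affine: "(\<lambda>y. kap r (x - y)) = (\<lambda>y. (r\<^sup>2 * (1 / r) ^ CARD('n)) * \<kappa> ((- 1 / r) *\<^sub>R y + (1 / r) *\<^sub>R x))"
  by (simp add: kap_def[abs_def] scaleR_right_diff_distrib)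

lemma test_function_kap:
  assumes "r > 0"
  shows "test_function (\<lambda>y. kap r (x - y))"
  unfolding test_function_def
proof
  show "\<forall>m. C_diff m (\<lambda>y. kap r (x - y))"
    unfolding kap_affine by (intro allI C_diff_mult[OF C_diff_const C_diff_affine[OF C_diff_kappa]])
  have "closure {y. kap r (x - y) \<noteq> 0} \<subseteq> cball x r"
  proof (rule closure_minimal)
    show "{y. kap r (x - y) \<noteq> 0} \<subseteq> cball x r"
      using kap_zero[OF assms] by (force simp: dist_norm)
  qed auto
  then show "compact (closure {y. kap r (x - y) \<noteq> 0})"
    using compact_Int_closed[of "cball x r" "closure {y. kap r (x - y) \<noteq> 0}"] by (simp add: Int_absorb1)
qed

lemma laplacian_kap:
  assumes "r > 0"
  shows "laplacian (\<lambda>y. kap r (x - y)) y = eta r (x - y) - eta (r / 2) (x - y)"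
proof -
  let ?b = "r\<^sup>2 * (1 / r) ^ CARD('n)" and ?z = "(- 1 / r) *\<^sub>R y + (1 / r) *\<^sub>R x"
  have p1: "partial_deriv i (\<lambda>y. ?b * \<kappa> ((- 1 / r) *\<^sub>R y + (1 / r) *\<^sub>R x))
      = (\<lambda>y. (?b * (- 1 / r)) * partial_deriv i \<kappa> ((- 1 / r) *\<^sub>R y + (1 / r) *\<^sub>R x))" for i
    by (rule ext) (rule partial_deriv_affine[OF C_diff_kappa])
  have p2: "partial_deriv i (\<lambda>y. (?b * (- 1 / r)) * partial_deriv i \<kappa> ((- 1 / r) *\<^sub>R y + (1 / r) *\<^sub>R x)) y
      = ?b * (- 1 / r) * (- 1 / r) * partial_deriv i (partial_deriv i \<kappa>) ?z" for i
    by (rule partial_deriv_affine[OF C_diff_SucE(2)[OF C_diff_kappa]])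
  have "laplacian (\<lambda>y. kap r (x - y)) y = ?b * (- 1 / r) * (- 1 / r) * laplacian \<kappa> ?z"
    unfolding kap_affine laplacian_def p1 p2 by (simp add: sum_distrib_left)
  also have "?b * (- 1 / r) * (- 1 / r) = (1 / r) ^ CARD('n)"
    using assms by (simp add: field_simps power2_eq_square)
  also have "laplacian \<kappa> ?z = \<eta> ?z - 2 ^ CARD('n) * \<eta> (2 *\<^sub>R ?z)" by (rule laplacian_kappa)
  also have "?z = (1 / r) *\<^sub>R (x - y)" by (simp add: scaleR_right_diff_distrib)
  also have "(1 / r) ^ CARD('n) * (\<eta> ((1 / r) *\<^sub>R (x - y)) - 2 ^ CARD('n) * \<eta> (2 *\<^sub>R ((1 / r) *\<^sub>R (x - y))))
      = eta r (x - y) - eta (r / 2) (x - y)"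
    by (simp add: eta_def power_divide right_diff_distrib)
  finally show ?thesis .
qed

definition kap_sum :: "real \<Rightarrow> nat \<Rightarrow> real ^ 'n \<Rightarrow> real" where
  "kap_sum s N z = (\<Sum>n<N. kap (s / 2 ^ n) z)"

text \<open>Testing the equation with \<open>y \<mapsto> kap (s / 2\<^sup>n) (x - y)\<close> turns the Laplacian into a difference of two
  consecutive mollifications; the sum over \<open>n\<close> telescopes.\<close>
lemma mollified_equation:
  assumes u: "sobolev_derivs u D D2" and s: "s > 0"
  shows "(LINT y|lebesgue. (eta s (x - y) - eta (s / 2 ^ N) (x - y)) *\<^sub>R u y)
     = (LINT y|lebesgue. kap_sum s N (x - y) *\<^sub>R (\<Sum>i\<in>UNIV. D2 i i y))"
proof -
  have s': "s / 2 ^ n > 0" for n using s by simp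
  let ?f = "\<lambda>y. \<Sum>i\<in>UNIV. D2 i i y"
  have loc: "u \<in> L2_loc" "D2 i i \<in> L2_loc" for i using u by (auto simp: sobolev_derivs_def)
  have int1: "integrable lebesgue (\<lambda>y. laplacian (\<lambda>y. kap (s / 2 ^ n) (x - y)) y *\<^sub>R u y)" for n
    unfolding laplacian_def scaleR_sum_left
    by (intro Bochner_Integration.integrable_sum test_function_mult_integrable test_function_partial_deriv
        test_function_kap s' loc)
  have int2: "integrable lebesgue (\<lambda>y. kap (s / 2 ^ n) (x - y) *\<^sub>R ?f y)" for n
    unfolding scaleR_sum_right
    by (intro Bochner_Integration.integrable_sum test_function_mult_integrable test_function_kap s' loc)
  have tel: "eta s z - eta (s / 2 ^ N) z = (\<Sum>n<N. eta (s / 2 ^ n) z - eta (s / 2 ^ n / 2) z)" for z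
    using sum_lessThan_telescope'[of "\<lambda>n. eta (s / 2 ^ n) z" N] by (simp add: mult.commute)
  have "(LINT y|lebesgue. (eta s (x - y) - eta (s / 2 ^ N) (x - y)) *\<^sub>R u y)
      = (LINT y|lebesgue. (\<Sum>n<N. laplacian (\<lambda>y. kap (s / 2 ^ n) (x - y)) y *\<^sub>R u y))"
    by (simp only: tel laplacian_kap[OF s'] scaleR_sum_left)
  also have "\<dots> = (\<Sum>n<N. LINT y|lebesgue. laplacian (\<lambda>y. kap (s / 2 ^ n) (x - y)) y *\<^sub>R u y)"
    by (rule Bochner_Integration.integral_sum[OF int1])
  also have "\<dots> = (\<Sum>n<N. LINT y|lebesgue. kap (s / 2 ^ n) (x - y) *\<^sub>R ?f y)"
    by (simp only: weak_laplacian[OF u test_function_kap[OF s']])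
  also have "\<dots> = (LINT y|lebesgue. (\<Sum>n<N. kap (s / 2 ^ n) (x - y) *\<^sub>R ?f y))"
    by (rule Bochner_Integration.integral_sum[OF int2, symmetric])
  finally show ?thesis by (simp only: kap_sum_def scaleR_sum_left)
qed

end

section \<open>Approximate identities and Borel representatives\<close>

lemma nn_integral_lborel_shift:
  fixes a :: "'a::euclidean_space"
  assumes [measurable]: "f \<in> borel_measurable borel"
  shows "(\<integral>\<^sup>+x. f (a + x) \<partial>lborel) = (\<integral>\<^sup>+x. f x \<partial>lborel)"
  by (subst (2) lborel_distr_plus[of a, symmetric]) (simp add: nn_integral_distr)

lemma integral_lborel_shift:
  fixes a :: "'a::euclidean_space" and f :: "'a \<Rightarrow> 'b::{banach, second_countable_topology}"
  assumes [measurable]: "f \<in> borel_measurable borel"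
  shows "(LINT x|lborel. f (a + x)) = (LINT x|lborel. f x)"
  by (subst (2) lborel_distr_plus[of a, symmetric]) (simp add: integral_distr)

lemma AE_lborel_shift:
  fixes a :: "'a::euclidean_space"
  assumes "AE x in lborel. P x"
  shows "AE x in lborel. P (a + x)"
proof (rule AE_distrD[of "(+) a" lborel borel])
  show "AE x in distr lborel borel ((+) a). P x" unfolding lborel_distr_plus by (rule assms)
qed simp

lemma AE_not_in_box_frontier: "AE x in lborel. x \<notin> cbox a b - box a (b :: 'a::euclidean_space)"
proof (rule AE_not_in)
  have "cbox a b - box a b \<in> sets borel" by simp
  moreover have "cbox a b - box a b \<in> null_sets lebesgue"
    using negligible_frontier_interval negligible_iff_null_sets by blast
  ultimately show "cbox a b - box a b \<in> null_sets lborel"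
    by (auto simp: null_sets_def)
qed

text \<open>The sets over which \<open>h\<close> integrates to 0 form a Dynkin system, and the boxes are an
  intersection-stable generator of the Borel sets.\<close>
lemma lborel_AE_eq_0_of_boxes:
  fixes h :: "'a::euclidean_space \<Rightarrow> complex"
  assumes h: "integrable lborel h"
    and box: "\<And>a b. (LINT x|lborel. indicator (box a b) x *\<^sub>R h x) = 0"
  shows "AE x in lborel. h x = 0"
proof (rule sigma_finite_measure.density_zero[OF sigma_finite_lborel h])
  have int: "set_integrable lborel A h" if "A \<in> sets borel" for A
    unfolding set_integrable_def using that by (intro integrable_mult_indicator h) auto
  have total: "(LINT x|lborel. h x) = 0"
  proof -
    let ?B = "\<lambda>n::nat. box (- (real n *\<^sub>R One)) (real n *\<^sub>R One) :: 'a set"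
    have "(\<lambda>n. LINT x|lborel. indicator (?B n) x *\<^sub>R h x) \<longlonglongrightarrow> (LINT x|lborel. h x)"
    proof (rule integral_dominated_convergence[where w="\<lambda>x. norm (h x)"])
      show "AE x in lborel. (\<lambda>n. indicator (?B n) x *\<^sub>R h x) \<longlonglongrightarrow> h x"
      proof (rule AE_I2)
        fix x :: 'a
        obtain N :: nat where N: "norm x < N" using reals_Archimedean2 by blast
        have "x \<in> ?B n" if "n \<ge> N" for n
        proof -
          have "\<bar>x \<bullet> i\<bar> < real n" if "i \<in> Basis" for i
            using Basis_le_norm[OF that, of x] N \<open>n \<ge> N\<close> by (meson le_less_trans less_le_trans of_nat_mono)
          then show ?thesis by (force simp: box_def abs_less_iff)
        qed
        then have "\<forall>\<^sub>F n in sequentially. h x = indicator (?B n) x *\<^sub>R h x"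
          by (auto simp: eventually_sequentially intro!: exI[of _ N])
        then show "(\<lambda>n. indicator (?B n) x *\<^sub>R h x) \<longlonglongrightarrow> h x"
          by (rule Lim_transform_eventually[OF tendsto_const])
      qed
      show "h \<in> borel_measurable lborel" using h by simp
      then show "(\<lambda>x. indicator (?B n) x *\<^sub>R h x) \<in> borel_measurable lborel" for n by simp
      show "integrable lborel (\<lambda>x. norm (h x))" using h by simp
      show "AE x in lborel. norm (indicator (?B n) x *\<^sub>R h x) \<le> norm (h x)" for n
        by (intro AE_I2) (auto simp: indicator_def)
    qed
    then show ?thesis by (simp add: box LIMSEQ_const_iff)
  qed
  fix A assume "A \<in> sets (lborel :: 'a measure)"
  then have A: "A \<in> sigma_sets UNIV (range (\<lambda>(a, b). box a b :: 'a set))"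
    by (simp add: borel_eq_box)
  have sets: "sigma_sets UNIV (range (\<lambda>(a, b). box a b :: 'a set)) = sets borel"
    by (simp add: borel_eq_box)
  have "Int_stable (range (\<lambda>(a, b). box a b :: 'a set))"
    by (auto simp: Int_stable_def box_Int_box)
  moreover have "range (\<lambda>(a, b). box a b :: 'a set) \<subseteq> Pow UNIV" by simp
  ultimately show "set_lebesgue_integral lborel A h = 0"
    using A
  proof (induction rule: sigma_sets_induct_disjoint)
    case (basic A)
    then show ?case using box by (auto simp: set_lebesgue_integral_def)
  next
    case (compl A)
    then have A: "A \<in> sets borel" by (simp add: sets)
    have "(LINT x|lborel. h x) = set_lebesgue_integral lborel A h + set_lebesgue_integral lborel (UNIV - A) h"
      using set_integral_Un[OF _ int[OF A] int[of "UNIV - A"]] A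
      by (simp add: set_lebesgue_integral_def)
    with compl total show ?case by simp
  next
    case (union A)
    then have "A i \<in> sets borel" for i using sets by auto
    then have "(LINT x:(\<Union>i. A i)|lborel. h x) = (\<Sum>i. (LINT x:(A i)|lborel. h x))"
      using union(1) by (intro lebesgue_integral_countable_add int) (auto simp: disjoint_family_on_def)
    with union show ?case by simp
  qed (auto simp: set_lebesgue_integral_def)
qed

text \<open>The product of Lebesgue measures on the completed \<open>\<sigma>\<close>-algebras is not complete, so Fubini's theorem is
  used for Borel functions; this lemma supplies them.\<close>
lemma borel_representative:
  fixes u :: "'a::euclidean_space \<Rightarrow> complex"
  assumes "u \<in> borel_measurable lebesgue"
  shows "\<exists>v\<in>borel_measurable borel. AE x in lborel. u x = v x"
proof -
  have "(\<lambda>x. Re (u x)) \<in> borel_measurable (completion lborel)" "(\<lambda>x. Im (u x)) \<in> borel_measurable (completion lborel)"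
    using assms by measurable
  then obtain a b where ab: "a \<in> borel_measurable lborel" "b \<in> borel_measurable lborel"
    "AE x in lborel. Re (u x) = a x" "AE x in lborel. Im (u x) = b x"
    using completion_ex_borel_measurable_real[of "\<lambda>x. Re (u x)" lborel]
      completion_ex_borel_measurable_real[of "\<lambda>x. Im (u x)" lborel] by blast
  show ?thesis
  proof (rule bexI)
    show "(\<lambda>x. Complex (a x) (b x)) \<in> borel_measurable borel"
      using ab(1,2) unfolding Complex_eq by simp
    show "AE x in lborel. u x = Complex (a x) (b x)"
      using ab(3,4) by eventually_elim (simp add: complex_eq_iff)
  qed
qed

abbreviation conv :: "('a::euclidean_space \<Rightarrow> real) \<Rightarrow> ('a \<Rightarrow> complex) \<Rightarrow> 'a \<Rightarrow> complex" where
  "conv \<phi> h x \<equiv> LINT y|lborel. \<phi> (x - y) *\<^sub>R h y"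

text \<open>By Tonelli and translation invariance the double integral of the norm is the product of the two
  \<open>L\<^sub>1\<close> norms.\<close>
lemma convolution_pair_integrable:
  fixes \<phi> :: "'a::euclidean_space \<Rightarrow> real" and h :: "'a \<Rightarrow> complex"
  assumes \<phi>: "integrable lborel \<phi>" and h: "integrable lborel h"
  shows "integrable (lborel \<Otimes>\<^sub>M lborel) (\<lambda>(x, y). \<phi> (x - y) *\<^sub>R h y)"
proof (rule integrableI_bounded)
  have [measurable]: "\<phi> \<in> borel_measurable borel" "h \<in> borel_measurable borel" using \<phi> h by auto
  show "(\<lambda>(x, y). \<phi> (x - y) *\<^sub>R h y) \<in> borel_measurable (lborel \<Otimes>\<^sub>M lborel)" by measurable
  have "(\<integral>\<^sup>+ z. ennreal (norm ((\<lambda>(x, y). \<phi> (x - y) *\<^sub>R h y) z)) \<partial>(lborel \<Otimes>\<^sub>M lborel))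
      = (\<integral>\<^sup>+ y. (\<integral>\<^sup>+ x. ennreal (norm (\<phi> (x - y) *\<^sub>R h y)) \<partial>lborel) \<partial>lborel)"
    by (subst lborel_pair.nn_integral_snd[symmetric]) auto
  also have "\<dots> = (\<integral>\<^sup>+ y. ennreal (norm (h y)) * (\<integral>\<^sup>+ x. ennreal \<bar>\<phi> x\<bar> \<partial>lborel) \<partial>lborel)"
  proof (intro nn_integral_cong)
    fix y
    have "(\<integral>\<^sup>+ x. ennreal (norm (\<phi> (x - y) *\<^sub>R h y)) \<partial>lborel) = (\<integral>\<^sup>+ x. ennreal (norm (h y)) * ennreal \<bar>\<phi> (- y + x)\<bar> \<partial>lborel)"
      by (simp add: ennreal_mult' mult.commute)
    also have "\<dots> = ennreal (norm (h y)) * (\<integral>\<^sup>+ x. ennreal \<bar>\<phi> (- y + x)\<bar> \<partial>lborel)"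
      by (rule nn_integral_cmult) measurable
    also have "(\<integral>\<^sup>+ x. ennreal \<bar>\<phi> (- y + x)\<bar> \<partial>lborel) = (\<integral>\<^sup>+ x. ennreal \<bar>\<phi> x\<bar> \<partial>lborel)"
      by (rule nn_integral_lborel_shift) measurable
    finally show "(\<integral>\<^sup>+ x. ennreal (norm (\<phi> (x - y) *\<^sub>R h y)) \<partial>lborel)
        = ennreal (norm (h y)) * (\<integral>\<^sup>+ x. ennreal \<bar>\<phi> x\<bar> \<partial>lborel)" .
  qed
  also have "\<dots> = (\<integral>\<^sup>+ y. ennreal (norm (h y)) \<partial>lborel) * (\<integral>\<^sup>+ x. ennreal \<bar>\<phi> x\<bar> \<partial>lborel)"
    by (rule nn_integral_multc) measurable
  also have "\<dots> < \<infinity>"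
    using \<phi> h by (simp add: integrable_iff_bounded ennreal_mult_less_top)
  finally show "(\<integral>\<^sup>+ z. ennreal (norm ((\<lambda>(x, y). \<phi> (x - y) *\<^sub>R h y) z)) \<partial>(lborel \<Otimes>\<^sub>M lborel)) < \<infinity>" .
qed

definition locally_integrable :: "('a::euclidean_space \<Rightarrow> complex) \<Rightarrow> bool" where
  "locally_integrable u \<longleftrightarrow> u \<in> borel_measurable borel \<and> (\<forall>R. integrable lborel (\<lambda>x. indicator (cball 0 R) x *\<^sub>R u x))"

lemma locally_integrable_mult:
  fixes \<phi> :: "real ^ 'n \<Rightarrow> real"
  assumes u: "locally_integrable u" and \<phi>: "continuous_on UNIV \<phi>" "\<And>y. norm (x - y) \<ge> R \<Longrightarrow> \<phi> y = 0"
  shows "integrable lborel (\<lambda>y. \<phi> y *\<^sub>R u y)"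
proof -
  have z: "\<phi> y = 0" if "norm y > norm x + R" for y
    using norm_triangle_ineq2[of y x] that by (intro \<phi>(2)) (simp add: norm_minus_commute)
  obtain B where B: "B \<ge> 0" "\<And>y. \<bar>\<phi> y\<bar> \<le> B"
    using compact_support_bounded[OF \<phi>(1), of "norm x + R + 1"] z by fastforce
  let ?h = "\<lambda>y. indicator (cball 0 (norm x + R)) y *\<^sub>R u y"
  have h: "integrable lborel ?h" using u by (simp add: locally_integrable_def)
  have [measurable]: "\<phi> \<in> borel_measurable borel" "u \<in> borel_measurable borel"
    using \<phi>(1) u by (auto simp: locally_integrable_def borel_measurable_continuous_onI)
  show ?thesis
  proof (rule Bochner_Integration.integrable_bound[OF integrable_mult_right[OF integrable_norm[OF h], of B]])
    show "AE y in lborel. norm (\<phi> y *\<^sub>R u y) \<le> norm (B * norm (?h y))"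
    proof (rule AE_I2)
      fix y
      show "norm (\<phi> y *\<^sub>R u y) \<le> norm (B * norm (?h y))"
        using B z[of y] by (cases "y \<in> cball 0 (norm x + R)") (auto simp: abs_mult intro!: mult_right_mono)
    qed
  qed measurable
qed

context kernel_pair
begin

lemma eta_measurable [measurable]: "eta r \<in> borel_measurable borel"
  by (rule borel_measurable_continuous_onI[OF eta_scaled_cont])

lemma kap_measurable [measurable]: "kap r \<in> borel_measurable borel"
  by (rule borel_measurable_continuous_onI[OF kap_cont])

lemma eta_scaled_integrable: "r > 0 \<Longrightarrow> integrable lborel (eta r)"
  by (rule continuous_compact_support_integrable[OF eta_scaled_cont eta_scaled_zero])

lemma eta_scaled_integral:
  assumes "r > 0"
  shows "(LINT z|lborel. eta r z) = 1"
proof -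
  have [measurable]: "\<eta> \<in> borel_measurable borel"
    by (rule borel_measurable_continuous_onI[OF eta_cont])
  have "(LINT z|lborel. \<eta> z) = (LINT z|density (distr lborel borel (\<lambda>x. 0 + (1 / r) *\<^sub>R x)) (\<lambda>_. ennreal (\<bar>1 / r\<bar> ^ DIM(real ^ 'n))). \<eta> z)"
    using assms by (subst lborel_affine[of "1 / r" 0]) auto
  also have "\<dots> = (LINT z|lborel. eta r z)"
    using assms by (subst integral_density) (auto simp: integral_distr eta_def[abs_def])
  finally show ?thesis using eta_integral by simp
qed

lemma eta_reflect_integral:
  assumes "r > 0"
  shows "integrable lborel (\<lambda>x. eta r (x - y))" "(LINT x|lborel. eta r (x - y)) = 1"
proof -
  show "integrable lborel (\<lambda>x. eta r (x - y))"
  proof (rule continuous_compact_support_integrable[where R="norm y + r"])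
    show "continuous_on UNIV (\<lambda>x. eta r (x - y))"
      by (intro continuous_on_compose2[OF eta_scaled_cont] continuous_intros) auto
    show "eta r (x - y) = 0" if "norm y + r \<le> norm x" for x
      using norm_triangle_ineq2[of x y] that by (intro eta_scaled_zero[OF assms]) simp
  qed
  show "(LINT x|lborel. eta r (x - y)) = 1"
    using integral_lborel_shift[of "eta r" "- y"] eta_scaled_integral[OF assms] by simp
qed

text \<open>After exchanging the integrals the mollifier acts on the indicator of the box, where the limit is
  evident off the frontier. This weak convergence identifies a limit that is known to exist for
  other reasons.\<close>
lemma eta_box_limit:
  assumes u: "locally_integrable u" and s: "s > 0"
  shows "(\<lambda>N. LINT x|lborel. indicator (box a b) x *\<^sub>R conv (eta (s / 2 ^ N)) u x)
     \<longlonglongrightarrow> (LINT x|lborel. indicator (box a b) x *\<^sub>R u x)"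
proof -
  let ?B = "box a b"
  obtain R0 where R0: "\<And>x. x \<in> ?B \<Longrightarrow> norm x \<le> R0"
    using bounded_box[of a b] by (auto simp: bounded_iff)
  define h where "h y = indicator (cball 0 (R0 + s)) y *\<^sub>R u y" for y
  have h: "integrable lborel h" using u by (simp add: locally_integrable_def h_def[abs_def])
  have [measurable]: "h \<in> borel_measurable borel" using h by auto
  define r where "r N = s / 2 ^ N" for N :: nat
  have r: "r N > 0" "r N \<le> s" for N using s by (auto simp: r_def divide_le_eq)
  have r0: "r \<longlonglongrightarrow> 0"
    unfolding r_def[abs_def] using LIMSEQ_divide_realpow_zero[of 2 s] by simp
  define J where "J N y = (LINT x|lborel. indicator ?B x * eta (r N) (x - y))" for N y
  have Jint: "integrable lborel (\<lambda>x. indicator ?B x * eta (r N) (x - y))" for N y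
    using integrable_mult_indicator[OF _ eta_reflect_integral(1)[OF r(1)], of ?B] by simp
  have eq: "(LINT x|lborel. indicator ?B x *\<^sub>R conv (eta (r N)) u x) = (LINT y|lborel. J N y *\<^sub>R h y)" for N
  proof -
    have "indicator ?B x *\<^sub>R conv (eta (r N)) u x = (LINT y|lborel. indicator ?B x *\<^sub>R (eta (r N) (x - y) *\<^sub>R h y))" for x
    proof (cases "x \<in> ?B")
      case True
      have "eta (r N) (x - y) *\<^sub>R u y = eta (r N) (x - y) *\<^sub>R h y" for y
      proof (cases "norm (x - y) \<ge> r N")
        case False
        then have "norm y \<le> R0 + s"
          using R0[OF True] r(2)[of N] norm_triangle_ineq2[of y x] by (simp add: norm_minus_commute)
        then show ?thesis by (simp add: h_def)
      qed (simp add: eta_scaled_zero[OF r(1)])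
      then have "conv (eta (r N)) u x = conv (eta (r N)) h x"
        by (intro Bochner_Integration.integral_cong refl)
      with True show ?thesis by simp
    qed simp
    then have "(LINT x|lborel. indicator ?B x *\<^sub>R conv (eta (r N)) u x)
        = (LINT x|lborel. LINT y|lborel. indicator ?B x *\<^sub>R (eta (r N) (x - y) *\<^sub>R h y))" by simp
    also have "\<dots> = (LINT y|lborel. LINT x|lborel. indicator ?B x *\<^sub>R (eta (r N) (x - y) *\<^sub>R h y))"
    proof (rule lborel_pair.Fubini_integral[symmetric])
      have "integrable (lborel \<Otimes>\<^sub>M lborel) (\<lambda>z. indicator (?B \<times> UNIV) z *\<^sub>R (case z of (x, y) \<Rightarrow> eta (r N) (x - y) *\<^sub>R h y))"
        by (intro integrable_mult_indicator convolution_pair_integrable eta_scaled_integrable r h pair_measureI) auto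
      moreover have "(\<lambda>z. indicator (?B \<times> UNIV) z *\<^sub>R (case z of (x, y) \<Rightarrow> eta (r N) (x - y) *\<^sub>R h y))
          = (\<lambda>(x, y). indicator ?B x *\<^sub>R (eta (r N) (x - y) *\<^sub>R h y))"
        by (intro ext) (auto simp: indicator_def)
      ultimately show "integrable (lborel \<Otimes>\<^sub>M lborel) (\<lambda>(x, y). indicator ?B x *\<^sub>R (eta (r N) (x - y) *\<^sub>R h y))"
        by (simp only:)
    qed
    also have "\<dots> = (LINT y|lborel. J N y *\<^sub>R h y)"
      unfolding J_def
    proof (intro Bochner_Integration.integral_cong refl)
      fix y
      show "(LINT x|lborel. indicator ?B x *\<^sub>R (eta (r N) (x - y) *\<^sub>R h y)) = (LINT x|lborel. indicator ?B x * eta (r N) (x - y)) *\<^sub>R h y"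
        using Jint by (subst integral_scaleR_left[symmetric]) auto
    qed
    finally show ?thesis .
  qed
  have J1: "\<bar>J N y\<bar> \<le> 1" for N y
  proof -
    have "J N y \<ge> 0" unfolding J_def
      by (intro integral_nonneg_AE AE_I2) (simp add: eta_scaled_nonneg[OF r(1)])
    moreover have "J N y \<le> (LINT x|lborel. eta (r N) (x - y))"
      unfolding J_def by (intro integral_mono Jint eta_reflect_integral r)
        (auto simp: indicator_def eta_scaled_nonneg[OF r(1)])
    ultimately show ?thesis using eta_reflect_integral(2)[OF r(1)] by simp
  qed
  have Jlim: "(\<lambda>N. J N y) \<longlonglongrightarrow> indicator ?B y" if "y \<notin> cbox a b - ?B" for y
  proof -
    have "\<exists>e>0. (ball y e \<subseteq> ?B \<and> y \<in> ?B) \<or> (ball y e \<inter> ?B = {} \<and> y \<notin> ?B)"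
    proof (cases "y \<in> ?B")
      case True
      then show ?thesis using open_box[of a b] unfolding open_contains_ball by blast
    next
      case False
      then have "y \<in> - cbox a b" using that by auto
      then obtain e where "e > 0" "ball y e \<subseteq> - cbox a b"
        using open_Compl[OF closed_cbox[of a b]] unfolding open_contains_ball by blast
      with False show ?thesis using box_subset_cbox[of a b] by blast
    qed
    then obtain e where e: "e > 0" "(ball y e \<subseteq> ?B \<and> y \<in> ?B) \<or> (ball y e \<inter> ?B = {} \<and> y \<notin> ?B)" by blast
    have "J N y = indicator ?B y" if "r N < e" for N
    proof -
      have "indicator ?B x * eta (r N) (x - y) = indicator ?B y * eta (r N) (x - y)" for x
      proof (cases "norm (x - y) \<ge> r N")
        case False
        then have "x \<in> ball y e" using that by (simp add: dist_norm norm_minus_commute)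
        with e(2) show ?thesis by (auto simp: indicator_def)
      qed (simp add: eta_scaled_zero[OF r(1)])
      then have "J N y = (LINT x|lborel. indicator ?B y * eta (r N) (x - y))"
        unfolding J_def by (intro Bochner_Integration.integral_cong refl)
      then show ?thesis using eta_reflect_integral(2)[OF r(1)] by simp
    qed
    moreover have "\<forall>\<^sub>F N in sequentially. r N < e" using order_tendstoD(2)[OF r0 e(1)] .
    ultimately have "\<forall>\<^sub>F N in sequentially. indicator ?B y = J N y" by (auto elim!: eventually_mono)
    then show ?thesis by (rule Lim_transform_eventually[OF tendsto_const])
  qed
  have "(\<lambda>N. LINT y|lborel. J N y *\<^sub>R h y) \<longlonglongrightarrow> (LINT y|lborel. indicator ?B y *\<^sub>R h y)"
  proof (rule integral_dominated_convergence[where w="\<lambda>y. norm (h y)"])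
    show "integrable lborel (\<lambda>y. norm (h y))" using h by simp
    show "(\<lambda>y. indicator ?B y *\<^sub>R h y) \<in> borel_measurable lborel" by measurable
    show "(\<lambda>y. J N y *\<^sub>R h y) \<in> borel_measurable lborel" for N
      unfolding J_def by measurable
    show "AE y in lborel. norm (J N y *\<^sub>R h y) \<le> norm (h y)" for N
      using J1[of N] by (intro AE_I2) (simp add: mult_left_le_one_le)
    have "AE y in lborel. y \<notin> cbox a b - ?B"
    by (rule AE_not_in_box_frontier)
    then show "AE y in lborel. (\<lambda>N. J N y *\<^sub>R h y) \<longlonglongrightarrow> indicator ?B y *\<^sub>R h y"
      by (rule eventually_mono) (intro tendsto_scaleR Jlim tendsto_const)
  qed
  moreover have "indicator ?B y *\<^sub>R h y = indicator ?B y *\<^sub>R u y" for y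
    using R0[of y] s by (auto simp: h_def indicator_def)
  ultimately show ?thesis using eq by (simp add: r_def)
qed

end

section \<open>The kernel and its integrals against weights\<close>

text \<open>This replaces Hoelder's inequality: a weight is bounded by a constant plus a multiple of its
  \<open>q\<close>-th power, and the threshold \<open>t\<close> remains free.\<close>
lemma young_split:
  fixes m t q :: real
  assumes "m \<ge> 0" "t > 0" "q \<ge> 1"
  shows "m \<le> t + t powr (1 - q) * m powr q"
proof (cases "m \<le> t")
  case True
  then show ?thesis by (simp add: add_increasing2)
next
  case False
  then have "m = m powr (1 - q) * m powr q" using assms by (simp flip: powr_add)
  also have "\<dots> \<le> t powr (1 - q) * m powr q"
    using False assms by (intro mult_right_mono powr_mono2') auto
  finally show ?thesis using assms by simp
qed

context kernel_pair
begin

lemma kap_bound: "\<exists>C\<ge>0. \<forall>r>0. \<forall>z. kap r z \<le> C * r powr (2 - real CARD('n)) * indicator (ball 0 r) z"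
proof -
  obtain C where C: "C \<ge> 0" "\<And>z. \<bar>\<kappa> z\<bar> \<le> C"
    using compact_support_bounded[OF kappa_cont kappa_zero] by blast
  then have C': "\<kappa> z \<le> C" for z by (meson abs_le_D1)
  have "kap r z \<le> C * r powr (2 - real CARD('n)) * indicator (ball 0 r) z" if r: "r > 0" for r z
  proof (cases "norm z < r")
    case True
    have "r\<^sup>2 * (1 / r) ^ CARD('n) = r powr (2 - real CARD('n))"
      using r by (simp add: powr_diff powr_realpow powr_numeral power_divide field_simps)
    then have "kap r z = r powr (2 - real CARD('n)) * \<kappa> ((1 / r) *\<^sub>R z)" by (simp add: kap_def)
    also have "\<dots> \<le> r powr (2 - real CARD('n)) * C" by (intro mult_left_mono C') simp
    finally show ?thesis using True by (simp add: mult.commute)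
  qed (use kap_zero[OF r, of z] in auto)
  then show ?thesis using C(1) by blast
qed

definition kap_const :: real where
  "kap_const = (SOME C. C \<ge> 0 \<and> (\<forall>r>0. \<forall>z. kap r z \<le> C * r powr (2 - real CARD('n)) * indicator (ball 0 r) z))"

lemma kap_const: "kap_const \<ge> 0" "r > 0 \<Longrightarrow> kap r z \<le> kap_const * r powr (2 - real CARD('n)) * indicator (ball 0 r) z"
  using someI_ex[OF kap_bound[unfolded Bex_def]] unfolding kap_const_def by auto

definition weight_const :: "real \<Rightarrow> (real ^ 'n \<Rightarrow> real) \<Rightarrow> real" where
  "weight_const q M = kap_const * (unit_ball_vol CARD('n) + (LINT y|lborel. M y powr q))"

definition weight :: "real \<Rightarrow> (real ^ 'n \<Rightarrow> real) \<Rightarrow> bool" where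
  "weight q M \<longleftrightarrow> M \<in> borel_measurable borel \<and> (\<forall>y. M y \<ge> 0) \<and> integrable lborel (\<lambda>y. M y powr q)"

lemma weight_const_nonneg: "weight_const q M \<ge> 0"
  unfolding weight_const_def using kap_const(1)
  by (intro mult_nonneg_nonneg add_nonneg_nonneg integral_nonneg_AE) auto

text \<open>The threshold \<open>t = r\<^bsup>-d/q\<^esup>\<close> makes the contribution \<open>t r\<^sup>d\<close> of the ball and the contribution
  \<open>t\<^bsup>1-q\<^esup>\<close> of the \<open>q\<close>-th power equal, namely \<open>r\<^bsup>d - d/q\<^esup>\<close>.\<close>
lemma kap_weight_bound:
  assumes M: "weight q M" and q: "q \<ge> 1" and r: "r > 0"
  shows "(\<integral>\<^sup>+y. ennreal (kap r (z - y) * M y) \<partial>lborel) \<le> ennreal (weight_const q M * r powr (2 - CARD('n) / q))"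
proof -
  have [measurable]: "M \<in> borel_measurable borel" and M0: "\<And>y. M y \<ge> 0"
    and MI: "integrable lborel (\<lambda>y. M y powr q)" using M by (auto simp: weight_def)
  let ?d = "real CARD('n)"
  define t where "t = r powr (- ?d / q)"
  have t: "t > 0" using r by (simp add: t_def)
  let ?c = "kap_const * r powr (2 - ?d)"
  have c: "?c \<ge> 0" using kap_const(1) by simp
  have pt: "kap r (z - y) * M y \<le> ?c * t * indicator (ball z r) y + ?c * t powr (1 - q) * M y powr q" for y
  proof -
    have b: "indicator (ball 0 r) (z - y) = (indicator (ball z r) y :: real)"
      by (auto simp: indicator_def dist_norm norm_minus_commute)
    have "kap r (z - y) * M y \<le> ?c * indicator (ball z r) y * M y"
      using kap_const(2)[OF r, of "z - y"] M0[of y] unfolding b by (intro mult_right_mono) auto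
    also have "\<dots> \<le> ?c * indicator (ball z r) y * (t + t powr (1 - q) * M y powr q)"
      using c by (intro mult_left_mono young_split M0 t q) auto
    also have "\<dots> \<le> ?c * t * indicator (ball z r) y + ?c * t powr (1 - q) * M y powr q"
      using kap_const(1) t by (auto simp: indicator_def algebra_simps)
    finally show ?thesis .
  qed
  define A E I where "A = ?c * t" and "E = ?c * t powr (1 - q)" and "I = (LINT y|lborel. M y powr q)"
  have I: "I \<ge> 0" unfolding I_def by (intro integral_nonneg_AE) auto
  have AE: "A \<ge> 0" "E \<ge> 0" using c t by (auto simp: A_def E_def)
  have "ennreal (kap r (z - y) * M y) \<le> ennreal A * indicator (ball z r) y + ennreal E * ennreal (M y powr q)" for y
  proof -
    have "ennreal (kap r (z - y) * M y) \<le> ennreal (A * indicator (ball z r) y + E * M y powr q)"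
      by (rule ennreal_leI[OF pt[of y, folded A_def E_def]])
    moreover have "ennreal (A * indicator (ball z r) y) = ennreal A * indicator (ball z r) y"
      by (cases "y \<in> ball z r") auto
    moreover have "ennreal (E * M y powr q) = ennreal E * ennreal (M y powr q)"
      by (rule ennreal_mult'') simp
    moreover have "A * indicator (ball z r) y \<ge> 0" "E * M y powr q \<ge> 0"
      using AE by auto
    ultimately show ?thesis by (simp only: ennreal_plus)
  qed
  then have le: "(\<integral>\<^sup>+y. ennreal (kap r (z - y) * M y) \<partial>lborel)
      \<le> (\<integral>\<^sup>+y. ennreal A * indicator (ball z r) y + ennreal E * ennreal (M y powr q) \<partial>lborel)"
    by (intro nn_integral_mono)
  define v where "v = unit_ball_vol ?d * r ^ CARD('n)"
  have v: "v \<ge> 0" using r by (simp add: v_def)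
  have [measurable]: "ball z r \<in> sets borel" by simp
  have vol: "emeasure lborel (ball z r) = ennreal v"
    using emeasure_ball[of r z] r by (simp add: v_def)
  have MI': "(\<integral>\<^sup>+y. ennreal (M y powr q) \<partial>lborel) = ennreal I"
    unfolding I_def by (intro nn_integral_eq_integral[OF MI] AE_I2) (rule powr_ge_zero)
  have eq: "(\<integral>\<^sup>+y. ennreal A * indicator (ball z r) y + ennreal E * ennreal (M y powr q) \<partial>lborel)
      = ennreal (A * v + E * I)"
  proof -
    have "(\<integral>\<^sup>+y. ennreal A * indicator (ball z r) y + ennreal E * ennreal (M y powr q) \<partial>lborel)
        = ennreal A * ennreal v + ennreal E * ennreal I"
    proof -
      have "(\<integral>\<^sup>+y. ennreal A * indicator (ball z r) y + ennreal E * ennreal (M y powr q) \<partial>lborel)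
        = (\<integral>\<^sup>+y. ennreal A * indicator (ball z r) y \<partial>lborel) + (\<integral>\<^sup>+y. ennreal E * ennreal (M y powr q) \<partial>lborel)"
        by (rule nn_integral_add) measurable
      moreover have "(\<integral>\<^sup>+y. ennreal A * indicator (ball z r) y \<partial>lborel) = ennreal A * emeasure lborel (ball z r)"
        by (rule nn_integral_cmult_indicator) simp
      moreover have "(\<integral>\<^sup>+y. ennreal E * ennreal (M y powr q) \<partial>lborel) = ennreal E * (\<integral>\<^sup>+y. ennreal (M y powr q) \<partial>lborel)"
        by (rule nn_integral_cmult) measurable
      ultimately show ?thesis by (simp only: vol MI')
    qed
    moreover have "ennreal A * ennreal v = ennreal (A * v)"
      by (rule ennreal_mult'[symmetric, OF AE(1)])
    moreover have "ennreal E * ennreal I = ennreal (E * I)"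
      by (rule ennreal_mult'[symmetric, OF AE(2)])
    moreover have "A * v \<ge> 0" "E * I \<ge> 0"
      using AE I v by (auto intro!: mult_nonneg_nonneg)
    ultimately show ?thesis by (simp only: ennreal_plus)
  qed
  have 1: "r powr (2 - ?d) * t * r ^ CARD('n) = r powr (2 - ?d / q)"
    using r by (simp add: t_def powr_realpow[symmetric] flip: powr_add)
  have 2: "r powr (2 - ?d) * t powr (1 - q) = r powr (2 - ?d / q)"
  proof -
    have "2 - ?d + - ?d / q * (1 - q) = 2 - ?d / q" using q by (simp add: field_simps)
    then show ?thesis unfolding t_def powr_powr powr_add[symmetric] by (rule arg_cong)
  qed
  have "A * v + E * I
    = kap_const * (unit_ball_vol ?d * (r powr (2 - ?d) * t * r ^ CARD('n)) + I * (r powr (2 - ?d) * t powr (1 - q)))"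
    by (simp add: v_def A_def E_def algebra_simps)
  then have "A * v + E * I = weight_const q M * r powr (2 - ?d / q)"
    unfolding 1 2 by (simp add: weight_const_def I_def algebra_simps)
  with le eq show ?thesis by simp
qed

text \<open>A truncated fundamental solution of the Laplacian, up to sign. For \<open>z \<noteq> 0\<close> the sum is finite;
  at the origin it may diverge, and the value there is set to 0.\<close>
definition ker :: "real \<Rightarrow> real ^ 'n \<Rightarrow> real" where
  "ker s z = (if z = 0 then 0 else (\<Sum>n. kap (s / 2 ^ n) z))"

lemma ker_measurable [measurable]: "ker s \<in> borel_measurable borel"
  unfolding ker_def[abs_def] by measurable

lemma kap_sum_measurable [measurable]: "kap_sum s N \<in> borel_measurable borel"
  unfolding kap_sum_def[abs_def] by measurable

lemma ker_minus: "ker s (- z) = ker s z"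
  by (simp add: ker_def kap_minus)

lemma kap_eventually_zero:
  assumes "s > 0" "z \<noteq> 0"
  shows "\<exists>N. \<forall>n\<ge>N. kap (s / 2 ^ n) z = 0"
proof -
  obtain N where N: "s / norm z < 2 ^ N" using real_arch_pow[of 2 "s / norm z"] by auto
  have "kap (s / 2 ^ n) z = 0" if "n \<ge> N" for n
  proof (rule kap_zero)
    have "s / norm z < 2 ^ n" using N that by (meson less_le_trans one_le_numeral power_increasing)
    then show "s / 2 ^ n \<le> norm z" using assms by (simp add: field_simps)
  qed (use assms in simp)
  then show ?thesis by blast
qed

lemma kap_summable:
  assumes "s > 0" "z \<noteq> 0"
  shows "summable (\<lambda>n. kap (s / 2 ^ n) z)"
proof -
  obtain N where "\<forall>n\<ge>N. kap (s / 2 ^ n) z = 0" using kap_eventually_zero[OF assms] by blast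
  then show ?thesis by (intro summable_finite[of "{..<N}"]) auto
qed

lemma ker_nonneg: "s > 0 \<Longrightarrow> ker s z \<ge> 0"
  by (auto simp: ker_def intro!: suminf_nonneg kap_summable kap_nonneg)

lemma kap_sum_nonneg: "s > 0 \<Longrightarrow> kap_sum s N z \<ge> 0"
  by (auto simp: kap_sum_def intro!: sum_nonneg kap_nonneg)

text \<open>The tail of the series is the kernel at a smaller scale, so every bound for \<open>ker s\<close> that is
  explicit in \<open>s\<close> is also a bound for the tails.\<close>
lemma ker_split:
  assumes "s > 0" "z \<noteq> 0"
  shows "ker s z = kap_sum s N z + ker (s / 2 ^ N) z"
  using suminf_split_initial_segment[OF kap_summable[OF assms], of N] assms(2)
  by (simp add: ker_def kap_sum_def power_add mult.commute)

lemma kap_sum_le_ker: "s > 0 \<Longrightarrow> z \<noteq> 0 \<Longrightarrow> kap_sum s N z \<le> ker s z"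
  using ker_split[of s z N] ker_nonneg[of "s / 2 ^ N" z] by simp

lemma kap_sum_tendsto_ker: "s > 0 \<Longrightarrow> z \<noteq> 0 \<Longrightarrow> (\<lambda>N. kap_sum s N z) \<longlonglongrightarrow> ker s z"
  using summable_LIMSEQ[OF kap_summable] by (simp add: ker_def kap_sum_def)

lemma kap_dyadic_zero:
  assumes s: "s > 0" "norm z \<ge> s"
  shows "kap (s / 2 ^ n) z = 0"
proof (rule kap_zero)
  have "s / 2 ^ n \<le> s / 1" using s by (intro divide_left_mono) auto
  then show "s / 2 ^ n \<le> norm z" using s by simp
qed (use s in simp)

lemma ker_zero: "s > 0 \<Longrightarrow> norm z \<ge> s \<Longrightarrow> ker s z = 0"
  by (simp add: ker_def kap_dyadic_zero)

lemma kap_sum_zero: "s > 0 \<Longrightarrow> norm z \<ge> s \<Longrightarrow> kap_sum s N z = 0"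
  by (simp add: kap_sum_def kap_dyadic_zero)

definition ker_const :: "real \<Rightarrow> (real ^ 'n \<Rightarrow> real) \<Rightarrow> real" where
  "ker_const q M = weight_const q M / (1 - 2 powr - (2 - CARD('n) / q))"

text \<open>Summing the bounds for the scales \<open>s/2\<^sup>n\<close> gives a geometric series with ratio \<open>2\<^bsup>-(2 - d/q)\<^esup>\<close>, which is
  less than 1 because \<open>q > d/2\<close>.\<close>
lemma ker_weight_bound:
  assumes M: "weight q M" and q: "q \<ge> 1" "q > CARD('n) / 2" and s: "s > 0"
  shows "(\<integral>\<^sup>+y. ennreal (ker s (z - y) * M y) \<partial>lborel) \<le> ennreal (ker_const q M * s powr (2 - CARD('n) / q))"
proof -
  let ?a = "2 - CARD('n) / q" and ?W = "weight_const q M"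
  have a: "?a > 0" using q by (simp add: field_simps)
  have [measurable]: "M \<in> borel_measurable borel" and M0: "\<And>y. M y \<ge> 0"
    using M by (auto simp: weight_def)
  have "(\<integral>\<^sup>+y. ennreal (ker s (z - y) * M y) \<partial>lborel) \<le> (\<integral>\<^sup>+y. (\<Sum>n. ennreal (kap (s / 2 ^ n) (z - y) * M y)) \<partial>lborel)"
  proof (rule nn_integral_mono)
    fix y
    show "ennreal (ker s (z - y) * M y) \<le> (\<Sum>n. ennreal (kap (s / 2 ^ n) (z - y) * M y))"
    proof (cases "z - y = 0")
      case True
      then show ?thesis by (simp add: ker_def)
    next
      case False
      have sm: "summable (\<lambda>n. kap (s / 2 ^ n) (z - y) * M y)"
        by (intro summable_mult2 kap_summable s False)
      have "(\<Sum>n. ennreal (kap (s / 2 ^ n) (z - y) * M y)) = ennreal (\<Sum>n. kap (s / 2 ^ n) (z - y) * M y)"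
        using s M0 by (intro suminf_ennreal2 sm) (simp add: kap_nonneg)
      also have "(\<Sum>n. kap (s / 2 ^ n) (z - y) * M y) = ker s (z - y) * M y"
        using suminf_mult2[OF kap_summable[OF s False], of "M y"] False by (simp add: ker_def)
      finally show ?thesis by simp
    qed
  qed
  also have "\<dots> = (\<Sum>n. \<integral>\<^sup>+y. ennreal (kap (s / 2 ^ n) (z - y) * M y) \<partial>lborel)"
    by (rule nn_integral_suminf) measurable
  also have "\<dots> \<le> (\<Sum>n. ennreal (?W * (s / 2 ^ n) powr ?a))"
    by (intro suminf_le kap_weight_bound M q) (use s in auto)
  also have "\<dots> = (\<Sum>n. ennreal (?W * s powr ?a * (2 powr - ?a) ^ n))"
  proof -
    have "(s / 2 ^ n) powr ?a = s powr ?a * (2 powr - ?a) ^ n" for n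
    proof -
      have "(2 ^ n) powr ?a = (2 powr ?a) ^ n"
        by (simp add: powr_realpow[symmetric] powr_powr powr_power mult.commute)
      moreover have "(2 powr - ?a) ^ n = inverse ((2 powr ?a) ^ n)"
        unfolding powr_minus by (rule power_inverse)
      ultimately show ?thesis
        using s by (simp only: powr_divide) (simp add: divide_inverse)
    qed
    then show ?thesis by (simp add: mult.assoc)
  qed
  also have "\<dots> = ennreal (\<Sum>n. ?W * s powr ?a * (2 powr - ?a) ^ n)"
    using a weight_const_nonneg by (intro suminf_ennreal2 summable_mult summable_geometric) (auto simp: powr_less_one)
  also have "(\<Sum>n. ?W * s powr ?a * (2 powr - ?a) ^ n) = ker_const q M * s powr ?a"
  proof -
    have "norm (2 powr - ?a) < 1" using a by (simp add: powr_less_one)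
    then show ?thesis
      by (subst suminf_mult) (auto simp: summable_geometric suminf_geometric ker_const_def)
  qed
  finally show ?thesis .
qed

text \<open>The weight is the indicator of the supporting ball, with exponent \<open>q = d\<close>.\<close>
lemma ker_integrable:
  assumes "s > 0"
  shows "integrable lborel (ker s)"
proof (rule integrableI_nonneg)
  let ?M = "indicator (cball 0 s) :: real ^ 'n \<Rightarrow> real" and ?d = "real CARD('n)"
  have d: "?d \<ge> 1" by (simp add: Suc_leI)
  have eq: "?M y powr ?d = ?M y" for y by (simp add: indicator_def)
  have M: "weight ?d ?M"
    unfolding weight_def eq
    by (auto intro!: integrable_real_indicator borel_measurable_indicator emeasure_lborel_cball_finite[unfolded infinity_ennreal_def])
  have k: "ker s y = ker s (0 - y) * ?M y" for y
    using ker_zero[OF assms, of y] by (auto simp: ker_minus indicator_def)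
  have "(\<integral>\<^sup>+y. ennreal (ker s y) \<partial>lborel) = (\<integral>\<^sup>+y. ennreal (ker s (0 - y) * ?M y) \<partial>lborel)"
    by (intro nn_integral_cong arg_cong[of _ _ ennreal] k)
  also have "\<dots> \<le> ennreal (ker_const ?d ?M * s powr (2 - CARD('n) / ?d))"
    using d by (intro ker_weight_bound M assms) auto
  also have "\<dots> < \<infinity>" by simp
  finally show "(\<integral>\<^sup>+y. ennreal (ker s y) \<partial>lborel) < \<infinity>" .
qed (use assms in \<open>auto intro: ker_nonneg\<close>)

end

section \<open>The integral equation\<close>

lemma convolution_integrable:
  fixes \<phi> :: "'a::euclidean_space \<Rightarrow> real" and h :: "'a \<Rightarrow> complex"
  assumes \<phi>: "integrable lborel \<phi>" and h: "integrable lborel h"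
  shows "AE x in lborel. integrable lborel (\<lambda>y. \<phi> (x - y) *\<^sub>R h y)"
    and "integrable lborel (\<lambda>x. LINT y|lborel. \<phi> (x - y) *\<^sub>R h y)"
    and "integrable lborel (\<lambda>x. LINT y|lborel. norm (\<phi> (x - y) *\<^sub>R h y))"
proof -
  note int = convolution_pair_integrable[OF \<phi> h]
  show "AE x in lborel. integrable lborel (\<lambda>y. \<phi> (x - y) *\<^sub>R h y)"
    using lborel_pair.AE_integrable_fst'[OF int] by simp
  show "integrable lborel (\<lambda>x. LINT y|lborel. \<phi> (x - y) *\<^sub>R h y)"
    using lborel_pair.integrable_fst'[OF int] by simp
  show "integrable lborel (\<lambda>x. LINT y|lborel. norm (\<phi> (x - y) *\<^sub>R h y))"
    using lborel_pair.integrable_fst'[OF integrable_norm[OF int]] by simp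
qed

lemma AE_lborel_neq: "AE y in lborel. y \<noteq> (c :: 'a::euclidean_space)"
proof -
  have "{c} \<in> null_sets lborel" by (auto simp: null_sets_def)
  then show ?thesis using AE_not_in[of "{c}" lborel] by simp
qed

context kernel_pair
begin

lemma kap_sum_cont: "continuous_on UNIV (kap_sum s N)"
  unfolding kap_sum_def[abs_def] by (intro continuous_on_sum kap_cont)

lemma kap_sum_conv_tendsto:
  fixes h :: "real ^ 'n \<Rightarrow> complex"
  assumes s: "s > 0" and int: "integrable lborel (\<lambda>y. ker s (x - y) *\<^sub>R h y)"
    and [measurable]: "h \<in> borel_measurable borel"
  shows "(\<lambda>N. LINT y|lborel. kap_sum s N (x - y) *\<^sub>R h y) \<longlonglongrightarrow> conv (ker s) h x"
    and "norm (conv (kap_sum s N) h x) \<le> (LINT y|lborel. norm (ker s (x - y) *\<^sub>R h y))"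
proof -
  have bd: "AE y in lborel. norm (kap_sum s N (x - y) *\<^sub>R h y) \<le> norm (ker s (x - y) *\<^sub>R h y)" for N
    using AE_lborel_neq[of x]
  proof (rule eventually_mono)
    fix y assume "y \<noteq> x"
    then have "kap_sum s N (x - y) \<le> ker s (x - y)" by (intro kap_sum_le_ker s) auto
    then show "norm (kap_sum s N (x - y) *\<^sub>R h y) \<le> norm (ker s (x - y) *\<^sub>R h y)"
      using kap_sum_nonneg[OF s, of N "x - y"] by (auto intro!: mult_right_mono)
  qed
  show "(\<lambda>N. LINT y|lborel. kap_sum s N (x - y) *\<^sub>R h y) \<longlonglongrightarrow> conv (ker s) h x"
  proof (rule integral_dominated_convergence[where w="\<lambda>y. norm (ker s (x - y) *\<^sub>R h y)"])
    show "AE y in lborel. (\<lambda>N. kap_sum s N (x - y) *\<^sub>R h y) \<longlonglongrightarrow> ker s (x - y) *\<^sub>R h y"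
      using AE_lborel_neq[of x]
    proof (rule eventually_mono)
      fix y assume "y \<noteq> x"
      then show "(\<lambda>N. kap_sum s N (x - y) *\<^sub>R h y) \<longlonglongrightarrow> ker s (x - y) *\<^sub>R h y"
        by (intro tendsto_scaleR tendsto_const kap_sum_tendsto_ker s) auto
    qed
    show "integrable lborel (\<lambda>y. norm (ker s (x - y) *\<^sub>R h y))" by (rule integrable_norm[OF int])
  qed (measurable, measurable, rule bd)
  have int': "integrable lborel (\<lambda>y. kap_sum s N (x - y) *\<^sub>R h y)"
    by (rule Bochner_Integration.integrable_bound[OF int _ bd]) measurable
  show "norm (conv (kap_sum s N) h x) \<le> (LINT y|lborel. norm (ker s (x - y) *\<^sub>R h y))"
    by (rule order_trans[OF integral_norm_bound integral_mono_AE[OF integrable_norm[OF int'] integrable_norm[OF int] bd]])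
qed

text \<open>As \<open>N \<rightarrow> \<infinity>\<close> the right-hand side of the mollified equation converges almost everywhere by dominated
  convergence, while its left-hand side converges to \<open>u\<close> only in the weak sense of
  \<open>eta_box_limit\<close>. Both limits have the same integral over every box, hence they agree.\<close>
lemma mollified_limit:
  assumes u: "locally_integrable u" and f: "locally_integrable f" and s: "s > 0"
    and eq: "\<And>x N. (LINT y|lborel. (eta s (x - y) - eta (s / 2 ^ N) (x - y)) *\<^sub>R u y)
      = conv (kap_sum s N) f x"
  shows "AE x in lborel. x \<in> box a b \<longrightarrow> integrable lborel (\<lambda>y. ker s (x - y) *\<^sub>R f y) \<and>
     u x = conv (eta s) u x - conv (ker s) f x"
proof -
  let ?B = "box a b"
  obtain R0 where R0: "\<And>x. x \<in> ?B \<Longrightarrow> norm x \<le> R0"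
    using bounded_box[of a b] by (auto simp: bounded_iff)
  have trunc: "\<phi> (x - y) *\<^sub>R v y = \<phi> (x - y) *\<^sub>R (indicator (cball 0 (R0 + s)) y *\<^sub>R v y)"
    if "x \<in> ?B" "\<And>z. norm z \<ge> s \<Longrightarrow> \<phi> z = 0" for \<phi> :: "real ^ 'n \<Rightarrow> real" and v :: "real ^ 'n \<Rightarrow> complex" and x y
  proof (cases "norm (x - y) \<ge> s")
    case False
    then have "norm y \<le> R0 + s"
      using R0[OF that(1)] norm_triangle_ineq2[of y x] by (simp add: norm_minus_commute)
    then show ?thesis by simp
  qed (simp add: that(2))
  \<comment> \<open>On the box, convolutions with kernels supported in the ball of radius \<open>s\<close> see \<open>f\<close> and \<open>u\<close> only
    in a bounded set, so both may be truncated to integrable functions.\<close>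
  define h where "h y = indicator (cball 0 (R0 + s)) y *\<^sub>R f y" for y
  define v where "v y = indicator (cball 0 (R0 + s)) y *\<^sub>R u y" for y
  have h: "integrable lborel h" and v: "integrable lborel v"
    using u f by (auto simp: locally_integrable_def h_def[abs_def] v_def[abs_def])
  have [measurable]: "h \<in> borel_measurable borel" "v \<in> borel_measurable borel" "u \<in> borel_measurable borel"
    using h v u by (auto simp: locally_integrable_def)
  define G where "G x = conv (eta s) v x" for x
  define F where "F x = conv (ker s) h x" for x
  define U where "U N x = conv (eta (s / 2 ^ N)) u x" for N x
  note cG = convolution_integrable[OF eta_scaled_integrable[OF s] v]
  note cF = convolution_integrable[OF ker_integrable[OF s] h]
  have Uint: "integrable lborel (\<lambda>y. eta (s / 2 ^ N) (x - y) *\<^sub>R u y)" for N x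
  proof (rule locally_integrable_mult[OF u])
    show "continuous_on UNIV (\<lambda>y. eta (s / 2 ^ N) (x - y))"
      by (intro continuous_on_compose2[OF eta_scaled_cont] continuous_intros) auto
    show "\<And>y. s / 2 ^ N \<le> norm (x - y) \<Longrightarrow> eta (s / 2 ^ N) (x - y) = 0"
      using s by (intro eta_scaled_zero) auto
  qed
  have U: "U N x = G x - conv (kap_sum s N) h x" if x: "x \<in> ?B" for N x
  proof -
    have "conv (eta s) u x - U N x = (LINT y|lborel. (eta s (x - y) - eta (s / 2 ^ N) (x - y)) *\<^sub>R u y)"
      unfolding U_def scaleR_diff_left using Uint[of 0 x] Uint[of N x]
      by (intro Bochner_Integration.integral_diff[symmetric]) simp_all
    also have "\<dots> = conv (kap_sum s N) f x" by (rule eq)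
    also have "\<dots> = conv (kap_sum s N) h x"
      unfolding h_def by (intro Bochner_Integration.integral_cong refl trunc[OF x] kap_sum_zero s)
    also have "conv (eta s) u x = G x"
      unfolding G_def v_def by (intro Bochner_Integration.integral_cong refl trunc[OF x] eta_scaled_zero s)
    finally show ?thesis by (simp add: algebra_simps)
  qed
  define e where "e x = indicator ?B x *\<^sub>R (u x - (G x - F x))" for x
  have "indicator ?B x *\<^sub>R u x = indicator ?B x *\<^sub>R v x" for x
    using R0[of x] s by (auto simp: indicator_def v_def)
  then have e_eq: "e = (\<lambda>x. indicator ?B x *\<^sub>R v x - indicator ?B x *\<^sub>R (G x - F x))"
    unfolding e_def by (simp add: fun_eq_iff scaleR_diff_right)
  have GF: "integrable lborel (\<lambda>x. G x - F x)"
    unfolding G_def F_def by (intro Bochner_Integration.integrable_diff cG cF)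
  have e: "integrable lborel e"
    unfolding e_eq by (intro Bochner_Integration.integrable_diff integrable_mult_indicator v GF) auto
  have "(LINT x|lborel. indicator (box c d) x *\<^sub>R e x) = 0" for c d
  proof -
    obtain a' b' where ab: "box c d \<inter> ?B = box a' b'" using box_Int_box[of c d a b] by blast
    let ?I = "indicator (box a' b') :: real ^ 'n \<Rightarrow> real"
    have sub: "x \<in> ?B" if "x \<in> box a' b'" for x using that ab by blast
    have l1: "(\<lambda>N. LINT x|lborel. ?I x *\<^sub>R U N x) \<longlonglongrightarrow> (LINT x|lborel. ?I x *\<^sub>R u x)"
      unfolding U_def by (rule eta_box_limit[OF u s])
    have l2: "(\<lambda>N. LINT x|lborel. ?I x *\<^sub>R U N x) \<longlonglongrightarrow> (LINT x|lborel. ?I x *\<^sub>R (G x - F x))"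
    proof (rule integral_dominated_convergence[where w="\<lambda>x. norm (G x) + (LINT y|lborel. norm (ker s (x - y) *\<^sub>R h y))"])
      show "integrable lborel (\<lambda>x. norm (G x) + (LINT y|lborel. norm (ker s (x - y) *\<^sub>R h y)))"
        unfolding G_def by (intro Bochner_Integration.integrable_add integrable_norm cG cF)
      show "(\<lambda>x. ?I x *\<^sub>R (G x - F x)) \<in> borel_measurable lborel"
        by (intro borel_measurable_scaleR borel_measurable_integrable[OF GF]) simp
      show "(\<lambda>x. ?I x *\<^sub>R U N x) \<in> borel_measurable lborel" for N
        unfolding U_def by measurable
      show "AE x in lborel. (\<lambda>N. ?I x *\<^sub>R U N x) \<longlonglongrightarrow> ?I x *\<^sub>R (G x - F x)"
        using cF(1)
      proof (rule eventually_mono)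
        fix x assume int: "integrable lborel (\<lambda>y. ker s (x - y) *\<^sub>R h y)"
        show "(\<lambda>N. ?I x *\<^sub>R U N x) \<longlonglongrightarrow> ?I x *\<^sub>R (G x - F x)"
        proof (cases "x \<in> box a' b'")
          case True
          then show ?thesis using kap_sum_conv_tendsto(1)[OF s int]
            by (simp add: U[OF sub[OF True]] F_def tendsto_intros)
        qed simp
      qed
      show "AE x in lborel. norm (?I x *\<^sub>R U N x) \<le> norm (G x) + (LINT y|lborel. norm (ker s (x - y) *\<^sub>R h y))" for N
        using cF(1)
      proof (rule eventually_mono)
        fix x assume int: "integrable lborel (\<lambda>y. ker s (x - y) *\<^sub>R h y)"
        show "norm (?I x *\<^sub>R U N x) \<le> norm (G x) + (LINT y|lborel. norm (ker s (x - y) *\<^sub>R h y))"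
        proof (cases "x \<in> box a' b'")
          case True
          have "norm (U N x) \<le> norm (G x) + norm (conv (kap_sum s N) h x)"
            unfolding U[OF sub[OF True]] by (rule norm_triangle_ineq4)
          also have "\<dots> \<le> norm (G x) + (LINT y|lborel. norm (ker s (x - y) *\<^sub>R h y))"
            by (intro add_left_mono kap_sum_conv_tendsto(2)[OF s int]) measurable
          finally show ?thesis using True by simp
        qed (simp add: integral_nonneg_AE)
      qed
    qed
    have I: "indicator (box c d) x *\<^sub>R e x = ?I x *\<^sub>R v x - ?I x *\<^sub>R (G x - F x)" for x
      unfolding e_eq by (auto simp: ab[symmetric] indicator_def)
    have "(LINT x|lborel. indicator (box c d) x *\<^sub>R e x) = (LINT x|lborel. ?I x *\<^sub>R v x) - (LINT x|lborel. ?I x *\<^sub>R (G x - F x))"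
      unfolding I by (intro Bochner_Integration.integral_diff integrable_mult_indicator v GF) auto
    also have "(LINT x|lborel. ?I x *\<^sub>R v x) = (LINT x|lborel. ?I x *\<^sub>R u x)"
    proof (intro Bochner_Integration.integral_cong refl)
      fix x show "?I x *\<^sub>R v x = ?I x *\<^sub>R u x"
        using R0[OF sub, of x] s by (auto simp: indicator_def v_def)
    qed
    also have "\<dots> = (LINT x|lborel. ?I x *\<^sub>R (G x - F x))" using LIMSEQ_unique[OF l1 l2] .
    finally show ?thesis by simp
  qed
  then have "AE x in lborel. e x = 0" by (rule lborel_AE_eq_0_of_boxes[OF e])
  then show ?thesis using cF(1)
  proof eventually_elim
    case (elim x)
    show ?case
    proof
      assume x: "x \<in> ?B"
      have k: "ker s (x - y) *\<^sub>R f y = ker s (x - y) *\<^sub>R h y" for y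
        unfolding h_def by (intro trunc[OF x] ker_zero s)
      have g: "eta s (x - y) *\<^sub>R u y = eta s (x - y) *\<^sub>R v y" for y
        unfolding v_def by (intro trunc[OF x] eta_scaled_zero s)
      show "integrable lborel (\<lambda>y. ker s (x - y) *\<^sub>R f y) \<and>
         u x = conv (eta s) u x - conv (ker s) f x"
        using elim x unfolding k g by (simp add: e_def G_def F_def)
    qed
  qed
qed

end

section \<open>Folding Bloch functions to the unit cell\<close>

definition shiftv :: "int ^ 'n \<Rightarrow> real ^ 'n" where
  "shiftv k = (\<chi> j. of_int (k $ j))"

text \<open>The half-open cube, because its lattice translates tile the space without overlap.\<close>
definition cell :: "(real ^ 'n) set" where
  "cell = {x. \<forall>i. -1/2 \<le> x $ i \<and> x $ i < 1/2}"

text \<open>The lattice translates of the cell that can meet the open unit ball around a point of the cell.\<close>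
definition near :: "(int ^ 'n) set" where
  "near = {k. \<forall>j. k $ j \<in> {-1, 0, 1}}"

definition phase :: "complex ^ 'n \<Rightarrow> int ^ 'n \<Rightarrow> complex" where
  "phase p k = exp (\<i> * (\<Sum>j\<in>UNIV. p $ j * of_int (k $ j)))"

lemma finite_near: "finite (near :: (int ^ 'n) set)"
proof -
  have "finite (PiE (UNIV :: 'n set) (\<lambda>_. {-1, 0, 1 :: int}))" by (intro finite_PiE) auto
  then have "finite (vec_lambda ` (PiE (UNIV :: 'n set) (\<lambda>_. {-1, 0, 1 :: int})))" by (rule finite_imageI)
  moreover have "near \<subseteq> vec_lambda ` (PiE (UNIV :: 'n set) (\<lambda>_. {-1, 0, 1 :: int}))"
  proof
    fix k :: "int ^ 'n" assume "k \<in> near"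
    then have "vec_nth k \<in> PiE UNIV (\<lambda>_. {-1, 0, 1})" by (auto simp: near_def)
    then show "k \<in> vec_lambda ` (PiE (UNIV :: 'n set) (\<lambda>_. {-1, 0, 1 :: int}))"
      by (intro image_eqI[of _ _ "vec_nth k"]) auto
  qed
  ultimately show ?thesis by (rule finite_subset[rotated])
qed

lemma cell_measurable [measurable]: "cell \<in> sets borel"
  unfolding cell_def by measurable

lemma norm_cell: "x \<in> cell \<Longrightarrow> norm (x :: real ^ 'n) \<le> CARD('n)"
proof -
  assume x: "x \<in> cell"
  have "norm x \<le> (\<Sum>i\<in>UNIV. \<bar>x $ i\<bar>)" by (rule norm_le_l1_cart)
  also have "\<dots> \<le> (\<Sum>i\<in>(UNIV :: 'n set). 1)"
  proof (rule sum_mono)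
    fix i show "\<bar>x $ i\<bar> \<le> 1" using x by (auto simp: cell_def abs_le_iff dest!: spec[of _ i])
  qed
  finally show ?thesis by simp
qed

lemma cell_sum_near:
  fixes x y :: "real ^ 'n"
  assumes x: "x \<in> cell" and xy: "norm (x - y) < 1"
  shows "(\<Sum>k\<in>near. indicator cell (y - shiftv k)) = (1 :: real)"
proof -
  define k0 :: "int ^ 'n" where "k0 = (\<chi> j. \<lfloor>y $ j + 1/2\<rfloor>)"
  have iff: "y - shiftv k \<in> cell \<longleftrightarrow> k = k0" for k
  proof -
    have "(-1/2 \<le> y $ i - of_int (k $ i) \<and> y $ i - of_int (k $ i) < 1/2) \<longleftrightarrow> k $ i = \<lfloor>y $ i + 1/2\<rfloor>" for i
      by linarith
    then show ?thesis by (simp add: cell_def shiftv_def k0_def vec_eq_iff)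
  qed
  have "k0 \<in> near"
  proof -
    have "\<lfloor>y $ j + 1/2\<rfloor> \<in> {-1, 0, 1}" for j
    proof -
      have "\<bar>x $ j - y $ j\<bar> < 1" using component_le_norm_cart[of "x - y" j] xy by simp
      moreover have "-1/2 \<le> x $ j" "x $ j < 1/2" using x by (auto simp: cell_def)
      ultimately have "-1 < y $ j + 1/2" "y $ j + 1/2 < 2" by linarith+
      then have "\<lfloor>y $ j + 1/2\<rfloor> \<ge> -1" "\<lfloor>y $ j + 1/2\<rfloor> < 2" by linarith+
      then have "\<lfloor>y $ j + 1/2\<rfloor> = -1 \<or> \<lfloor>y $ j + 1/2\<rfloor> = 0 \<or> \<lfloor>y $ j + 1/2\<rfloor> = 1" by linarith
      then show ?thesis by blast
    qed
    then show ?thesis by (simp add: near_def k0_def)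
  qed
  moreover have "(\<Sum>k\<in>near. indicator cell (y - shiftv k)) = (\<Sum>k\<in>near. if k = k0 then 1 else (0 :: real))"
    by (intro sum.cong refl) (simp add: indicator_def iff)
  ultimately show ?thesis by (simp add: finite_near)
qed

text \<open>The integrand vanishes unless \<open>y\<close> lies in one of the translates indexed by \<open>near\<close>; shifting each of
  them back to the cell costs a Bloch phase.\<close>
lemma fold_integral:
  fixes \<phi> :: "real ^ 'n \<Rightarrow> real" and h :: "real ^ 'n \<Rightarrow> complex"
  assumes [measurable]: "\<phi> \<in> borel_measurable borel" "h \<in> borel_measurable borel"
    and int: "integrable lborel (\<lambda>y. \<phi> (x - y) *\<^sub>R h y)"
    and \<phi>: "\<And>z. norm z \<ge> 1 \<Longrightarrow> \<phi> z = 0" and x: "x \<in> cell"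
    and bloch: "\<And>k. AE y in lborel. h (shiftv k + y) = phase p k * h y"
  shows "conv \<phi> h x
     = (\<Sum>k\<in>near. phase p k * conv \<phi> (\<lambda>y. indicator cell y *\<^sub>R h y) (x - shiftv k))"
proof -
  let ?g = "\<lambda>k y. indicator cell (y - shiftv k) *\<^sub>R (\<phi> (x - y) *\<^sub>R h y)"
  have gm: "?g k \<in> borel_measurable borel" for k by measurable
  have gi: "integrable lborel (?g k)" for k
  proof (rule Bochner_Integration.integrable_bound[OF int])
    show "?g k \<in> borel_measurable lborel" using gm by simp
    show "AE y in lborel. norm (?g k y) \<le> norm (\<phi> (x - y) *\<^sub>R h y)"
      by (intro AE_I2) (auto simp: indicator_def)
  qed
  have "\<phi> (x - y) *\<^sub>R h y = (\<Sum>k\<in>near. ?g k y)" for y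
  proof (cases "norm (x - y) < 1")
    case True
    show ?thesis unfolding scaleR_sum_left[symmetric] cell_sum_near[OF x True] by simp
  qed (simp add: \<phi>)
  then have "conv \<phi> h x = (LINT y|lborel. (\<Sum>k\<in>near. ?g k y))"
    by (intro Bochner_Integration.integral_cong refl)
  also have "\<dots> = (\<Sum>k\<in>near. LINT y|lborel. ?g k y)"
    by (rule Bochner_Integration.integral_sum[OF gi])
  finally have 1: "conv \<phi> h x = (\<Sum>k\<in>near. LINT y|lborel. ?g k y)" .
  have ae: "AE y in lborel. ?g k (shiftv k + y) = phase p k * \<phi> (x - shiftv k - y) *\<^sub>R (indicator cell y *\<^sub>R h y)" for k
    using bloch[of k] by eventually_elim (simp add: scaleR_conv_of_real algebra_simps)
  have 2: "(LINT y|lborel. ?g k y) = phase p k * conv \<phi> (\<lambda>y. indicator cell y *\<^sub>R h y) (x - shiftv k)" for k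
  proof -
    have "(LINT y|lborel. ?g k y) = (LINT y|lborel. ?g k (shiftv k + y))"
      by (rule integral_lborel_shift[OF gm, symmetric])
    also have "\<dots> = (LINT y|lborel. phase p k * \<phi> (x - shiftv k - y) *\<^sub>R (indicator cell y *\<^sub>R h y))"
      by (rule integral_cong_AE[OF _ _ ae]) measurable
    also have "\<dots> = phase p k * conv \<phi> (\<lambda>y. indicator cell y *\<^sub>R h y) (x - shiftv k)"
      by (rule integral_mult_right_zero)
    finally show ?thesis .
  qed
  show "conv \<phi> h x
     = (\<Sum>k\<in>near. phase p k * conv \<phi> (\<lambda>y. indicator cell y *\<^sub>R h y) (x - shiftv k))"
    unfolding 1 2 ..
qed

text \<open>Integrals over the cell ignore null sets, so a function is replaced there by a Borel function that
  vanishes off the cell.\<close>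
definition cell_rep :: "(real ^ 'n \<Rightarrow> complex) \<Rightarrow> (real ^ 'n \<Rightarrow> complex) \<Rightarrow> bool" where
  "cell_rep u w \<longleftrightarrow> integrable lborel w \<and> (\<forall>y. y \<notin> cell \<longrightarrow> w y = 0) \<and>
    (AE x in lborel. x \<in> cell \<longrightarrow> u x = w x)"

lemma cell_repD:
  assumes "cell_rep u w"
  shows "integrable lborel w" "y \<notin> cell \<Longrightarrow> w y = 0" "AE x in lborel. x \<in> cell \<longrightarrow> u x = w x"
  using assms by (simp_all add: cell_rep_def)

lemma locally_integrable_cell:
  assumes "locally_integrable h"
  shows "integrable lborel (\<lambda>y :: real ^ 'n. indicator cell y *\<^sub>R h y)"
proof -
  have [measurable]: "h \<in> borel_measurable borel" using assms by (simp add: locally_integrable_def)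
  have "integrable lborel (\<lambda>y. indicator (cball 0 (real CARD('n))) y *\<^sub>R h y)"
    using assms by (simp add: locally_integrable_def)
  then show ?thesis
  proof (rule Bochner_Integration.integrable_bound)
    show "AE y in lborel. norm (indicator cell y *\<^sub>R h y) \<le> norm (indicator (cball 0 (real CARD('n))) y *\<^sub>R h y)"
      using norm_cell by (intro AE_I2) (auto simp: indicator_def)
  qed measurable
qed

lemma L2_loc_measurable:
  fixes u :: "real ^ 'n \<Rightarrow> complex"
  assumes "\<And>S. compact S \<Longrightarrow> set_integrable lebesgue S u"
  shows "u \<in> borel_measurable lebesgue"
proof (rule borel_measurable_LIMSEQ_metric)
  show "(\<lambda>x. indicator (cball 0 (real n)) x *\<^sub>R u x) \<in> borel_measurable lebesgue" for n :: nat
    using borel_measurable_integrable[OF assms[OF compact_cball, unfolded set_integrable_def]] .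
  show "(\<lambda>n. indicator (cball 0 (real n)) x *\<^sub>R u x) \<longlonglongrightarrow> u x" for x
  proof -
    obtain N :: nat where N: "norm x < N" using reals_Archimedean2 by blast
    then have "\<forall>\<^sub>F n in sequentially. u x = indicator (cball 0 (real n)) x *\<^sub>R u x"
      by (auto simp: eventually_sequentially indicator_def intro!: exI[of _ N])
    then show ?thesis by (rule Lim_transform_eventually[OF tendsto_const])
  qed
qed

lemma locally_integrable_representative:
  fixes u :: "real ^ 'n \<Rightarrow> complex"
  assumes u: "\<And>S. compact S \<Longrightarrow> set_integrable lebesgue S u"
  shows "\<exists>v. locally_integrable v \<and> (AE x in lborel. u x = v x)"
proof -
  obtain v where v [measurable]: "v \<in> borel_measurable borel" and uv: "AE x in lborel. u x = v x"
    using borel_representative[OF L2_loc_measurable[OF u]] by auto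
  have "integrable lborel (\<lambda>x. indicator (cball 0 R) x *\<^sub>R v x)" for R
  proof -
    have [measurable]: "cball (0 :: real ^ 'n) R \<in> sets borel" by simp
    have ui: "integrable lebesgue (\<lambda>x. indicator (cball 0 R) x *\<^sub>R u x)"
      using u[OF compact_cball, of 0 R] by (simp add: set_integrable_def)
    have m: "(\<lambda>x. indicator (cball 0 R) x *\<^sub>R v x) \<in> borel_measurable lborel" by measurable
    have "AE x in lebesgue. indicator (cball 0 R) x *\<^sub>R u x = indicator (cball 0 R) x *\<^sub>R v x"
      using AE_completion[OF uv] by eventually_elim simp
    then have "integrable lebesgue (\<lambda>x. indicator (cball 0 R) x *\<^sub>R v x)"
      using integrable_cong_AE[OF borel_measurable_integrable[OF ui] measurable_completion[OF m]] ui by blast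
    then show ?thesis using integrable_completion[OF m] by simp
  qed
  with v uv show ?thesis
    unfolding locally_integrable_def by (intro exI[of _ v] conjI allI)
qed

lemma lebesgue_integral_representative:
  fixes u v :: "real ^ 'n \<Rightarrow> complex"
  assumes [measurable]: "v \<in> borel_measurable borel" "\<phi> \<in> borel_measurable borel"
    and u: "u \<in> borel_measurable lebesgue" and uv: "AE x in lborel. u x = v x"
  shows "(LINT y|lebesgue. \<phi> y *\<^sub>R u y) = (LINT y|lborel. \<phi> y *\<^sub>R v y)"
proof -
  have m: "(\<lambda>y. \<phi> y *\<^sub>R v y) \<in> borel_measurable lborel" by measurable
  have "\<phi> \<in> borel_measurable lebesgue" by (rule measurable_completion) simp
  with u have "(\<lambda>y. \<phi> y *\<^sub>R u y) \<in> borel_measurable lebesgue" by (intro borel_measurable_scaleR)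
  moreover have "AE y in lebesgue. \<phi> y *\<^sub>R u y = \<phi> y *\<^sub>R v y"
    using AE_completion[OF uv] by eventually_elim simp
  ultimately have "(LINT y|lebesgue. \<phi> y *\<^sub>R u y) = (LINT y|lebesgue. \<phi> y *\<^sub>R v y)"
    by (rule integral_cong_AE[OF _ measurable_completion[OF m]])
  then show ?thesis using integral_completion[OF m] by simp
qed

context kernel_pair
begin

definition cell_equation ::
  "(real ^ 'n \<Rightarrow> real) \<Rightarrow> real \<Rightarrow> complex ^ 'n \<Rightarrow> complex \<Rightarrow> (real ^ 'n \<Rightarrow> complex) \<Rightarrow> bool"
where
  "cell_equation V s p \<mu> w \<longleftrightarrow> (AE x in lborel. x \<in> cell \<longrightarrow> w x = (\<Sum>k\<in>near. phase p k *
    (conv (eta s) w (x - shiftv k) - conv (ker s) (\<lambda>y. (V y - \<mu>) * w y) (x - shiftv k))))"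

text \<open>Integrability of \<open>V w\<close> comes from the equation itself: \<open>(V - \<mu>)u\<close> is a sum of second
  derivatives of \<open>u\<close>.\<close>
lemma eigenfunction_cell_equation:
  assumes V: "lattice_periodic V" and V' [measurable]: "V' \<in> borel_measurable borel"
    and VV': "AE x in lborel. V x = V' x" and ef: "eigenfunction V p \<mu> u"
  shows "\<exists>w. cell_rep u w \<and> integrable lborel (\<lambda>y. V' y *\<^sub>R w y) \<and>
    (\<forall>s. 0 < s \<longrightarrow> s \<le> 1 \<longrightarrow> cell_equation V' s p \<mu> w)"
proof -
  obtain D D2 where D: "sobolev_derivs u D D2"
    and eqn: "AE x in lebesgue. \<mu> * u x = - (\<Sum>i\<in>UNIV. D2 i i x) + complex_of_real (V x) * u x"
    and bloch: "u \<in> bloch_space p"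
    using ef by (auto simp: eigenfunction_def H_graph_def)
  define f where "f x = (\<Sum>i\<in>UNIV. D2 i i x)" for x
  have uL: "u \<in> L2_loc" and DL: "\<And>i. D2 i i \<in> L2_loc" using D by (auto simp: sobolev_derivs_def)
  have us: "\<And>S. compact S \<Longrightarrow> set_integrable lebesgue S u"
    by (rule L2_loc_imp_set_integrable[OF uL])
  have fs: "\<And>S. compact S \<Longrightarrow> set_integrable lebesgue S f"
    unfolding f_def by (rule set_integrable_sum_L2_loc[OF DL])
  obtain u' where u': "locally_integrable u'" and uu': "AE x in lborel. u x = u' x"
    using locally_integrable_representative[OF us] by auto
  obtain f' where f': "locally_integrable f'" and ff': "AE x in lborel. f x = f' x"
    using locally_integrable_representative[OF fs] by auto
  have [measurable]: "u' \<in> borel_measurable borel" "f' \<in> borel_measurable borel"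
    using u' f' by (auto simp: locally_integrable_def)
  have "AE x in lborel. \<mu> * u x = - f x + complex_of_real (V x) * u x"
    using eqn unfolding AE_completion_iff f_def .
  then have f'eq: "AE x in lborel. f' x = (complex_of_real (V' x) - \<mu>) * u' x"
    using uu' ff' VV' by eventually_elim (simp add: algebra_simps)
  have bu: "AE x in lborel. u' (shiftv k + x) = phase p k * u' x" for k
  proof -
    have "AE x in lborel. u (x + shiftv k) = phase p k * u x"
      using bloch unfolding bloch_space_def AE_completion_iff shiftv_def phase_def by blast
    then show ?thesis using uu' AE_lborel_shift[OF uu', of "shiftv k"]
      by eventually_elim (simp add: add.commute)
  qed
  have bf: "AE x in lborel. f' (shiftv k + x) = phase p k * f' x" for k
  proof -
    have V1: "V (x + shiftv k) = V x" for x
      using V unfolding lattice_periodic_def shiftv_def by blast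
    show ?thesis
      using f'eq AE_lborel_shift[OF f'eq, of "shiftv k"] bu[of k] VV' AE_lborel_shift[OF VV', of "shiftv k"]
    proof eventually_elim
      case (elim x)
      have "V' (shiftv k + x) = V' x" using elim(4,5) V1[of x] by (simp add: add.commute)
      then show ?case unfolding elim(1) elim(2) elim(3) by (simp only: mult_ac)
    qed
  qed
  define w where "w y = indicator cell y *\<^sub>R u' y" for y
  have w: "integrable lborel w" unfolding w_def[abs_def] by (rule locally_integrable_cell[OF u'])
  have [measurable]: "w \<in> borel_measurable borel" using w by auto
  have fw: "AE y in lborel. indicator cell y *\<^sub>R f' y = (complex_of_real (V' y) - \<mu>) * w y"
    using f'eq by eventually_elim (simp add: w_def)
  have g: "integrable lborel (\<lambda>y. indicator cell y *\<^sub>R f' y)" by (rule locally_integrable_cell[OF f'])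
  have Vw: "integrable lborel (\<lambda>y. V' y *\<^sub>R w y)"
  proof -
    have i: "integrable lborel (\<lambda>y. indicator cell y *\<^sub>R f' y + \<mu> * w y)"
      by (intro Bochner_Integration.integrable_add g integrable_mult_right w)
    have ae: "AE y in lborel. indicator cell y *\<^sub>R f' y + \<mu> * w y = V' y *\<^sub>R w y"
      using fw by eventually_elim (simp add: scaleR_conv_of_real algebra_simps)
    show ?thesis
      by (rule integrable_cong_AE_imp[OF i _ ae]) measurable
  qed
  have eqN: "(LINT y|lborel. (eta s (x - y) - eta (s / 2 ^ N) (x - y)) *\<^sub>R u' y)
      = conv (kap_sum s N) f' x" if s: "s > 0" for s x N
  proof -
    have "(LINT y|lebesgue. (eta s (x - y) - eta (s / 2 ^ N) (x - y)) *\<^sub>R u y)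
       = (LINT y|lebesgue. kap_sum s N (x - y) *\<^sub>R f y)"
      unfolding f_def by (rule mollified_equation[OF D s])
    moreover have "(LINT y|lebesgue. (eta s (x - y) - eta (s / 2 ^ N) (x - y)) *\<^sub>R u y)
       = (LINT y|lborel. (eta s (x - y) - eta (s / 2 ^ N) (x - y)) *\<^sub>R u' y)"
      by (rule lebesgue_integral_representative[OF _ _ L2_loc_measurable[OF us] uu']) measurable
    moreover have "(LINT y|lebesgue. kap_sum s N (x - y) *\<^sub>R f y) = conv (kap_sum s N) f' x"
      by (rule lebesgue_integral_representative[OF _ _ L2_loc_measurable[OF fs] ff']) measurable
    ultimately show ?thesis by simp
  qed
  have "cell_equation V' s p \<mu> w" if s: "s > 0" "s \<le> 1" for s
  proof -
    define a b :: "real ^ 'n" where "a = (\<chi> i. -1/2)" and "b = (\<chi> i. 1/2)"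
    have "AE x in lborel. x \<notin> cbox a b - box a b"
      by (rule AE_not_in_box_frontier)
    moreover have "x \<in> cbox a b" if "x \<in> cell" for x
      using that by (auto simp: cell_def mem_box_cart a_def b_def less_imp_le)
    ultimately have "AE x in lborel. x \<in> cell \<longrightarrow> x \<in> box a b"
      by (auto elim!: eventually_mono)
    then show ?thesis unfolding cell_equation_def
      using mollified_limit[OF u' f' s(1) eqN[OF s(1)], of a b]
    proof eventually_elim
      case (elim x)
      show ?case
      proof
        assume x: "x \<in> cell"
        with elim have int: "integrable lborel (\<lambda>y. ker s (x - y) *\<^sub>R f' y)"
          and ux: "u' x = conv (eta s) u' x - conv (ker s) f' x"
          by auto
        have inte: "integrable lborel (\<lambda>y. eta s (x - y) *\<^sub>R u' y)"
        proof (rule locally_integrable_mult[OF u'])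
          show "continuous_on UNIV (\<lambda>y. eta s (x - y))"
            by (intro continuous_on_compose2[OF eta_scaled_cont] continuous_intros) auto
          show "\<And>y. s \<le> norm (x - y) \<Longrightarrow> eta s (x - y) = 0" by (rule eta_scaled_zero[OF s(1)])
        qed
        have "conv (eta s) u' x
            = (\<Sum>k\<in>near. phase p k * conv (eta s) (\<lambda>y. indicator cell y *\<^sub>R u' y) (x - shiftv k))"
          using s by (intro fold_integral inte x bu eta_scaled_zero) simp_all
        moreover have "conv (ker s) f' x
            = (\<Sum>k\<in>near. phase p k * conv (ker s) (\<lambda>y. indicator cell y *\<^sub>R f' y) (x - shiftv k))"
          using s by (intro fold_integral int x bf ker_zero) simp_all
        moreover have "conv (ker s) (\<lambda>y. indicator cell y *\<^sub>R f' y) (x - shiftv k)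
           = conv (ker s) (\<lambda>y. (V' y - \<mu>) * w y) (x - shiftv k)" for k
        proof (rule integral_cong_AE)
          show "AE y in lborel. ker s (x - shiftv k - y) *\<^sub>R (indicator cell y *\<^sub>R f' y) = ker s (x - shiftv k - y) *\<^sub>R ((V' y - \<mu>) * w y)"
            using fw by eventually_elim simp
        qed measurable
        ultimately show "w x = (\<Sum>k\<in>near. phase p k *
            (conv (eta s) w (x - shiftv k) - conv (ker s) (\<lambda>y. (V' y - \<mu>) * w y) (x - shiftv k)))"
          using ux x by (simp add: w_def sum_subtractf right_diff_distrib)
      qed
    qed
  qed
  moreover have "AE x in lborel. x \<in> cell \<longrightarrow> u x = w x"
    using uu' by eventually_elim (simp add: w_def)
  then have "cell_rep u w" using w by (simp add: cell_rep_def w_def)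
  ultimately show ?thesis using Vw by blast
qed

end

section \<open>Contractions depending on a parameter\<close>

lemma contraction_solvable:
  fixes L :: "'b::{real_normed_vector, complete_space} \<Rightarrow> 'b"
  assumes L: "linear L" and bd: "\<And>f. norm (L f) \<le> norm f / 2"
  shows "\<exists>f. f = L f + G"
proof -
  have "\<exists>!f. L f + G = f"
  proof (rule banach_fix_type)
    show "\<forall>f f'. dist (L f + G) (L f' + G) \<le> 1/2 * dist f f'"
    proof (intro allI)
      fix f f' show "dist (L f + G) (L f' + G) \<le> 1/2 * dist f f'"
        using bd[of "f - f'"] by (simp add: dist_norm linear_diff[OF L])
    qed
  qed auto
  then obtain f where "L f + G = f" by blast
  then show ?thesis by (intro exI[of _ f]) simp
qed

text \<open>Subtracting the equations at \<open>q\<close> and \<open>p\<close> shows first that \<open>g\<close> is Lipschitz at \<open>p\<close>, and then that the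
  remainder \<open>r = g q - g p - E (q - p)\<close> solves \<open>r = T p r + o(q - p)\<close>. Differentiability is
  asked of \<open>q \<mapsto> T q (g p) + G q\<close>, where the argument of \<open>T q\<close> is frozen; the remaining term
  \<open>(T q - T p) (g q - g p)\<close> is \<open>o(q - p)\<close> by continuity of \<open>T\<close> in the operator norm.\<close>
lemma contraction_fixed_point_has_derivative:
  fixes T :: "'a::real_normed_vector \<Rightarrow> 'b::{real_normed_vector, complete_space} \<Rightarrow> 'b" and g G :: "'a \<Rightarrow> 'b"
  assumes S: "open S" "p \<in> S"
    and lin: "\<And>q. q \<in> S \<Longrightarrow> linear (T q)"
    and half: "\<And>q f. q \<in> S \<Longrightarrow> norm (T q f) \<le> norm f / 2"
    and fp: "\<And>q. q \<in> S \<Longrightarrow> g q = T q (g q) + G q"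
    and H: "((\<lambda>q. T q (g p) + G q) has_derivative H') (at p)"
    and cont: "\<And>e. e > 0 \<Longrightarrow> \<exists>d>0. \<forall>q. norm (q - p) < d \<longrightarrow> (\<forall>f. norm (T q f - T p f) \<le> e * norm f)"
    and E: "bounded_linear E" "\<And>h. E h = T p (E h) + H' h"
  shows "(g has_derivative E) (at p)"
  unfolding has_derivative_at_alt
proof (intro conjI allI impI E(1))
  fix e :: real assume e: "e > 0"
  let ?H = "\<lambda>q. T q (g p) + G q"
  obtain K where K: "K > 0" "\<And>h. norm (H' h) \<le> norm h * K"
    using bounded_linear.pos_bounded[OF has_derivative_bounded_linear[OF H]] by auto
  \<comment> \<open>\<open>2 (K + 1)\<close> will be a Lipschitz constant of \<open>g\<close> at \<open>p\<close>, and solving for the remainder costs another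
    factor 2.\<close>
  define e1 where "e1 = e / (8 * (K + 1))"
  define e2 where "e2 = min 1 (e / 4)"
  have e1: "e1 > 0" and e2: "e2 > 0" "e2 \<le> 1" "e2 \<le> e / 4" using e K(1) by (auto simp: e1_def e2_def)
  obtain d0 where d0: "d0 > 0" "\<And>q. norm (q - p) < d0 \<Longrightarrow> q \<in> S"
    using S unfolding open_contains_ball by (metis dist_norm mem_ball norm_minus_commute subsetD)
  obtain d1 where d1: "d1 > 0" "\<And>q f. norm (q - p) < d1 \<Longrightarrow> norm (T q f - T p f) \<le> e1 * norm f"
    using cont[OF e1] by blast
  obtain d2 where d2: "d2 > 0" "\<And>q. norm (q - p) < d2 \<Longrightarrow> norm (?H q - ?H p - H' (q - p)) \<le> e2 * norm (q - p)"
    using H e2(1) unfolding has_derivative_at_alt by blast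
  have "norm (g q - g p - E (q - p)) \<le> e * norm (q - p)" if q: "norm (q - p) < min d0 (min d1 d2)" for q
  proof -
    have qS: "q \<in> S" using d0(2) q by simp
    define h where "h = q - p"
    have Hr: "norm (?H q - ?H p - H' h) \<le> e2 * norm h" unfolding h_def using d2(2) q by simp
    have gp: "g p = ?H p" by (rule fp[OF S(2)])
    have "norm (?H q - ?H p) \<le> norm (?H q - ?H p - H' h) + norm (H' h)"
      using norm_triangle_ineq[of "?H q - ?H p - H' h" "H' h"] by simp
    also have "\<dots> \<le> 1 * norm h + norm h * K"
      using Hr K(2)[of h] e2(2) by (intro add_mono order_trans[OF Hr] mult_right_mono) auto
    finally have HL: "norm (?H q - ?H p) \<le> (K + 1) * norm h" by (simp add: algebra_simps)
    have "g q - g p = T q (g q) + G q - ?H p" using fp[OF qS] gp by metis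
    then have gd: "g q - g p = T q (g q - g p) + (?H q - ?H p)"
      using linear_diff[OF lin[OF qS], of "g q" "g p"] by simp
    have "norm (g q - g p) \<le> norm (T q (g q - g p)) + norm (?H q - ?H p)"
      by (subst gd) (rule norm_triangle_ineq)
    also have "\<dots> \<le> norm (g q - g p) / 2 + (K + 1) * norm h"
      using half[OF qS, of "g q - g p"] HL by linarith
    finally have gL: "norm (g q - g p) \<le> 2 * (K + 1) * norm h" by (simp add: algebra_simps)
    define r where "r = g q - g p - E h"
    have "r = T p r + ((T q (g q - g p) - T p (g q - g p)) + (?H q - ?H p - H' h))"
    proof -
      have "T p r = T p (g q - g p) - T p (E h)"
        unfolding r_def by (rule linear_diff[OF lin[OF S(2)]])
      moreover have "r = T q (g q - g p) + (?H q - ?H p) - (T p (E h) + H' h)"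
        unfolding r_def using gd E(2)[of h] by simp
      ultimately show ?thesis by simp
    qed
    then have "norm r \<le> norm (T p r) + (norm (T q (g q - g p) - T p (g q - g p)) + norm (?H q - ?H p - H' h))"
      by (metis (no_types, lifting) norm_triangle_ineq order_trans add_left_mono)
    also have "\<dots> \<le> norm r / 2 + (e1 * (2 * (K + 1) * norm h) + e2 * norm h)"
    proof (intro add_mono half S Hr)
      have "norm (T q (g q - g p) - T p (g q - g p)) \<le> e1 * norm (g q - g p)" using d1(2) q by simp
      also have "\<dots> \<le> e1 * (2 * (K + 1) * norm h)" using e1 gL by (intro mult_left_mono) auto
      finally show "norm (T q (g q - g p) - T p (g q - g p)) \<le> e1 * (2 * (K + 1) * norm h)" .
    qed
    also have "e1 * (2 * (K + 1) * norm h) = e / 4 * norm h"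
      using K(1) by (simp add: e1_def field_simps)
    finally have "norm r \<le> 2 * (e / 4 * norm h + e2 * norm h)" by simp
    also have "\<dots> \<le> 2 * (e / 4 * norm h + e / 4 * norm h)"
      using e2(3) by (intro mult_left_mono add_left_mono mult_right_mono) auto
    finally show ?thesis by (simp add: r_def h_def)
  qed
  then show "\<exists>d>0. \<forall>y. norm (y - p) < d \<longrightarrow> norm (g y - g p - E (y - p)) \<le> e * norm (y - p)"
    using d0(1) d1(1) d2(1) by (intro exI[of _ "min d0 (min d1 d2)"]) auto
qed

section \<open>Complex scalars on bounded continuous functions\<close>

type_synonym 'n bfun = "(real ^ 'n) \<Rightarrow>\<^sub>C complex"

lemma bcontfun_apply_Bcontfun:
  fixes f :: "'a::topological_space \<Rightarrow> 'b::real_normed_vector"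
  assumes "continuous_on UNIV f" "\<And>x. norm (f x) \<le> B"
  shows "apply_bcontfun (Bcontfun f) = f"
  using bcontfun_normI[OF assms] by (rule Bcontfun_inverse)

text \<open>The bounded continuous functions carry a real vector space structure only; complex linearity of
  derivatives is expressed through this operation.\<close>
definition cscale :: "complex \<Rightarrow> ('a::topological_space \<Rightarrow>\<^sub>C complex) \<Rightarrow> ('a \<Rightarrow>\<^sub>C complex)" where
  "cscale c f = Bcontfun (\<lambda>x. c * f x)"

lemma apply_cscale [simp]: "apply_bcontfun (cscale c f) x = c * f x"
proof -
  have "apply_bcontfun (cscale c f) = (\<lambda>x. c * f x)"
    unfolding cscale_def
  proof (rule bcontfun_apply_Bcontfun)
    show "continuous_on UNIV (\<lambda>x. c * f x)" by (intro continuous_intros continuous_on_apply_bcontfun)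
    show "norm (c * f x) \<le> norm c * norm f" for x
      by (simp add: norm_mult mult_left_mono norm_bounded)
  qed
  then show ?thesis by simp
qed

lemma norm_cscale_le: "norm (cscale c f) \<le> norm c * norm f"
  by (rule norm_bound) (simp add: norm_mult mult_left_mono norm_bounded)

lemma bounded_bilinear_cscale: "bounded_bilinear cscale"
proof
  show "\<exists>K. \<forall>a b. norm (cscale a b) \<le> norm a * norm b * K"
    using norm_cscale_le by (intro exI[of _ 1]) auto
qed (auto intro!: bcontfun_eqI simp: algebra_simps scaleR_conv_of_real)

lemma cscale_cscale: "cscale a (cscale b f) = cscale (a * b) f"
  by (rule bcontfun_eqI) (simp add: mult.assoc)

section \<open>The integral operators on bounded continuous functions\<close>

lemma convolution_continuous_bounded:
  fixes \<phi> :: "real ^ 'n \<Rightarrow> real" and h :: "real ^ 'n \<Rightarrow> complex"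
  assumes \<phi>: "continuous_on UNIV \<phi>" "\<And>z. \<bar>\<phi> z\<bar> \<le> B" and h: "integrable lborel h"
  shows "continuous_on UNIV (\<lambda>x. LINT y|lborel. \<phi> (x - a - y) *\<^sub>R h y)"
    and "norm (conv \<phi> h (x - a)) \<le> B * (LINT y|lborel. norm (h y))"
proof -
  have [measurable]: "\<phi> \<in> borel_measurable borel" "h \<in> borel_measurable borel"
    using borel_measurable_continuous_onI[OF \<phi>(1)] h by auto
  have hB: "integrable lborel (\<lambda>y. B * norm (h y))" using h by simp
  have bd: "AE y in lborel. norm (\<phi> (x - a - y) *\<^sub>R h y) \<le> B * norm (h y)" for x
    using \<phi>(2) by (intro AE_I2) (simp add: mult_right_mono)
  have "isCont (\<lambda>x. LINT y|lborel. \<phi> (x - a - y) *\<^sub>R h y) x" for x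
    unfolding continuous_at_sequentially
  proof (intro allI impI)
    fix X assume X: "X \<longlonglongrightarrow> x"
    have "(\<lambda>n. LINT y|lborel. \<phi> (X n - a - y) *\<^sub>R h y) \<longlonglongrightarrow> conv \<phi> h (x - a)"
    proof (rule integral_dominated_convergence[where w="\<lambda>y. B * norm (h y)"])
      show "AE y in lborel. (\<lambda>n. \<phi> (X n - a - y) *\<^sub>R h y) \<longlonglongrightarrow> \<phi> (x - a - y) *\<^sub>R h y"
      proof (intro AE_I2 tendsto_scaleR tendsto_const)
        fix y
        have c: "isCont \<phi> (x - a - y)" using \<phi>(1) by (simp add: continuous_on_eq_continuous_at)
        show "(\<lambda>n. \<phi> (X n - a - y)) \<longlonglongrightarrow> \<phi> (x - a - y)"
          by (rule isCont_tendsto_compose[OF c]) (intro tendsto_intros X)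
      qed
    qed (measurable, measurable, rule hB, rule bd)
    then show "((\<lambda>x. LINT y|lborel. \<phi> (x - a - y) *\<^sub>R h y) \<circ> X) \<longlonglongrightarrow> conv \<phi> h (x - a)"
      by (simp add: o_def)
  qed
  then show "continuous_on UNIV (\<lambda>x. LINT y|lborel. \<phi> (x - a - y) *\<^sub>R h y)"
    by (simp add: continuous_at_imp_continuous_on)
  have int: "integrable lborel (\<lambda>y. \<phi> (x - a - y) *\<^sub>R h y)"
  proof (rule Bochner_Integration.integrable_bound[OF hB])
    show "AE y in lborel. norm (\<phi> (x - a - y) *\<^sub>R h y) \<le> norm (B * norm (h y))"
      using bd[of x] by eventually_elim simp
  qed measurable
  have "norm (conv \<phi> h (x - a)) \<le> (LINT y|lborel. norm (\<phi> (x - a - y) *\<^sub>R h y))"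
    by (rule integral_norm_bound)
  also have "\<dots> \<le> (LINT y|lborel. B * norm (h y))"
    by (rule integral_mono_AE[OF integrable_norm[OF int] hB bd])
  finally show "norm (conv \<phi> h (x - a)) \<le> B * (LINT y|lborel. norm (h y))" by simp
qed

locale cell_potential = kernel_pair \<kappa> \<eta> for \<kappa> \<eta> :: "real ^ 'n \<Rightarrow> real" +
  fixes V :: "real ^ 'n \<Rightarrow> real" and q :: real
  assumes V_borel [measurable]: "V \<in> borel_measurable borel"
    and q1: "q \<ge> 1" and q2: "q > CARD('n) / 2"
    and V_Lq: "integrable lborel (\<lambda>y. indicator cell y * \<bar>V y\<bar> powr q)"
begin

text \<open>It dominates \<open>|V|\<close> and 1 on the cell, so one estimate covers the potential and the spectral
  parameter. Being bounded below on the cell, it also detects whether a function vanishes there.\<close>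
definition majorant :: "real ^ 'n \<Rightarrow> real" where
  "majorant y = indicator cell y * (1 + \<bar>V y\<bar>)"

definition op_bound :: "real \<Rightarrow> real" where
  "op_bound s = ker_const q majorant * s powr (2 - CARD('n) / q)"

lemma majorant_measurable [measurable]: "majorant \<in> borel_measurable borel"
  unfolding majorant_def[abs_def] by measurable

lemma majorant_nonneg: "majorant y \<ge> 0"
  by (simp add: majorant_def)

lemma indicator_cell_integrable: "integrable lborel (indicator cell :: real ^ 'n \<Rightarrow> real)"
proof -
  have "emeasure lborel (cell :: (real ^ 'n) set) \<le> emeasure lborel (cball (0 :: real ^ 'n) (real CARD('n)))"
    using norm_cell by (intro emeasure_mono) auto
  also have "\<dots> < \<infinity>" by (rule emeasure_lborel_cball_finite)
  finally show ?thesis by (intro integrable_real_indicator) auto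
qed

lemma weight_majorant: "weight q majorant"
  unfolding weight_def
proof (intro conjI allI majorant_nonneg majorant_measurable)
  have "integrable lborel (\<lambda>y. 2 powr q * (indicator cell y + indicator cell y * \<bar>V y\<bar> powr q))"
    by (intro integrable_mult_right Bochner_Integration.integrable_add indicator_cell_integrable V_Lq)
  then show "integrable lborel (\<lambda>y. majorant y powr q)"
  proof (rule Bochner_Integration.integrable_bound)
    show "AE y in lborel. norm (majorant y powr q) \<le> norm (2 powr q * (indicator cell y + indicator cell y * \<bar>V y\<bar> powr q))"
    proof (rule AE_I2)
      fix y
      have "(1 + \<bar>V y\<bar>) powr q \<le> 2 powr q * (1 + \<bar>V y\<bar> powr q)"
      proof (cases "\<bar>V y\<bar> \<le> 1")
        case True
        then have "(1 + \<bar>V y\<bar>) powr q \<le> 2 powr q" using q1 by (intro powr_mono2) auto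
        then show ?thesis by (rule order_trans) (simp add: mult_le_cancel_left1)
      next
        case False
        then have "(1 + \<bar>V y\<bar>) powr q \<le> (2 * \<bar>V y\<bar>) powr q" using q1 by (intro powr_mono2) auto
        then show ?thesis by (rule order_trans) (simp add: powr_mult)
      qed
      then show "norm (majorant y powr q) \<le> norm (2 powr q * (indicator cell y + indicator cell y * \<bar>V y\<bar> powr q))"
        by (cases "y \<in> cell") (auto simp: majorant_def)
    qed
  qed measurable
qed

lemma majorant_integrable: "integrable lborel majorant"
proof -
  have "integrable lborel (\<lambda>y. indicator cell y + majorant y powr q)"
    using weight_majorant by (intro Bochner_Integration.integrable_add indicator_cell_integrable) (simp add: weight_def)
  then show ?thesis
  proof (rule Bochner_Integration.integrable_bound)
    show "AE y in lborel. norm (majorant y) \<le> norm (indicator cell y + majorant y powr q)"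
    proof (rule AE_I2)
      fix y show "norm (majorant y) \<le> norm (indicator cell y + majorant y powr q)"
        using young_split[OF majorant_nonneg, of 1 q y] q1 majorant_nonneg[of y] by (cases "y \<in> cell") (auto simp: majorant_def)
    qed
  qed measurable
qed

lemma exponent_pos: "2 - CARD('n) / q > 0"
  using q1 q2 by (simp add: field_simps)

lemma op_bound_nonneg: "op_bound s \<ge> 0"
proof -
  have "2 powr - (2 - CARD('n) / q) < 1" using exponent_pos by (simp add: powr_less_one)
  then show ?thesis unfolding op_bound_def ker_const_def
    by (intro mult_nonneg_nonneg divide_nonneg_nonneg weight_const_nonneg) auto
qed

lemma op_bound_tendsto_0:
  assumes "s > 0"
  shows "(\<lambda>N. op_bound (s / 2 ^ N)) \<longlonglongrightarrow> 0"
proof -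
  have "(\<lambda>N. (s / 2 ^ N) powr (2 - CARD('n) / q)) \<longlonglongrightarrow> 0"
    using assms exponent_pos LIMSEQ_divide_realpow_zero[of 2 s]
    by (intro tendsto_zero_powrI[OF _ tendsto_const]) auto
  then show ?thesis unfolding op_bound_def using tendsto_mult_right_zero by blast
qed

lemma small_op_bound: "e > 0 \<Longrightarrow> \<exists>s>0. s \<le> 1 \<and> op_bound s \<le> e"
proof -
  assume "e > 0"
  then have "\<forall>\<^sub>F N in sequentially. op_bound (1 / 2 ^ N) < e"
    using order_tendstoD(2)[OF op_bound_tendsto_0[of 1]] by simp
  then obtain N where "op_bound (1 / 2 ^ N) < e" by (auto simp: eventually_sequentially)
  then show ?thesis by (intro exI[of _ "1 / 2 ^ N"]) (auto simp: divide_le_eq)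
qed

lemma ker_majorant_bound: "s > 0 \<Longrightarrow> (\<integral>\<^sup>+y. ennreal (ker s (z - y) * majorant y) \<partial>lborel) \<le> ennreal (op_bound s)"
  unfolding op_bound_def by (rule ker_weight_bound[OF weight_majorant q1 q2])

definition admissible :: "(real ^ 'n \<Rightarrow> real) \<Rightarrow> bool" where
  "admissible W \<longleftrightarrow> W \<in> borel_measurable borel \<and> (\<forall>y. \<bar>W y\<bar> \<le> majorant y)"

lemma ker_conv_bound:
  fixes f :: "real ^ 'n \<Rightarrow> complex"
  assumes s: "s > 0" and W: "admissible W" and f [measurable]: "f \<in> borel_measurable borel" and C: "\<And>y. norm (f y) \<le> C"
  shows "integrable lborel (\<lambda>y. ker s (z - y) *\<^sub>R (W y *\<^sub>R f y))"
    and "norm (conv (ker s) (\<lambda>y. W y *\<^sub>R f y) z) \<le> op_bound s * C"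
proof -
  have [measurable]: "W \<in> borel_measurable borel" and WM: "\<And>y. \<bar>W y\<bar> \<le> majorant y" using W by (auto simp: admissible_def)
  have C0: "C \<ge> 0" using C[of 0] norm_ge_zero[of "f 0"] by linarith
  have "(\<integral>\<^sup>+y. ennreal (norm (ker s (z - y) *\<^sub>R (W y *\<^sub>R f y))) \<partial>lborel)
      \<le> (\<integral>\<^sup>+y. ennreal (ker s (z - y) * majorant y) * ennreal C \<partial>lborel)"
  proof (intro nn_integral_mono)
    fix y
    have "norm (ker s (z - y) *\<^sub>R (W y *\<^sub>R f y)) = ker s (z - y) * (\<bar>W y\<bar> * norm (f y))"
      using ker_nonneg[OF s, of "z - y"] by (simp add: abs_mult)
    also have "\<dots> \<le> ker s (z - y) * (majorant y * C)"
      by (intro mult_left_mono mult_mono WM C ker_nonneg s majorant_nonneg) auto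
    finally have "ennreal (norm (ker s (z - y) *\<^sub>R (W y *\<^sub>R f y))) \<le> ennreal (ker s (z - y) * majorant y * C)"
      by (intro ennreal_leI) (simp add: mult.assoc)
    also have "\<dots> = ennreal (ker s (z - y) * majorant y) * ennreal C"
      using C0 by (rule ennreal_mult'')
    finally show "ennreal (norm (ker s (z - y) *\<^sub>R (W y *\<^sub>R f y))) \<le> ennreal (ker s (z - y) * majorant y) * ennreal C" .
  qed
  also have "\<dots> = (\<integral>\<^sup>+y. ennreal (ker s (z - y) * majorant y) \<partial>lborel) * ennreal C"
    by (rule nn_integral_multc) measurable
  also have "\<dots> \<le> ennreal (op_bound s) * ennreal C" by (intro mult_right_mono ker_majorant_bound s) simp
  also have "\<dots> = ennreal (op_bound s * C)" using C0 by (rule ennreal_mult''[symmetric])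
  finally have le: "(\<integral>\<^sup>+y. ennreal (norm (ker s (z - y) *\<^sub>R (W y *\<^sub>R f y))) \<partial>lborel) \<le> ennreal (op_bound s * C)" .
  show int: "integrable lborel (\<lambda>y. ker s (z - y) *\<^sub>R (W y *\<^sub>R f y))"
  proof (rule integrableI_bounded)
    show "(\<integral>\<^sup>+y. ennreal (norm (ker s (z - y) *\<^sub>R (W y *\<^sub>R f y))) \<partial>lborel) < \<infinity>"
      using le_less_trans[OF le ennreal_less_top] by simp
  qed measurable
  have "ennreal (norm (conv (ker s) (\<lambda>y. W y *\<^sub>R f y) z)) \<le> ennreal (op_bound s * C)"
    by (rule order_trans[OF integral_norm_bound_ennreal[OF int] le])
  then show "norm (conv (ker s) (\<lambda>y. W y *\<^sub>R f y) z) \<le> op_bound s * C"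
    using op_bound_nonneg C0 by (simp add: ennreal_le_iff)
qed

text \<open>The partial sums \<open>kap_sum s N\<close> are continuous kernels, and by \<open>ker_split\<close> the error is bounded,
  uniformly in \<open>x\<close>, by the operator bound at scale \<open>s/2\<^sup>N\<close>.\<close>
lemma ker_conv_continuous:
  fixes f :: "real ^ 'n \<Rightarrow> complex"
  assumes s: "s > 0" and W: "admissible W" and f [measurable]: "f \<in> borel_measurable borel" and C: "\<And>y. norm (f y) \<le> C"
  shows "continuous_on UNIV (\<lambda>x. LINT y|lborel. ker s (x - a - y) *\<^sub>R (W y *\<^sub>R f y))"
proof -
  have [measurable]: "W \<in> borel_measurable borel" and WM: "\<And>y. \<bar>W y\<bar> \<le> majorant y" using W by (auto simp: admissible_def)
  have C0: "C \<ge> 0" using C[of 0] norm_ge_zero[of "f 0"] by linarith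
  let ?h = "\<lambda>y. W y *\<^sub>R f y"
  let ?F = "\<lambda>x. LINT y|lborel. ker s (x - a - y) *\<^sub>R ?h y"
  let ?FN = "\<lambda>N x. LINT y|lborel. kap_sum s N (x - a - y) *\<^sub>R ?h y"
  have MC: "integrable lborel (\<lambda>y. majorant y * C)" using majorant_integrable by simp
  have h: "integrable lborel ?h"
  proof (rule Bochner_Integration.integrable_bound[OF MC])
    show "AE y in lborel. norm (?h y) \<le> norm (majorant y * C)"
      using WM C C0 majorant_nonneg by (intro AE_I2) (simp add: mult_mono)
  qed measurable
  have cN: "continuous_on UNIV (?FN N)" for N
  proof -
    obtain B where "\<forall>z. \<bar>kap_sum s N z\<bar> \<le> B"
      using compact_support_bounded[OF kap_sum_cont kap_sum_zero[OF s]] by blast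
    then show ?thesis by (intro convolution_continuous_bounded(1)[OF kap_sum_cont _ h]) auto
  qed
  have diff: "dist (?FN N x) (?F x) \<le> op_bound (s / 2 ^ N) * C" for N x
  proof -
    have sN: "s / 2 ^ N > 0" using s by simp
    let ?z = "x - a"
    have i: "integrable lborel (\<lambda>y. ker s (?z - y) *\<^sub>R ?h y)" by (rule ker_conv_bound(1)[OF s W f C])
    have "?FN N x = (LINT y|lborel. ker s (?z - y) *\<^sub>R ?h y - ker (s / 2 ^ N) (?z - y) *\<^sub>R ?h y)"
    proof (rule integral_cong_AE)
      show "AE y in lborel. kap_sum s N (?z - y) *\<^sub>R ?h y = ker s (?z - y) *\<^sub>R ?h y - ker (s / 2 ^ N) (?z - y) *\<^sub>R ?h y"
        using AE_lborel_neq[of ?z]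
      proof (rule eventually_mono)
        fix y assume "y \<noteq> ?z"
        then have "kap_sum s N (?z - y) = ker s (?z - y) - ker (s / 2 ^ N) (?z - y)"
          using ker_split[OF s, of "?z - y" N] by simp
        then show "kap_sum s N (?z - y) *\<^sub>R ?h y = ker s (?z - y) *\<^sub>R ?h y - ker (s / 2 ^ N) (?z - y) *\<^sub>R ?h y"
          by (simp only: scaleR_diff_left)
      qed
    qed measurable
    also have "\<dots> = ?F x - conv (ker (s / 2 ^ N)) ?h ?z"
      by (rule Bochner_Integration.integral_diff[OF i ker_conv_bound(1)[OF sN W f C]])
    finally show ?thesis
      using ker_conv_bound(2)[OF sN W f C, of ?z] by (simp add: dist_norm)
  qed
  have "uniform_limit UNIV ?FN ?F sequentially"
  proof (rule uniform_limitI)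
    fix e :: real assume e: "e > 0"
    have "(\<lambda>N. op_bound (s / 2 ^ N) * C) \<longlonglongrightarrow> 0" by (rule tendsto_mult_left_zero[OF op_bound_tendsto_0[OF s]])
    then have "\<forall>\<^sub>F N in sequentially. op_bound (s / 2 ^ N) * C < e" using e by (rule order_tendstoD(2))
    then show "\<forall>\<^sub>F N in sequentially. \<forall>x\<in>UNIV. dist (?FN N x) (?F x) < e"
      by (rule eventually_mono) (use diff le_less_trans in blast)
  qed
  then show ?thesis
    by (rule uniform_limit_theorem[OF always_eventually[OF allI[OF cN]]]) simp
qed

definition ker_op :: "real \<Rightarrow> (real ^ 'n \<Rightarrow> real) \<Rightarrow> int ^ 'n \<Rightarrow> 'n bfun \<Rightarrow> 'n bfun" where
  "ker_op s W k f = Bcontfun (\<lambda>x. LINT y|lborel. ker s (x - shiftv k - y) *\<^sub>R (W y *\<^sub>R f y))"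

lemma bfun_measurable [measurable]: "apply_bcontfun (f :: 'n bfun) \<in> borel_measurable borel"
  by (intro borel_measurable_continuous_onI continuous_on_apply_bcontfun)

lemma apply_ker_op:
  assumes "s > 0" "admissible W"
  shows "apply_bcontfun (ker_op s W k f) x = conv (ker s) (\<lambda>y. W y *\<^sub>R f y) (x - shiftv k)"
  unfolding ker_op_def
  by (subst bcontfun_apply_Bcontfun[OF ker_conv_continuous[OF assms bfun_measurable norm_bounded]
        ker_conv_bound(2)[OF assms bfun_measurable norm_bounded]]) (rule refl)

lemma ker_op_bound:
  assumes "s > 0" "admissible W"
  shows "norm (ker_op s W k f) \<le> op_bound s * norm f"
  by (rule norm_bound) (simp only: apply_ker_op[OF assms] ker_conv_bound(2)[OF assms bfun_measurable norm_bounded])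

lemma ker_op_add:
  assumes "s > 0" "admissible W"
  shows "ker_op s W k (f + g) = ker_op s W k f + ker_op s W k g"
proof (rule bcontfun_eqI)
  note int = ker_conv_bound(1)[OF assms bfun_measurable norm_bounded]
  show "apply_bcontfun (ker_op s W k (f + g)) x = apply_bcontfun (ker_op s W k f + ker_op s W k g) x" for x
    using Bochner_Integration.integral_add[OF int[of "x - shiftv k" f] int[of "x - shiftv k" g]]
    by (simp add: apply_ker_op[OF assms] scaleR_add_right)
qed

lemma ker_op_cscale:
  assumes "s > 0" "admissible W"
  shows "ker_op s W k (cscale c f) = cscale c (ker_op s W k f)"
proof (rule bcontfun_eqI)
  show "apply_bcontfun (ker_op s W k (cscale c f)) x = apply_bcontfun (cscale c (ker_op s W k f)) x" for x
    using integral_mult_right_zero[of lborel c "\<lambda>y. ker s (x - shiftv k - y) *\<^sub>R (W y *\<^sub>R f y)"]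
    by (simp add: apply_ker_op[OF assms])
qed

lemma cscale_of_real: "cscale (of_real r) f = r *\<^sub>R f"
  by (rule bcontfun_eqI) (simp add: scaleR_conv_of_real)

definition eta_op :: "real \<Rightarrow> int ^ 'n \<Rightarrow> (real ^ 'n \<Rightarrow> complex) \<Rightarrow> 'n bfun" where
  "eta_op s k h = Bcontfun (\<lambda>x. LINT y|lborel. eta s (x - shiftv k - y) *\<^sub>R h y)"

lemma eta_bounded: "s > 0 \<Longrightarrow> \<exists>B\<ge>0. \<forall>z. \<bar>eta s z\<bar> \<le> B"
  by (rule compact_support_bounded[OF eta_scaled_cont eta_scaled_zero])

lemma apply_eta_op:
  assumes "s > 0" "integrable lborel h"
  shows "apply_bcontfun (eta_op s k h) x = conv (eta s) h (x - shiftv k)"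
proof -
  obtain B where B: "\<And>z. \<bar>eta s z\<bar> \<le> B" using eta_bounded[OF assms(1)] by blast
  show ?thesis unfolding eta_op_def
    by (subst bcontfun_apply_Bcontfun[OF convolution_continuous_bounded[OF eta_scaled_cont B assms(2)]]) (rule refl)
qed

lemma eta_op_bound:
  assumes "s > 0"
  shows "\<exists>B\<ge>0. \<forall>k h. integrable lborel h \<longrightarrow> norm (eta_op s k h) \<le> B * (LINT y|lborel. norm (h y))"
proof -
  obtain B where B: "B \<ge> 0" "\<And>z. \<bar>eta s z\<bar> \<le> B" using eta_bounded[OF assms(1)] by blast
  have "norm (eta_op s k h) \<le> B * (LINT y|lborel. norm (h y))" if "integrable lborel h" for k h
    by (rule norm_bound)
       (simp add: apply_eta_op[OF assms that] convolution_continuous_bounded(2)[OF eta_scaled_cont B(2) that])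
  with B(1) show ?thesis by blast
qed

lemma eta_conv_integrable:
  assumes "s > 0" "integrable lborel h"
  shows "integrable lborel (\<lambda>y. eta s (z - y) *\<^sub>R (h y :: complex))"
proof -
  obtain B where B: "B \<ge> 0" "\<And>z. \<bar>eta s z\<bar> \<le> B" using eta_bounded[OF assms(1)] by blast
  have [measurable]: "h \<in> borel_measurable borel" using assms by auto
  show ?thesis
  proof (rule Bochner_Integration.integrable_bound[OF integrable_mult_right[OF integrable_norm[OF assms(2)], of B]])
    show "AE y in lborel. norm (eta s (z - y) *\<^sub>R h y) \<le> norm (B * norm (h y))"
      using B by (intro AE_I2) (simp add: abs_mult mult_right_mono)
  qed measurable
qed

lemma eta_op_diff:
  assumes "s > 0" "integrable lborel g" "integrable lborel h"
  shows "eta_op s k (\<lambda>y. g y - h y) = eta_op s k g - eta_op s k h"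
proof (rule bcontfun_eqI)
  fix x
  have "conv (eta s) (\<lambda>y. g y - h y) (x - shiftv k)
      = conv (eta s) g (x - shiftv k) - conv (eta s) h (x - shiftv k)"
    unfolding scaleR_diff_right
    by (intro Bochner_Integration.integral_diff eta_conv_integrable assms)
  then show "apply_bcontfun (eta_op s k (\<lambda>y. g y - h y)) x = apply_bcontfun (eta_op s k g - eta_op s k h) x"
    using assms by (simp add: apply_eta_op)
qed

lemma eta_op_sum_cscale:
  assumes "s > 0" "\<And>j. j \<in> J \<Longrightarrow> integrable lborel (D j)"
  shows "eta_op s k (\<lambda>y. \<Sum>j\<in>J. c j * D j y) = (\<Sum>j\<in>J. cscale (c j) (eta_op s k (D j)))"
proof (rule bcontfun_eqI)
  fix x
  have int: "integrable lborel (\<lambda>y. \<Sum>j\<in>J. c j * D j y)"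
    using assms(2) by (intro Bochner_Integration.integrable_sum integrable_mult_right)
  have apply_sum: "apply_bcontfun (\<Sum>j\<in>J. F j) x = (\<Sum>j\<in>J. apply_bcontfun (F j) x)" for F :: "_ \<Rightarrow> 'n bfun"
    by (induction J rule: infinite_finite_induct) auto
  have "conv (eta s) (\<lambda>y. \<Sum>j\<in>J. c j * D j y) (x - shiftv k)
      = (LINT y|lborel. (\<Sum>j\<in>J. c j * (eta s (x - shiftv k - y) *\<^sub>R D j y)))"
    by (simp add: scaleR_sum_right)
  also have "\<dots> = (\<Sum>j\<in>J. LINT y|lborel. c j * (eta s (x - shiftv k - y) *\<^sub>R D j y))"
    using assms by (intro Bochner_Integration.integral_sum integrable_mult_right eta_conv_integrable)
  also have "\<dots> = (\<Sum>j\<in>J. c j * (LINT y|lborel. eta s (x - shiftv k - y) *\<^sub>R D j y))"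
    by (simp only: integral_mult_right_zero)
  finally show "apply_bcontfun (eta_op s k (\<lambda>y. \<Sum>j\<in>J. c j * D j y)) x = apply_bcontfun (\<Sum>j\<in>J. cscale (c j) (eta_op s k (D j))) x"
    using assms int by (simp add: apply_eta_op apply_sum)
qed

definition W1 :: "real ^ 'n \<Rightarrow> real" where "W1 y = - (indicator cell y * V y)"
definition W0 :: "real ^ 'n \<Rightarrow> real" where "W0 y = indicator cell y"

lemma admissible_W: "admissible W1" "admissible W0"
proof -
  have "W1 \<in> borel_measurable borel" "W0 \<in> borel_measurable borel"
    unfolding W1_def[abs_def] W0_def[abs_def] by measurable
  moreover have "\<bar>W1 y\<bar> \<le> majorant y" "\<bar>W0 y\<bar> \<le> majorant y" for y
    by (auto simp: W1_def W0_def majorant_def indicator_def)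
  ultimately show "admissible W1" "admissible W0" by (auto simp: admissible_def)
qed

text \<open>In terms of these operators the equation on the cell reads \<open>w = T_op s p \<mu> w + G_op s p w\<close>.
  The parameters \<open>p\<close> and \<open>\<mu>\<close> appear only as scalar coefficients of fixed operators.\<close>
definition T_op :: "real \<Rightarrow> complex ^ 'n \<Rightarrow> complex \<Rightarrow> 'n bfun \<Rightarrow> 'n bfun" where
  "T_op s p \<mu> f = (\<Sum>k\<in>near. cscale (phase p k) (ker_op s W1 k f) + cscale (phase p k * \<mu>) (ker_op s W0 k f))"

definition G_op :: "real \<Rightarrow> complex ^ 'n \<Rightarrow> (real ^ 'n \<Rightarrow> complex) \<Rightarrow> 'n bfun" where
  "G_op s p h = (\<Sum>k\<in>near. cscale (phase p k) (eta_op s k h))"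

definition phase_bound :: "complex ^ 'n \<Rightarrow> complex \<Rightarrow> real" where
  "phase_bound p \<mu> = (\<Sum>k\<in>near. norm (phase p k) * (1 + norm \<mu>))"

lemma cscale_add_right: "cscale c (f + g) = cscale c f + cscale c g"
  by (rule bounded_bilinear.add_right[OF bounded_bilinear_cscale])

lemma cscale_sum_right: "cscale c (\<Sum>j\<in>J. f j) = (\<Sum>j\<in>J. cscale c (f j))"
  by (rule bounded_bilinear.sum_right[OF bounded_bilinear_cscale])

lemma T_op_add: "s > 0 \<Longrightarrow> T_op s p \<mu> (f + g) = T_op s p \<mu> f + T_op s p \<mu> g"
  by (simp add: T_op_def ker_op_add admissible_W cscale_add_right sum.distrib)

lemma T_op_cscale: "s > 0 \<Longrightarrow> T_op s p \<mu> (cscale c f) = cscale c (T_op s p \<mu> f)"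
  by (simp add: T_op_def ker_op_cscale admissible_W cscale_add_right cscale_sum_right cscale_cscale mult_ac)

lemma T_op_linear: "s > 0 \<Longrightarrow> linear (T_op s p \<mu>)"
  by (rule linearI) (simp_all add: T_op_add T_op_cscale flip: cscale_of_real)

lemma T_op_bound:
  assumes s: "s > 0"
  shows "norm (T_op s p \<mu> f) \<le> phase_bound p \<mu> * op_bound s * norm f"
proof -
  have "norm (T_op s p \<mu> f) \<le> (\<Sum>k\<in>near. norm (phase p k) * (1 + norm \<mu>) * (op_bound s * norm f))"
    unfolding T_op_def
  proof (rule sum_norm_le)
    fix k
    have "norm (cscale (phase p k) (ker_op s W1 k f) + cscale (phase p k * \<mu>) (ker_op s W0 k f))
       \<le> norm (phase p k) * norm (ker_op s W1 k f) + norm (phase p k * \<mu>) * norm (ker_op s W0 k f)"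
      by (rule norm_triangle_le[OF add_mono[OF norm_cscale_le norm_cscale_le]])
    also have "\<dots> \<le> norm (phase p k) * (op_bound s * norm f) + norm (phase p k * \<mu>) * (op_bound s * norm f)"
      by (intro add_mono mult_left_mono ker_op_bound s admissible_W) auto
    finally show "norm (cscale (phase p k) (ker_op s W1 k f) + cscale (phase p k * \<mu>) (ker_op s W0 k f))
       \<le> norm (phase p k) * (1 + norm \<mu>) * (op_bound s * norm f)"
      by (simp add: norm_mult algebra_simps)
  qed
  then show ?thesis by (simp add: phase_bound_def sum_distrib_right mult.assoc)
qed

lemma apply_bfun_sum: "apply_bcontfun (\<Sum>j\<in>J. F j) x = (\<Sum>j\<in>J. apply_bcontfun (F j :: 'n bfun) x)"
  by (induction J rule: infinite_finite_induct) auto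

lemma ker_conv_potential:
  fixes f :: "'n bfun"
  assumes s: "s > 0"
  shows "integrable lborel (\<lambda>y. ker s (z - y) *\<^sub>R ((\<mu> - complex_of_real (V y)) * (indicator cell y *\<^sub>R f y)))"
    and "conv (ker s) (\<lambda>y. (\<mu> - V y) * (indicator cell y *\<^sub>R f y)) z
      = conv (ker s) (\<lambda>y. W1 y *\<^sub>R f y) z + \<mu> * conv (ker s) (\<lambda>y. W0 y *\<^sub>R f y) z"
proof -
  note int = ker_conv_bound(1)[OF s admissible_W(1) bfun_measurable norm_bounded, of z f]
    ker_conv_bound(1)[OF s admissible_W(2) bfun_measurable norm_bounded, of z f]
  have eq: "ker s (z - y) *\<^sub>R ((\<mu> - V y) * (indicator cell y *\<^sub>R f y))
      = ker s (z - y) *\<^sub>R (W1 y *\<^sub>R f y) + \<mu> * (ker s (z - y) *\<^sub>R (W0 y *\<^sub>R f y))" for y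
    by (simp add: W1_def W0_def scaleR_conv_of_real algebra_simps)
  show "integrable lborel (\<lambda>y. ker s (z - y) *\<^sub>R ((\<mu> - complex_of_real (V y)) * (indicator cell y *\<^sub>R f y)))"
    unfolding eq by (intro Bochner_Integration.integrable_add integrable_mult_right int)
  have "conv (ker s) (\<lambda>y. (\<mu> - V y) * (indicator cell y *\<^sub>R f y)) z
      = conv (ker s) (\<lambda>y. W1 y *\<^sub>R f y) z + (LINT y|lborel. \<mu> * (ker s (z - y) *\<^sub>R (W0 y *\<^sub>R f y)))"
    unfolding eq by (intro Bochner_Integration.integral_add integrable_mult_right int)
  then show "conv (ker s) (\<lambda>y. (\<mu> - V y) * (indicator cell y *\<^sub>R f y)) z
      = conv (ker s) (\<lambda>y. W1 y *\<^sub>R f y) z + \<mu> * conv (ker s) (\<lambda>y. W0 y *\<^sub>R f y) z"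
    by (simp only: integral_mult_right_zero)
qed

lemma apply_T_op:
  assumes s: "s > 0"
  shows "apply_bcontfun (T_op s p \<mu> f) x
    = (\<Sum>k\<in>near. phase p k * conv (ker s) (\<lambda>y. (\<mu> - V y) * (indicator cell y *\<^sub>R f y)) (x - shiftv k))"
  unfolding T_op_def apply_bfun_sum plus_bcontfun.rep_eq apply_cscale ker_conv_potential(2)[OF s]
    apply_ker_op[OF s admissible_W(1)] apply_ker_op[OF s admissible_W(2)]
  by (simp only: distrib_left mult.assoc)

lemma apply_G_op:
  assumes "s > 0" "integrable lborel h"
  shows "apply_bcontfun (G_op s p h) x = (\<Sum>k\<in>near. phase p k * conv (eta s) h (x - shiftv k))"
  using assms by (simp add: G_op_def apply_bfun_sum apply_eta_op)

section \<open>Uniqueness in a weighted \<open>L\<^sub>1\<close> space\<close>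

text \<open>Since \<open>ker s\<close> is even, integrating in \<open>x\<close> first leads to the same uniform bound as integrating
  in \<open>y\<close>: this is the contraction estimate in the weighted \<open>L\<^sub>1\<close> norm.\<close>
lemma majorant_double_integral:
  assumes s: "s > 0" and [measurable]: "e \<in> borel_measurable borel"
  shows "(\<integral>\<^sup>+x. ennreal (majorant x) * (\<integral>\<^sup>+y. ennreal (ker s (x - a - y) * majorant y) * e y \<partial>lborel) \<partial>lborel)
    \<le> ennreal (op_bound s) * (\<integral>\<^sup>+y. ennreal (majorant y) * e y \<partial>lborel)"
proof -
  have "(\<integral>\<^sup>+x. ennreal (majorant x) * (\<integral>\<^sup>+y. ennreal (ker s (x - a - y) * majorant y) * e y \<partial>lborel) \<partial>lborel)
      = (\<integral>\<^sup>+x. (\<integral>\<^sup>+y. ennreal (majorant x) * (ennreal (ker s (x - a - y) * majorant y) * e y) \<partial>lborel) \<partial>lborel)"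
    by (intro nn_integral_cong nn_integral_cmult[symmetric]) measurable
  also have "\<dots> = (\<integral>\<^sup>+y. (\<integral>\<^sup>+x. ennreal (majorant x) * (ennreal (ker s (x - a - y) * majorant y) * e y) \<partial>lborel) \<partial>lborel)"
    by (rule lborel_pair.Fubini') measurable
  also have "\<dots> = (\<integral>\<^sup>+y. (\<integral>\<^sup>+x. ennreal (ker s ((a + y) - x) * majorant x) \<partial>lborel) * (ennreal (majorant y) * e y) \<partial>lborel)"
  proof (intro nn_integral_cong)
    fix y
    have "ennreal (majorant x) * (ennreal (ker s (x - a - y) * majorant y) * e y) = ennreal (ker s ((a + y) - x) * majorant x) * (ennreal (majorant y) * e y)" for x
    proof -
      have "ker s (x - a - y) = ker s ((a + y) - x)"
        using ker_minus[of s "(a + y) - x"] by (simp add: algebra_simps)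
      then show ?thesis
        using majorant_nonneg ker_nonneg[OF s] by (simp add: ennreal_mult' mult_ac)
    qed
    then show "(\<integral>\<^sup>+x. ennreal (majorant x) * (ennreal (ker s (x - a - y) * majorant y) * e y) \<partial>lborel)
        = (\<integral>\<^sup>+x. ennreal (ker s ((a + y) - x) * majorant x) \<partial>lborel) * (ennreal (majorant y) * e y)"
      by (simp only:) (rule nn_integral_multc, measurable)
  qed
  also have "\<dots> \<le> (\<integral>\<^sup>+y. ennreal (op_bound s) * (ennreal (majorant y) * e y) \<partial>lborel)"
    by (intro nn_integral_mono mult_right_mono ker_majorant_bound s) simp
  also have "\<dots> = ennreal (op_bound s) * (\<integral>\<^sup>+y. ennreal (majorant y) * e y \<partial>lborel)"
    by (rule nn_integral_cmult) measurable
  finally show ?thesis .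
qed

text \<open>The difference \<open>e\<close> of \<open>w\<close> and \<open>f\<close> on the cell satisfies \<open>e = T e\<close>, since the inhomogeneous terms agree.
  Its weighted \<open>L\<^sub>1\<close> norm is finite and at most half of itself, hence 0.\<close>
lemma T_op_solution_unique:
  fixes w :: "real ^ 'n \<Rightarrow> complex" and f :: "'n bfun"
  assumes s: "s > 0" and half: "phase_bound p \<mu> * op_bound s \<le> 1 / 2"
    and rep: "cell_rep u w" and Vw: "integrable lborel (\<lambda>y. V y *\<^sub>R w y)"
    and weq: "cell_equation V s p \<mu> w"
    and f: "f = T_op s p \<mu> f + G_op s p w"
  shows "AE x in lborel. x \<in> cell \<longrightarrow> u x = f x"
proof -
  note w = cell_repD(1)[OF rep] and w0 = cell_repD(2)[OF rep]
  have [measurable]: "w \<in> borel_measurable borel" using w by auto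
  define e where "e y = indicator cell y *\<^sub>R (w y - f y)" for y
  have [measurable]: "e \<in> borel_measurable borel" unfolding e_def[abs_def] by measurable
  define N where "N y = ennreal (norm (e y))" for y
  have [measurable]: "N \<in> borel_measurable borel" unfolding N_def[abs_def] by measurable
  define J where "J k x = (\<integral>\<^sup>+y. ennreal (ker s (x - shiftv k - y) * majorant y) * N y \<partial>lborel)" for k x
  have [measurable]: "J k \<in> borel_measurable borel" for k unfolding J_def[abs_def] by measurable
  define c where "c k = norm (phase p k) * (1 + norm \<mu>)" for k :: "int ^ 'n"
  have c0: "c k \<ge> 0" for k by (simp add: c_def)
  have Vmw: "integrable lborel (\<lambda>y. (\<mu> - complex_of_real (V y)) * w y)"
  proof -
    have "integrable lborel (\<lambda>y. \<mu> * w y - V y *\<^sub>R w y)"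
      by (intro Bochner_Integration.integrable_diff integrable_mult_right w Vw)
    then show ?thesis by (simp add: left_diff_distrib scaleR_conv_of_real)
  qed
  have int1: "AE x in lborel. \<forall>k\<in>near. integrable lborel (\<lambda>y. ker s (x - shiftv k - y) *\<^sub>R ((\<mu> - complex_of_real (V y)) * w y))"
    unfolding AE_ball_countable[OF countable_finite[OF finite_near]]
  proof
    fix k
    show "AE x in lborel. integrable lborel (\<lambda>y. ker s (x - shiftv k - y) *\<^sub>R ((\<mu> - complex_of_real (V y)) * w y))"
      using AE_lborel_shift[OF convolution_integrable(1)[OF ker_integrable[OF s] Vmw], of "- shiftv k"] by simp
  qed
  \<comment> \<open>The equation \<open>e = T e\<close> in terms of absolute values, multiplied by the weight.\<close>
  have pt: "AE x in lborel. ennreal (majorant x) * N x \<le> (\<Sum>k\<in>near. ennreal (c k) * (ennreal (majorant x) * J k x))"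
    using int1 weq[unfolded cell_equation_def]
  proof eventually_elim
    case (elim x)
    show ?case
    proof (cases "x \<in> cell")
      case False
      then show ?thesis by (simp add: majorant_def)
    next
      case True
      let ?a = "\<lambda>k y. ker s (x - shiftv k - y) *\<^sub>R ((\<mu> - complex_of_real (V y)) * w y)"
      let ?b = "\<lambda>k y. ker s (x - shiftv k - y) *\<^sub>R ((\<mu> - complex_of_real (V y)) * (indicator cell y *\<^sub>R f y))"
      let ?d = "\<lambda>k y. ker s (x - shiftv k - y) *\<^sub>R ((\<mu> - complex_of_real (V y)) * e y)"
      note bi = ker_conv_potential(1)[OF s, of _ \<mu> f]
      have dk: "?d k y = ?a k y - ?b k y" for k y
        using w0[of y] by (cases "y \<in> cell") (auto simp: e_def algebra_simps)
      have di: "integrable lborel (?d k)" if "k \<in> near" for k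
        unfolding dk using elim(1) that bi by (intro Bochner_Integration.integrable_diff) auto
      have wx: "w x = (\<Sum>k\<in>near. phase p k * (conv (eta s) w (x - shiftv k) + (LINT y|lborel. ?a k y)))"
      proof -
        have "(LINT y|lborel. ?a k y) = - conv (ker s) (\<lambda>y. (complex_of_real (V y) - \<mu>) * w y) (x - shiftv k)" for k
        proof -
          have "?a k y = - (ker s (x - shiftv k - y) *\<^sub>R ((complex_of_real (V y) - \<mu>) * w y))" for y
            by (simp add: algebra_simps)
          then show ?thesis by (simp only: Bochner_Integration.integral_minus)
        qed
        then show ?thesis using elim(2) True by simp
      qed
      have fx: "f x = (\<Sum>k\<in>near. phase p k * (conv (eta s) w (x - shiftv k) + (LINT y|lborel. ?b k y)))"
      proof -
        have "f x = apply_bcontfun (T_op s p \<mu> f) x + apply_bcontfun (G_op s p w) x"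
          by (subst f) simp
        then show ?thesis
          unfolding apply_T_op[OF s] apply_G_op[OF s w] by (simp add: sum.distrib distrib_left)
      qed
      have "e x = (\<Sum>k\<in>near. phase p k * (LINT y|lborel. ?d k y))"
      proof -
        have d: "(LINT y|lborel. ?d k y) = (LINT y|lborel. ?a k y) - (LINT y|lborel. ?b k y)" if "k \<in> near" for k
          unfolding dk using elim(1) that bi by (intro Bochner_Integration.integral_diff) auto
        have "(\<Sum>k\<in>near. phase p k * (LINT y|lborel. ?d k y))
            = (\<Sum>k\<in>near. phase p k * ((LINT y|lborel. ?a k y) - (LINT y|lborel. ?b k y)))"
          by (intro sum.cong refl arg_cong[of _ _ "(*) _"] d)
        also have "\<dots> = w x - f x"
          unfolding wx fx sum_subtractf[symmetric] right_diff_distrib[symmetric] by (simp only: add_diff_cancel_left)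
        finally have "(\<Sum>k\<in>near. phase p k * (LINT y|lborel. ?d k y)) = w x - f x" .
        then show ?thesis using True by (simp add: e_def)
      qed
      then have "norm (e x) \<le> (\<Sum>k\<in>near. norm (phase p k) * norm (LINT y|lborel. ?d k y))"
        by (simp add: norm_mult sum_norm_le)
      then have "N x \<le> ennreal (\<Sum>k\<in>near. norm (phase p k) * norm (LINT y|lborel. ?d k y))"
        unfolding N_def by (rule ennreal_leI)
      also have "\<dots> = (\<Sum>k\<in>near. ennreal (norm (phase p k)) * ennreal (norm (LINT y|lborel. ?d k y)))"
        by (simp add: ennreal_mult' flip: sum_ennreal)
      also have "\<dots> \<le> (\<Sum>k\<in>near. ennreal (c k) * J k x)"
      proof (rule sum_mono)
        fix k :: "int ^ 'n" assume k: "k \<in> near"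
        have "ennreal (norm (LINT y|lborel. ?d k y)) \<le> (\<integral>\<^sup>+y. ennreal (norm (?d k y)) \<partial>lborel)"
          by (rule integral_norm_bound_ennreal[OF di[OF k]])
        also have "\<dots> \<le> (\<integral>\<^sup>+y. ennreal (1 + norm \<mu>) * (ennreal (ker s (x - shiftv k - y) * majorant y) * N y) \<partial>lborel)"
        proof (intro nn_integral_mono)
          fix y
          have "norm (\<mu> - complex_of_real (V y)) * norm (e y) \<le> (1 + norm \<mu>) * majorant y * norm (e y)"
          proof (cases "y \<in> cell")
            case True
            have "norm (\<mu> - complex_of_real (V y)) \<le> norm \<mu> + \<bar>V y\<bar>" using norm_triangle_ineq4[of \<mu> "complex_of_real (V y)"] by simp
            also have "\<dots> \<le> (1 + norm \<mu>) * (1 + \<bar>V y\<bar>)" by (simp add: algebra_simps)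
            finally show ?thesis using True by (intro mult_right_mono) (simp_all add: majorant_def)
          qed (simp add: e_def)
          then have "norm (?d k y) \<le> ker s (x - shiftv k - y) * ((1 + norm \<mu>) * majorant y * norm (e y))"
            using ker_nonneg[OF s, of "x - shiftv k - y"] by (simp add: norm_mult mult_left_mono)
          then have "ennreal (norm (?d k y)) \<le> ennreal ((1 + norm \<mu>) * ((ker s (x - shiftv k - y) * majorant y) * norm (e y)))"
            by (intro ennreal_leI) (simp add: mult_ac)
          also have "\<dots> = ennreal (1 + norm \<mu>) * (ennreal (ker s (x - shiftv k - y) * majorant y) * N y)"
            unfolding N_def by (simp only: ennreal_mult'[OF add_nonneg_nonneg[OF zero_le_one norm_ge_zero]] ennreal_mult''[OF norm_ge_zero])
          finally show "ennreal (norm (?d k y)) \<le> ennreal (1 + norm \<mu>) * (ennreal (ker s (x - shiftv k - y) * majorant y) * N y)" .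
        qed
        also have "\<dots> = ennreal (1 + norm \<mu>) * J k x"
          unfolding J_def by (rule nn_integral_cmult) measurable
        finally have "ennreal (norm (phase p k)) * ennreal (norm (LINT y|lborel. ?d k y))
          \<le> ennreal (norm (phase p k)) * (ennreal (1 + norm \<mu>) * J k x)"
          by (rule mult_left_mono) simp
        then show "ennreal (norm (phase p k)) * ennreal (norm (LINT y|lborel. ?d k y))
          \<le> ennreal (c k) * J k x"
          unfolding c_def ennreal_mult'[OF norm_ge_zero] by (simp only: mult.assoc)
      qed
      finally have "ennreal (majorant x) * N x \<le> ennreal (majorant x) * (\<Sum>k\<in>near. ennreal (c k) * J k x)"
        by (rule mult_left_mono) simp
      then show ?thesis by (simp add: sum_distrib_left mult_ac)
    qed
  qed
  let ?I = "\<integral>\<^sup>+x. ennreal (majorant x) * N x \<partial>lborel"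
  have "?I \<le> (\<integral>\<^sup>+x. (\<Sum>k\<in>near. ennreal (c k) * (ennreal (majorant x) * J k x)) \<partial>lborel)"
    by (rule nn_integral_mono_AE[OF pt])
  also have "\<dots> = (\<Sum>k\<in>near. \<integral>\<^sup>+x. ennreal (c k) * (ennreal (majorant x) * J k x) \<partial>lborel)"
    by (rule nn_integral_sum) measurable
  also have "\<dots> = (\<Sum>k\<in>near. ennreal (c k) * (\<integral>\<^sup>+x. ennreal (majorant x) * J k x \<partial>lborel))"
    by (intro sum.cong refl nn_integral_cmult) measurable
  also have "\<dots> \<le> (\<Sum>k\<in>near. ennreal (c k) * (ennreal (op_bound s) * ?I))"
    unfolding J_def by (intro sum_mono mult_left_mono majorant_double_integral s) auto
  also have "\<dots> = (\<Sum>k\<in>near. ennreal (c k)) * (ennreal (op_bound s) * ?I)"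
    by (rule sum_distrib_right[symmetric])
  also have "(\<Sum>k\<in>near. ennreal (c k)) = ennreal (phase_bound p \<mu>)"
    unfolding phase_bound_def c_def[symmetric] by (rule sum_ennreal[OF c0])
  finally have "?I \<le> ennreal (phase_bound p \<mu>) * (ennreal (op_bound s) * ?I)" .
  also have "\<dots> = ennreal (phase_bound p \<mu> * op_bound s) * ?I"
    by (simp only: ennreal_mult''[OF op_bound_nonneg] mult.assoc)
  also have "\<dots> \<le> ennreal (1 / 2) * ?I"
    by (intro mult_right_mono ennreal_leI half) simp
  finally have I_le: "?I \<le> ennreal (1 / 2) * ?I" .
  have Me: "integrable lborel (\<lambda>x. majorant x *\<^sub>R e x)"
  proof (rule Bochner_Integration.integrable_bound)
    show "integrable lborel (\<lambda>x. norm (w x) + norm (V x *\<^sub>R w x) + majorant x * norm f)"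
      by (intro Bochner_Integration.integrable_add integrable_norm w Vw integrable_mult_left majorant_integrable)
    show "AE x in lborel. norm (majorant x *\<^sub>R e x) \<le> norm (norm (w x) + norm (V x *\<^sub>R w x) + majorant x * norm f)"
    proof (rule AE_I2)
      fix x
      show "norm (majorant x *\<^sub>R e x) \<le> norm (norm (w x) + norm (V x *\<^sub>R w x) + majorant x * norm f)"
      proof (cases "x \<in> cell")
        case True
        have "norm (e x) \<le> norm (w x) + norm (f x)" using True by (simp add: e_def norm_triangle_ineq4)
        also have "\<dots> \<le> norm (w x) + norm f" by (simp add: norm_bounded)
        finally have "majorant x * norm (e x) \<le> majorant x * (norm (w x) + norm f)" by (rule mult_left_mono[OF _ majorant_nonneg])
        also have "\<dots> = norm (w x) + norm (V x *\<^sub>R w x) + majorant x * norm f"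
          using True by (simp add: majorant_def algebra_simps)
        finally show ?thesis using majorant_nonneg[of x] by simp
      qed (simp add: e_def)
    qed
  qed measurable
  have Ie: "?I = (\<integral>\<^sup>+x. ennreal (norm (majorant x *\<^sub>R e x)) \<partial>lborel)"
    unfolding N_def using majorant_nonneg by (intro nn_integral_cong) (simp add: ennreal_mult')
  have "?I < \<infinity>" unfolding Ie using Me by (simp add: integrable_iff_bounded)
  have "?I = 0"
  proof (rule ccontr)
    assume nz: "?I \<noteq> 0"
    obtain r where r: "?I = ennreal r" "r \<ge> 0" using \<open>?I < \<infinity>\<close> by (cases ?I) auto
    then have "r > 0" using nz by (cases "r = 0") auto
    have "ennreal r \<le> ennreal (1 / 2 * r)" using I_le unfolding r(1) by (simp only: ennreal_mult''[OF r(2)])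
    then show False using \<open>r > 0\<close> by (simp add: ennreal_le_iff)
  qed
  then have "AE x in lborel. ennreal (norm (majorant x *\<^sub>R e x)) = 0"
    unfolding Ie by (subst (asm) nn_integral_0_iff_AE) auto
  then show ?thesis using cell_repD(3)[OF rep]
  proof eventually_elim
    case (elim x)
    show ?case
    proof
      assume x: "x \<in> cell"
      then have "majorant x > 0" by (simp add: majorant_def add_pos_nonneg)
      then show "u x = f x" using elim x by (simp add: e_def)
    qed
  qed
qed

lemma T_op_solvable:
  assumes s: "s > 0" and half: "phase_bound p \<mu> * op_bound s \<le> 1 / 2"
  shows "\<exists>f. f = T_op s p \<mu> f + G"
proof (rule contraction_solvable[OF T_op_linear[OF s]])
  fix f
  have "norm (T_op s p \<mu> f) \<le> phase_bound p \<mu> * op_bound s * norm f" by (rule T_op_bound[OF s])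
  also have "\<dots> \<le> 1 / 2 * norm f" by (intro mult_right_mono half) simp
  finally show "norm (T_op s p \<mu> f) \<le> norm f / 2" by simp
qed

end

section \<open>Square integrable functions on the cube\<close>

lemma AE_Omega_cell: "AE x :: real ^ 'n in lborel. x \<in> Omega \<longrightarrow> x \<in> cell"
proof -
  define a b :: "real ^ 'n" where "a = (\<chi> i. -1/2)" and "b = (\<chi> i. 1/2)"
  have "AE x in lborel. x \<notin> cbox a b - box a b"
    by (rule AE_not_in_box_frontier)
  moreover have "x \<in> cell" if "x \<in> box a b" for x
    using that by (auto simp: cell_def mem_box_cart a_def b_def less_imp_le)
  moreover have "Omega = cbox a b" by (simp add: Omega_def a_def b_def)
  ultimately show ?thesis by (auto elim!: eventually_mono)
qed

lemma cell_subset_Omega: "x \<in> cell \<Longrightarrow> x \<in> Omega"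
  by (auto simp: cell_def Omega_def mem_box_cart less_imp_le)

lemma Omega_lebesgue [measurable]: "Omega \<in> sets lebesgue"
  by (simp add: Omega_def)

lemma measure_Omega: "measure lebesgue (Omega :: (real ^ 'n) set) = 1"
proof -
  have "measure lborel (cbox (\<chi> i. - 1 / 2) (\<chi> i. 1 / 2) :: (real ^ 'n) set) = 1"
    by (subst content_cbox_cart) (auto simp: interval_eq_empty_cart)
  then show ?thesis by (simp add: Omega_def)
qed

lemma finite_measure_Omega: "emeasure lebesgue (Omega :: (real ^ 'n) set) < \<infinity>"
  unfolding Omega_def using lmeasurable_cbox[unfolded fmeasurable_def] by auto

lemma Lp2_Omega_integrable:
  fixes F :: "real ^ 'n \<Rightarrow> complex"
  assumes "F \<in> Lp 2 Omega"
  shows "integrable (lebesgue_on Omega) F"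
  using Lp2_imp_set_integrable[OF assms Omega_lebesgue finite_measure_Omega]
  by (simp add: integrable_restrict_space set_integrable_def)

lemma Lp2_lincomb:
  fixes F G :: "'a::euclidean_space \<Rightarrow> complex"
  assumes "F \<in> Lp 2 S" "G \<in> Lp 2 S"
  shows "(\<lambda>x. F x + c * G x) \<in> Lp 2 S"
proof -
  have [measurable]: "F \<in> borel_measurable (lebesgue_on S)" "G \<in> borel_measurable (lebesgue_on S)"
    using assms by (auto simp: Lp_def)
  have "integrable (lebesgue_on S) (\<lambda>x. 2 * (norm (F x) powr 2) + (2 * (norm c)\<^sup>2) * (norm (G x) powr 2))"
    using assms by (intro Bochner_Integration.integrable_add integrable_mult_right) (auto simp: Lp_def)
  then have "integrable (lebesgue_on S) (\<lambda>x. norm (F x + c * G x) powr 2)"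
  proof (rule Bochner_Integration.integrable_bound)
    show "AE x in lebesgue_on S. norm (norm (F x + c * G x) powr 2) \<le> norm (2 * (norm (F x) powr 2) + (2 * (norm c)\<^sup>2) * (norm (G x) powr 2))"
    proof (rule AE_I2)
      fix x
      have "norm (F x + c * G x) \<le> norm (F x) + norm c * norm (G x)"
        by (metis norm_triangle_ineq norm_mult)
      then have "(norm (F x + c * G x))\<^sup>2 \<le> (norm (F x) + norm c * norm (G x))\<^sup>2"
        by (intro power_mono) auto
      also have "\<dots> \<le> 2 * (norm (F x))\<^sup>2 + 2 * (norm c * norm (G x))\<^sup>2"
        using sum_squares_bound[of "norm (F x)" "norm c * norm (G x)"] by (simp add: power2_sum)
      finally show "norm (norm (F x + c * G x) powr 2) \<le> norm (2 * (norm (F x) powr 2) + (2 * (norm c)\<^sup>2) * (norm (G x) powr 2))"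
        by (simp add: powr_numeral power_mult_distrib)
    qed
  qed measurable
  then show ?thesis by (auto simp: Lp_def)
qed

lemma Lp2_sub_sum:
  fixes F :: "'a::euclidean_space \<Rightarrow> complex"
  assumes "F \<in> Lp 2 S" "finite J" "\<And>j. j \<in> J \<Longrightarrow> D j \<in> Lp 2 S"
  shows "(\<lambda>x. F x - (\<Sum>j\<in>J. c j * D j x)) \<in> Lp 2 S"
  using assms(2,3)
proof (induction J rule: finite_induct)
  case empty
  then show ?case using assms(1) by simp
next
  case (insert j J)
  then have "(\<lambda>x. (F x - (\<Sum>j\<in>J. c j * D j x)) + (- c j) * D j x) \<in> Lp 2 S"
    by (intro Lp2_lincomb) auto
  moreover have "(\<lambda>x. (F x - (\<Sum>j\<in>J. c j * D j x)) + (- c j) * D j x) = (\<lambda>x. F x - (\<Sum>j\<in>insert j J. c j * D j x))"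
    using insert by (intro ext) simp
  ultimately show ?case by (simp only:)
qed

text \<open>The cube has measure 1, so the inequality says that the variance of \<open>|F|\<close> is nonnegative.\<close>
lemma L1_le_Lp2_norm:
  fixes F :: "real ^ 'n \<Rightarrow> complex"
  assumes F: "F \<in> Lp 2 Omega"
  shows "(LINT x|lebesgue_on Omega. norm (F x)) \<le> Lp_norm 2 Omega F"
proof -
  let ?L = "lebesgue_on (Omega :: (real ^ 'n) set)"
  interpret finite_measure ?L
    using finite_measure_Omega[where 'n='n] by (intro finite_measureI) (simp add: emeasure_restrict_space)
  define c where "c = (LINT x|?L. norm (F x))"
  have i1: "integrable ?L (\<lambda>x. norm (F x))" using Lp2_Omega_integrable[OF F] by simp
  have i2: "integrable ?L (\<lambda>x. norm (F x) powr 2)" using F by (simp add: Lp_def)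
  have c0: "c \<ge> 0" unfolding c_def by (intro integral_nonneg_AE) auto
  have one: "measure ?L (space ?L) = 1"
    using measure_Omega[where 'n='n] by (simp add: measure_restrict_space)
  have "0 \<le> (LINT x|?L. (norm (F x) - c)\<^sup>2)" by (intro integral_nonneg_AE) auto
  also have "(LINT x|?L. (norm (F x) - c)\<^sup>2) = (LINT x|?L. norm (F x) powr 2 - 2 * c * norm (F x) + c\<^sup>2)"
    by (intro Bochner_Integration.integral_cong refl) (simp add: power2_diff powr_numeral)
  also have "\<dots> = (LINT x|?L. norm (F x) powr 2) - 2 * c * c + c\<^sup>2"
    using i1 i2 one by (simp add: c_def)
  finally have "c\<^sup>2 \<le> (LINT x|?L. norm (F x) powr 2)" by (simp add: power2_eq_square)
  then have "c \<le> sqrt (LINT x|?L. norm (F x) powr 2)" by (rule real_le_rsqrt)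
  moreover have "(LINT x|?L. norm (F x) powr 2) \<ge> 0" by (intro integral_nonneg_AE) auto
  ultimately show ?thesis by (simp add: Lp_norm_def c_def powr_half_sqrt)
qed

lemma integral_norm_cell:
  fixes W F :: "real ^ 'n \<Rightarrow> complex"
  assumes rep: "cell_rep F W" and F: "integrable (lebesgue_on Omega) F"
  shows "(LINT y|lborel. norm (W y)) = (LINT x|lebesgue_on Omega. norm (F x))"
proof -
  note W = cell_repD(1)[OF rep] and W0 = cell_repD(2)[OF rep] and eq = cell_repD(3)[OF rep]
  have m: "(\<lambda>y. norm (W y)) \<in> borel_measurable lborel" using W by auto
  have "(LINT y|lborel. norm (W y)) = (LINT y|lebesgue. norm (W y))"
    by (rule integral_completion[OF m, symmetric])
  also have "\<dots> = (LINT y|lebesgue. indicator Omega y *\<^sub>R norm (F y))"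
  proof (rule integral_cong_AE)
    show "(\<lambda>y. norm (W y)) \<in> borel_measurable lebesgue" by (rule measurable_completion[OF m])
    show "(\<lambda>y. indicator Omega y *\<^sub>R norm (F y)) \<in> borel_measurable lebesgue"
      using integrable_norm[OF F] by (intro borel_measurable_integrable) (simp add: integrable_restrict_space)
    have "AE y in lborel. norm (W y) = indicator Omega y *\<^sub>R norm (F y)"
      using eq AE_Omega_cell
    proof eventually_elim
      case (elim y)
      then show ?case using W0[of y] cell_subset_Omega[of y] by (cases "y \<in> cell") (auto simp: indicator_def)
    qed
    then show "AE y in lebesgue. norm (W y) = indicator Omega y *\<^sub>R norm (F y)" by (rule AE_completion)
  qed
  also have "\<dots> = (LINT x|lebesgue_on Omega. norm (F x))"
    by (simp add: integral_restrict_space)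
  finally show ?thesis .
qed

lemma Lp2_Omega_representative:
  fixes F :: "real ^ 'n \<Rightarrow> complex"
  assumes F: "F \<in> Lp 2 Omega"
  shows "\<exists>W. cell_rep F W"
proof -
  have i: "integrable lebesgue (\<lambda>x. indicator Omega x *\<^sub>R F x)"
    using Lp2_Omega_integrable[OF F] by (simp add: integrable_restrict_space)
  then obtain v where [measurable]: "v \<in> borel_measurable borel" and v: "AE x in lborel. indicator Omega x *\<^sub>R F x = v x"
    using borel_representative[of "\<lambda>x. indicator Omega x *\<^sub>R F x"] by auto
  have m: "v \<in> borel_measurable lborel" by simp
  have "integrable lebesgue v"
    using integrable_cong_AE[OF borel_measurable_integrable[OF i] measurable_completion[OF m] AE_completion[OF v]] i by blast
  then have vi: "integrable lborel v" using integrable_completion[OF m] by simp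
  have wi: "integrable lborel (\<lambda>y. indicator cell y *\<^sub>R v y)"
    by (rule integrable_mult_indicator[OF _ vi]) simp
  have "AE x in lborel. x \<in> cell \<longrightarrow> F x = indicator cell x *\<^sub>R v x"
    using v by eventually_elim (auto dest: cell_subset_Omega)
  with wi show ?thesis
    by (intro exI[of _ "\<lambda>y. indicator cell y *\<^sub>R v y"]) (simp add: cell_rep_def)
qed

section \<open>Continuous representatives\<close>

lemma C_rep_bfun:
  fixes f :: "'n::finite bfun"
  assumes "AE x in lborel. x \<in> cell \<longrightarrow> u x = f x"
  shows "C_rep Omega u f"
  unfolding C_rep_def
proof
  show "apply_bcontfun f \<in> C_space Omega" by (simp add: C_space_def)
  have "AE x in lborel. x \<in> Omega \<longrightarrow> f x = u x"
    using assms AE_Omega_cell by eventually_elim auto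
  then show "AE x in lebesgue_on Omega. f x = u x"
    by (subst AE_restrict_space_iff) (auto intro: AE_completion)
qed

text \<open>A nonnegative continuous function on a nondegenerate box with integral 0 vanishes identically.\<close>
lemma C_rep_unique:
  fixes u :: "real ^ 'n \<Rightarrow> complex"
  assumes "C_rep Omega u g" "C_rep Omega u g'" and x: "x \<in> Omega"
  shows "g x = g' x"
proof -
  define h where "h x = norm (g x - g' x)" for x
  have cont: "continuous_on Omega h"
    using assms(1,2) unfolding h_def[abs_def] C_rep_def C_space_def by (auto intro!: continuous_intros)
  have "AE x in lebesgue_on Omega. g x = u x" "AE x in lebesgue_on Omega. g' x = u x"
    using assms by (auto simp: C_rep_def)
  then have "AE x in lebesgue_on Omega. h x = 0" by eventually_elim (simp add: h_def)
  then have ae: "AE x in lebesgue. x \<in> Omega \<longrightarrow> h x = 0"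
    by (subst (asm) AE_restrict_space_iff) auto
  then have neg: "negligible {x. \<not> (x \<in> Omega \<longrightarrow> h x = 0)}"
    using AE_iff_null_sets by (simp add: negligible_iff_null_sets completion.AE_iff_null_sets)
  have "(h has_integral 0) Omega"
    by (rule has_integral_spike[OF neg _ has_integral_0]) auto
  then have "h x = 0"
    using cont x unfolding Omega_def
    by (intro has_integral_0_cbox_imp_0[of _ _ h]) (auto simp: h_def interval_ne_empty_cart)
  then show ?thesis by (simp add: h_def)
qed

section \<open>Complex differentiability of families of bounded continuous functions\<close>

text \<open>Real differentiability with complex homogeneous derivative. The existence form makes product and
  sum rules composable without tracking the derivatives.\<close>
definition cdiff_scalar :: "(complex ^ 'n \<Rightarrow> complex) \<Rightarrow> complex ^ 'n \<Rightarrow> bool" where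
  "cdiff_scalar c p \<longleftrightarrow> (\<exists>c'. (c has_derivative c') (at p) \<and> (\<forall>a h. c' (a *s h) = a * c' h))"

definition cdiff :: "(complex ^ 'n \<Rightarrow> ('a::topological_space \<Rightarrow>\<^sub>C complex)) \<Rightarrow> complex ^ 'n \<Rightarrow> bool" where
  "cdiff F p \<longleftrightarrow> (\<exists>F'. (F has_derivative F') (at p) \<and> (\<forall>a h. F' (a *s h) = cscale a (F' h)))"

lemma cdiff_scalar_isCont: "cdiff_scalar c p \<Longrightarrow> isCont c p"
  unfolding cdiff_scalar_def by (auto dest: has_derivative_continuous)

lemma cdiff_scalar_mult:
  assumes "cdiff_scalar c p" "cdiff_scalar e p"
  shows "cdiff_scalar (\<lambda>q. c q * e q) p"
proof -
  obtain c' e' where c: "(c has_derivative c') (at p)" "\<And>a h. c' (a *s h) = a * c' h"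
    and e: "(e has_derivative e') (at p)" "\<And>a h. e' (a *s h) = a * e' h"
    using assms unfolding cdiff_scalar_def by blast
  show ?thesis unfolding cdiff_scalar_def
    by (rule exI, rule conjI, rule has_derivative_mult[OF c(1) e(1)])
       (simp add: c(2) e(2) algebra_simps)
qed

lemma cdiff_scalar_phase:
  fixes p :: "complex ^ 'n"
  shows "cdiff_scalar (\<lambda>q. phase q k) p"
proof -
  let ?l = "\<lambda>q :: complex ^ 'n. \<i> * (\<Sum>j\<in>UNIV. q $ j * of_int (k $ j))"
  have l: "(?l has_derivative ?l) (at p)"
  proof (rule bounded_linear_imp_has_derivative)
    show "bounded_linear ?l"
      by (intro bounded_linear_const_mult bounded_linear_sum bounded_linear_mult_const bounded_linear_vec_nth)
  qed
  have E: "((\<lambda>q. exp (?l q)) has_derivative (\<lambda>h. exp (?l p) * ?l h)) (at p)"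
    using has_derivative_compose[OF l, of exp "(*) (exp (?l p))"] DERIV_exp[of "?l p"]
    by (simp add: has_field_derivative_def)
  have hom: "?l (a *s h) = a * ?l h" for a h
    by (simp add: sum_distrib_left mult_ac)
  have "\<forall>a h. exp (?l p) * ?l (a *s h) = a * (exp (?l p) * ?l h)"
    unfolding hom by (simp only: mult.left_commute simp_thms)
  with E show ?thesis unfolding cdiff_scalar_def phase_def
    by (intro exI[of _ "\<lambda>h. exp (?l p) * ?l h"] conjI)
qed

lemma cdiff_const: "cdiff (\<lambda>q. x) p"
  unfolding cdiff_def
  by (rule exI[of _ "\<lambda>_. 0"]) (auto intro: bcontfun_eqI)

lemma cdiff_add:
  assumes "cdiff F p" "cdiff G p"
  shows "cdiff (\<lambda>q. F q + G q) p"
proof -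
  obtain F' G' where F: "(F has_derivative F') (at p)" "\<And>a h. F' (a *s h) = cscale a (F' h)"
    and G: "(G has_derivative G') (at p)" "\<And>a h. G' (a *s h) = cscale a (G' h)"
    using assms unfolding cdiff_def by blast
  show ?thesis unfolding cdiff_def
    by (rule exI, rule conjI, rule has_derivative_add[OF F(1) G(1)])
       (simp add: F(2) G(2) bounded_bilinear.add_right[OF bounded_bilinear_cscale])
qed

lemma cdiff_sum:
  assumes "\<And>j. j \<in> J \<Longrightarrow> cdiff (F j) p"
  shows "cdiff (\<lambda>q. \<Sum>j\<in>J. F j q) p"
  using assms by (induction J rule: infinite_finite_induct) (auto intro: cdiff_const cdiff_add)

lemma cdiff_cscale:
  assumes "cdiff_scalar c p" "cdiff F p"
  shows "cdiff (\<lambda>q. cscale (c q) (F q)) p"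
proof -
  obtain c' F' where c: "(c has_derivative c') (at p)" "\<And>a h. c' (a *s h) = a * c' h"
    and F: "(F has_derivative F') (at p)" "\<And>a h. F' (a *s h) = cscale a (F' h)"
    using assms unfolding cdiff_def cdiff_scalar_def by blast
  show ?thesis unfolding cdiff_def
    by (rule exI, rule conjI, rule bounded_bilinear.FDERIV[OF bounded_bilinear_cscale c(1) F(1)])
       (simp add: F(2) c(2) cscale_cscale bounded_bilinear.add_right[OF bounded_bilinear_cscale] mult.commute)
qed

lemma complex_homogeneous_expansion:
  assumes "bounded_linear F'" "\<And>a h. F' (a *s h) = cscale a (F' h)"
  shows "F' h = (\<Sum>j\<in>UNIV. cscale (h $ j) (F' (axis j 1)))"
proof -
  have "F' h = F' (\<Sum>j\<in>UNIV. (h $ j) *s axis j 1)" by (simp add: basis_expansion)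
  also have "\<dots> = (\<Sum>j\<in>UNIV. F' ((h $ j) *s axis j 1))"
    by (rule linear_sum[OF bounded_linear.linear[OF assms(1)]])
  finally show ?thesis by (simp add: assms(2))
qed

lemma bounded_linear_cscale_sum:
  fixes E :: "'n::finite \<Rightarrow> ('a::topological_space \<Rightarrow>\<^sub>C complex)"
  shows "bounded_linear (\<lambda>h. \<Sum>j\<in>UNIV. cscale (h $ j) (E j))"
  by (intro bounded_linear_sum bounded_linear_compose[OF bounded_bilinear.bounded_linear_left[OF bounded_bilinear_cscale]]
      bounded_linear_vec_nth)

lemma sup_norm_bfun_le:
  fixes f :: "'n::finite bfun"
  assumes "\<And>x. x \<in> Omega \<Longrightarrow> F x = f x"
  shows "0 \<le> sup_norm Omega F" "sup_norm Omega F \<le> norm f"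
proof -
  have z: "(0 :: real ^ 'n) \<in> Omega" by (simp add: Omega_def mem_box_cart)
  have b: "norm (F x) \<le> norm f" if "x \<in> Omega" for x using assms[OF that] norm_bounded[of f x] by simp
  show "sup_norm Omega F \<le> norm f"
    unfolding sup_norm_def using z b by (intro cSUP_least) auto
  have "0 \<le> norm (F 0)" by simp
  also have "\<dots> \<le> sup_norm Omega F"
    unfolding sup_norm_def using z b by (intro cSUP_upper bdd_aboveI2[of _ _ "norm f"])
  finally show "0 \<le> sup_norm Omega F" .
qed

section \<open>Eigenfunctions as solutions of the fixed point equation\<close>

context cell_potential
begin

lemma T_op_diff_bound:
  assumes s: "s > 0"
  shows "norm (T_op s p \<mu> f - T_op s p' \<mu>' f)
    \<le> (\<Sum>k\<in>near. (norm (phase p k - phase p' k) + norm (phase p k * \<mu> - phase p' k * \<mu>')) * op_bound s) * norm f"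
proof -
  note dl = bounded_bilinear.diff_left[OF bounded_bilinear_cscale]
  have "T_op s p \<mu> f - T_op s p' \<mu>' f = (\<Sum>k\<in>near. cscale (phase p k - phase p' k) (ker_op s W1 k f)
      + cscale (phase p k * \<mu> - phase p' k * \<mu>') (ker_op s W0 k f))"
    unfolding T_op_def sum_subtractf[symmetric] dl by (intro sum.cong refl) simp
  also have "norm \<dots> \<le> (\<Sum>k\<in>near. (norm (phase p k - phase p' k) + norm (phase p k * \<mu> - phase p' k * \<mu>')) * op_bound s * norm f)"
  proof (rule sum_norm_le)
    fix k :: "int ^ 'n"
    let ?c = "phase p k - phase p' k" and ?e = "phase p k * \<mu> - phase p' k * \<mu>'"
    have "norm (cscale ?c (ker_op s W1 k f) + cscale ?e (ker_op s W0 k f))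
       \<le> norm ?c * norm (ker_op s W1 k f) + norm ?e * norm (ker_op s W0 k f)"
      by (rule norm_triangle_le[OF add_mono[OF norm_cscale_le norm_cscale_le]])
    also have "\<dots> \<le> norm ?c * (op_bound s * norm f) + norm ?e * (op_bound s * norm f)"
      by (intro add_mono mult_left_mono ker_op_bound s admissible_W) auto
    finally show "norm (cscale ?c (ker_op s W1 k f) + cscale ?e (ker_op s W0 k f)) \<le> (norm ?c + norm ?e) * op_bound s * norm f"
      by (simp add: algebra_simps)
  qed
  finally show ?thesis by (simp add: sum_distrib_right)
qed

lemma eigenfunction_fixed_point:
  assumes V0: "lattice_periodic V0" and ae: "AE x in lborel. V0 x = V x"
    and ef: "eigenfunction V0 p \<mu> u" and s: "s > 0" "s \<le> 1" and half: "phase_bound p \<mu> * op_bound s \<le> 1 / 2"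
  shows "\<exists>w f. cell_rep u w \<and> f = T_op s p \<mu> f + G_op s p w \<and> C_rep Omega u (apply_bcontfun f)"
proof -
  obtain w where w: "cell_rep u w" and Vw: "integrable lborel (\<lambda>y. V y *\<^sub>R w y)"
    and eq: "cell_equation V s p \<mu> w"
    using eigenfunction_cell_equation[OF V0 V_borel ae ef] s by blast
  obtain f where f: "f = T_op s p \<mu> f + G_op s p w" using T_op_solvable[OF s(1) half] by blast
  have "C_rep Omega u (apply_bcontfun f)"
    by (rule C_rep_bfun[OF T_op_solution_unique[OF s(1) half w Vw eq f]])
  with w f show ?thesis by blast
qed

lemma phase_bound_nonneg: "phase_bound p \<mu> \<ge> 0"
  unfolding phase_bound_def by (intro sum_nonneg mult_nonneg_nonneg) auto

text \<open>The summand 1 leaves room for moving the parameters: the same scale \<open>s\<close> gives a contraction for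
  all nearby \<open>p\<close> and \<open>\<mu>\<close>.\<close>
lemma small_scale: "\<exists>s>0. s \<le> 1 \<and> (phase_bound p \<mu> + 1) * op_bound s \<le> 1 / 2"
proof -
  have pos: "phase_bound p \<mu> + 1 > 0" using phase_bound_nonneg[of p \<mu>] by linarith
  then obtain s where "s > 0" "s \<le> 1" "op_bound s \<le> 1 / (2 * (phase_bound p \<mu> + 1))"
    using small_op_bound[of "1 / (2 * (phase_bound p \<mu> + 1))"] by auto
  with pos show ?thesis by (intro exI[of _ s]) (simp add: field_simps)
qed

lemma eigenfunction_continuous:
  assumes "lattice_periodic V0" "AE x in lborel. V0 x = V x" "eigenfunction V0 p \<mu> u"
  shows "\<exists>g. C_rep Omega u g"
proof -
  obtain s where s: "s > 0" "s \<le> 1" "(phase_bound p \<mu> + 1) * op_bound s \<le> 1 / 2" using small_scale by blast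
  then have "phase_bound p \<mu> * op_bound s \<le> 1 / 2" using op_bound_nonneg[of s] by (simp add: algebra_simps)
  then show ?thesis using eigenfunction_fixed_point[OF assms s(1,2)] by blast
qed

text \<open>The operator is bounded from \<open>L\<^sub>1\<close> of the cell to the bounded continuous functions, and the \<open>L\<^sub>1\<close> norm of the
  remainder is at most its \<open>L\<^sub>2\<close> norm on the cube.\<close>
lemma eta_op_cdiff:
  fixes b :: "complex ^ 'n \<Rightarrow> real ^ 'n \<Rightarrow> complex"
  assumes s: "s > 0" and S: "open S" "p \<in> S"
    and b: "\<And>q. q \<in> S \<Longrightarrow> b q \<in> Lp 2 Omega" and D: "\<And>j. D j \<in> Lp 2 Omega"
    and lim: "((\<lambda>h. Lp_norm 2 Omega (\<lambda>x. b (p + h) x - b p x - (\<Sum>j\<in>UNIV. h $ j * D j x)) / norm h) \<longlongrightarrow> 0) (at 0)"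
    and rep: "\<And>q. q \<in> S \<Longrightarrow> cell_rep (b q) (w q)"
  shows "cdiff (\<lambda>q. eta_op s k (w q)) p"
proof -
  note w = cell_repD[OF rep]
  have "\<exists>W. cell_rep (D j) W" for j by (rule Lp2_Omega_representative[OF D])
  then obtain W where "\<And>j. cell_rep (D j) (W j)" by metis
  note W = cell_repD[OF this]
  obtain B where B: "B \<ge> 0" "\<And>h. integrable lborel h \<Longrightarrow> norm (eta_op s k h) \<le> B * (LINT y|lborel. norm (h y))"
    using eta_op_bound[OF s] by blast
  let ?F' = "\<lambda>h. \<Sum>j\<in>UNIV. cscale (h $ j) (eta_op s k (W j))"
  let ?R = "\<lambda>h. Lp_norm 2 Omega (\<lambda>x. b (p + h) x - b p x - (\<Sum>j\<in>UNIV. h $ j * D j x))"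
  have est: "norm (eta_op s k (w (p + h)) - eta_op s k (w p) - ?F' h) \<le> B * ?R h" if h: "p + h \<in> S" for h
  proof -
    let ?r = "\<lambda>y. w (p + h) y - w p y - (\<Sum>j\<in>UNIV. h $ j * W j y)"
    let ?F = "\<lambda>x. b (p + h) x - b p x - (\<Sum>j\<in>UNIV. h $ j * D j x)"
    have i1: "integrable lborel (\<lambda>y. w (p + h) y - w p y)" "integrable lborel (\<lambda>y. \<Sum>j\<in>UNIV. h $ j * W j y)"
      by (intro Bochner_Integration.integrable_diff Bochner_Integration.integrable_sum integrable_mult_right w(1) h S W)+
    have i2: "integrable lborel ?r" by (intro Bochner_Integration.integrable_diff i1)
    have eq: "eta_op s k ?r = eta_op s k (w (p + h)) - eta_op s k (w p) - ?F' h"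
      unfolding eta_op_diff[OF s i1] eta_op_diff[OF s w(1)[OF h] w(1)[OF S(2)]]
      by (subst eta_op_sum_cscale[OF s W(1)]) (rule refl)
    have F2: "?F \<in> Lp 2 Omega"
      using Lp2_lincomb[OF b[OF h] b[OF S(2)], of "-1"] by (intro Lp2_sub_sum D) auto
    have "AE x in lborel. x \<in> cell \<longrightarrow> ?F x = ?r x"
    proof -
      have "AE x in lborel. \<forall>j. x \<in> cell \<longrightarrow> D j x = W j x"
        by (rule eventually_all_finite[OF W(3)])
      with w(3)[OF h] w(3)[OF S(2)] show ?thesis by eventually_elim auto
    qed
    then have "cell_rep ?F ?r" using i2 by (simp add: cell_rep_def w(2) h S W(2))
    then have "(LINT y|lborel. norm (?r y)) = (LINT x|lebesgue_on Omega. norm (?F x))"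
      by (rule integral_norm_cell[OF _ Lp2_Omega_integrable[OF F2]])
    also have "\<dots> \<le> ?R h" by (rule L1_le_Lp2_norm[OF F2])
    finally have "B * (LINT y|lborel. norm (?r y)) \<le> B * ?R h" by (rule mult_left_mono[OF _ B(1)])
    then show ?thesis using B(2)[OF i2] unfolding eq by linarith
  qed
  have "((\<lambda>q. eta_op s k (w q)) has_derivative ?F') (at p)"
    unfolding has_derivative_at
  proof
    show "bounded_linear ?F'" by (rule bounded_linear_cscale_sum)
    have "((\<lambda>h. B * (?R h / norm h)) \<longlongrightarrow> 0) (at 0)" by (rule tendsto_mult_right_zero[OF lim])
    moreover have "\<forall>\<^sub>F h in at 0. norm (norm (eta_op s k (w (p + h)) - eta_op s k (w p) - ?F' h) / norm h) \<le> B * (?R h / norm h)"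
    proof -
      have "((\<lambda>h. p + h) \<longlongrightarrow> p) (at 0)" by (auto intro!: tendsto_eq_intros)
      then have "\<forall>\<^sub>F h in at 0. p + h \<in> S" using S by (rule topological_tendstoD)
      then show ?thesis
      proof (rule eventually_mono)
        fix h assume "p + h \<in> S"
        then have "norm (eta_op s k (w (p + h)) - eta_op s k (w p) - ?F' h) / norm h \<le> B * ?R h / norm h"
          by (intro divide_right_mono est) auto
        then show "norm (norm (eta_op s k (w (p + h)) - eta_op s k (w p) - ?F' h) / norm h) \<le> B * (?R h / norm h)" by simp
      qed
    qed
    ultimately show "((\<lambda>h. norm (eta_op s k (w (p + h)) - eta_op s k (w p) - ?F' h) / norm h) \<longlongrightarrow> 0) (at 0)"
      by (rule Lim_null_comparison[rotated])
  qed
  then show ?thesis unfolding cdiff_def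
    by (intro exI[of _ ?F'] conjI) (simp_all add: cscale_sum_right cscale_cscale)
qed

lemma T_op_cdiff:
  assumes "cdiff_scalar \<mu> p"
  shows "cdiff (\<lambda>q. T_op s q (\<mu> q) f) p"
  unfolding T_op_def
  by (intro cdiff_sum cdiff_add cdiff_cscale cdiff_scalar_mult cdiff_scalar_phase assms cdiff_const)

lemma T_op_norm_continuous:
  assumes s: "s > 0" and \<mu>: "cdiff_scalar \<mu> p" and e: "e > 0"
  shows "\<exists>d>0. \<forall>q. norm (q - p) < d \<longrightarrow> (\<forall>f. norm (T_op s q (\<mu> q) f - T_op s p (\<mu> p) f) \<le> e * norm f)"
proof -
  define om where "om q = (\<Sum>k\<in>near. (norm (phase q k - phase p k) + norm (phase q k * \<mu> q - phase p k * \<mu> p)) * op_bound s)" for q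
  have "isCont om p"
    unfolding om_def[abs_def]
    by (intro continuous_intros cdiff_scalar_isCont[OF cdiff_scalar_phase] cdiff_scalar_isCont[OF \<mu>])
  moreover have "om p = 0" by (simp add: om_def)
  ultimately obtain d where d: "d > 0" "\<And>q. norm (q - p) < d \<Longrightarrow> \<bar>om q\<bar> < e"
    using e unfolding continuous_at_eps_delta by (metis dist_norm diff_zero real_norm_def)
  have "norm (T_op s q (\<mu> q) f - T_op s p (\<mu> p) f) \<le> e * norm f" if "norm (q - p) < d" for q f
  proof -
    have "norm (T_op s q (\<mu> q) f - T_op s p (\<mu> p) f) \<le> om q * norm f"
      unfolding om_def by (rule T_op_diff_bound[OF s])
    also have "\<dots> \<le> e * norm f" using d(2)[OF that] by (intro mult_right_mono) auto
    finally show ?thesis .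
  qed
  with d(1) show ?thesis by blast
qed

lemma phase_bound_continuous: "cdiff_scalar \<mu> p \<Longrightarrow> isCont (\<lambda>q. phase_bound q (\<mu> q)) p"
  unfolding phase_bound_def
  by (intro continuous_intros cdiff_scalar_isCont[OF cdiff_scalar_phase] cdiff_scalar_isCont)

text \<open>Near \<open>p\<close> the continuous representatives solve the fixed point equations with one common scale \<open>s\<close>.
  The candidate \<open>E j\<close> for the partial derivatives solves the differentiated equation, and complex
  homogeneity of its inhomogeneous term extends this from the unit vectors to all directions.\<close>
lemma eigenfunction_branch_differentiable:
  fixes b B :: "complex ^ 'n \<Rightarrow> real ^ 'n \<Rightarrow> complex"
  assumes V0: "lattice_periodic V0" and ae: "AE x in lborel. V0 x = V x"
    and U: "open U" "p \<in> U" and \<mu>: "cdiff_scalar \<mu> p"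
    and ef: "\<And>q. q \<in> U \<Longrightarrow> eigenfunction V0 q (\<mu> q) (b q)"
    and b: "\<And>q. q \<in> U \<Longrightarrow> b q \<in> Lp 2 Omega" and D: "\<And>j. D j \<in> Lp 2 Omega"
    and lim: "((\<lambda>h. Lp_norm 2 Omega (\<lambda>x. b (p + h) x - b p x - (\<Sum>j\<in>UNIV. h $ j * D j x)) / norm h) \<longlongrightarrow> 0) (at 0)"
    and B: "\<And>q. q \<in> U \<Longrightarrow> C_rep Omega (b q) (B q)"
  shows "\<exists>E :: 'n \<Rightarrow> real ^ 'n \<Rightarrow> complex. (\<forall>j. E j \<in> C_space Omega) \<and>
    ((\<lambda>h. sup_norm Omega (\<lambda>x. B (p + h) x - B p x - (\<Sum>j\<in>UNIV. h $ j * E j x)) / norm h) \<longlongrightarrow> 0) (at 0)"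
proof -
  obtain s where s: "s > 0" "s \<le> 1" and half: "(phase_bound p (\<mu> p) + 1) * op_bound s \<le> 1 / 2"
    using small_scale by blast
  have "\<forall>\<^sub>F q in nhds p. phase_bound q (\<mu> q) < phase_bound p (\<mu> p) + 1"
  proof (rule order_tendstoD(2))
    show "((\<lambda>q. phase_bound q (\<mu> q)) \<longlongrightarrow> phase_bound p (\<mu> p)) (nhds p)"
      using phase_bound_continuous[OF \<mu>]
      unfolding isCont_def tendsto_at_iff_tendsto_nhds[of "\<lambda>q. phase_bound q (\<mu> q)"] .
  qed simp
  moreover have "\<forall>\<^sub>F q in nhds p. q \<in> U" using U by (rule eventually_nhds_in_open)
  ultimately have "\<forall>\<^sub>F q in nhds p. phase_bound q (\<mu> q) < phase_bound p (\<mu> p) + 1 \<and> q \<in> U"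
    by (rule eventually_conj)
  then obtain S where S: "open S" "p \<in> S" and SU: "\<And>q. q \<in> S \<Longrightarrow> q \<in> U"
    and Spb: "\<And>q. q \<in> S \<Longrightarrow> phase_bound q (\<mu> q) < phase_bound p (\<mu> p) + 1"
    unfolding eventually_nhds by blast
  have hq: "phase_bound q (\<mu> q) * op_bound s \<le> 1 / 2" if "q \<in> S" for q
    using mult_right_mono[OF less_imp_le[OF Spb[OF that]] op_bound_nonneg[of s]] half by linarith
  define R where "R q w f \<longleftrightarrow> cell_rep (b q) w \<and>
    f = T_op s q (\<mu> q) f + G_op s q w \<and> C_rep Omega (b q) (apply_bcontfun f)" for q w f
  have "\<exists>w f. R q w f" if "q \<in> S" for q
    unfolding R_def by (rule eigenfunction_fixed_point[OF V0 ae ef[OF SU[OF that]] s hq[OF that]])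
  then have "\<forall>q\<in>S. \<exists>z. R q (fst z) (snd z)" by simp
  then obtain z where z: "\<forall>q\<in>S. R q (fst (z q)) (snd (z q))" using bchoice[of S] by meson
  define w g where "w q = fst (z q)" and "g q = snd (z q)" for q
  have R: "R q (w q) (g q)" if "q \<in> S" for q using z that by (simp add: w_def g_def)
  have w: "\<And>q. q \<in> S \<Longrightarrow> cell_rep (b q) (w q)"
    and g: "\<And>q. q \<in> S \<Longrightarrow> g q = T_op s q (\<mu> q) (g q) + G_op s q (w q)"
    and rep: "\<And>q. q \<in> S \<Longrightarrow> C_rep Omega (b q) (apply_bcontfun (g q))"
    using R unfolding R_def by blast+
  have Bg: "B q x = g q x" if "q \<in> S" "x \<in> Omega" for q x
    by (rule C_rep_unique[OF B[OF SU[OF that(1)]] rep[OF that(1)] that(2)])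
  have "cdiff (\<lambda>q. T_op s q (\<mu> q) (g p) + G_op s q (w q)) p"
    unfolding G_op_def
    by (intro cdiff_add T_op_cdiff \<mu> cdiff_sum cdiff_cscale cdiff_scalar_phase
        eta_op_cdiff[OF s(1) S b[OF SU] D lim w])
  then obtain H' where H: "((\<lambda>q. T_op s q (\<mu> q) (g p) + G_op s q (w q)) has_derivative H') (at p)"
    and hom: "\<And>a h. H' (a *s h) = cscale a (H' h)"
    unfolding cdiff_def by blast
  have "\<exists>f. f = T_op s p (\<mu> p) f + H' (axis j 1)" for j
    by (rule T_op_solvable[OF s(1) hq[OF S(2)]])
  then obtain E where E: "\<And>j. E j = T_op s p (\<mu> p) (E j) + H' (axis j 1)" by metis
  let ?N = "\<lambda>h. sup_norm Omega (\<lambda>x. B (p + h) x - B p x - (\<Sum>j\<in>UNIV. h $ j * E j x))"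
  let ?E = "\<lambda>h. \<Sum>j\<in>UNIV. cscale (h $ j) (E j)"
  have gE: "(g has_derivative ?E) (at p)"
  proof (rule contraction_fixed_point_has_derivative[OF S _ _ g H])
    show "linear (T_op s q (\<mu> q))" for q by (rule T_op_linear[OF s(1)])
    show "norm (T_op s q (\<mu> q) f) \<le> norm f / 2" if "q \<in> S" for q f
    proof -
      have "norm (T_op s q (\<mu> q) f) \<le> phase_bound q (\<mu> q) * op_bound s * norm f" by (rule T_op_bound[OF s(1)])
      also have "\<dots> \<le> 1 / 2 * norm f" by (intro mult_right_mono hq that) simp
      finally show ?thesis by simp
    qed
    show "\<exists>d>0. \<forall>q. norm (q - p) < d \<longrightarrow> (\<forall>f. norm (T_op s q (\<mu> q) f - T_op s p (\<mu> p) f) \<le> e * norm f)" if "e > 0" for e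
      by (rule T_op_norm_continuous[OF s(1) \<mu> that])
    show "bounded_linear ?E" by (rule bounded_linear_cscale_sum)
    show "?E h = T_op s p (\<mu> p) (?E h) + H' h" for h
    proof -
      have "T_op s p (\<mu> p) (?E h) + H' h = (\<Sum>j\<in>UNIV. cscale (h $ j) (T_op s p (\<mu> p) (E j))) + (\<Sum>j\<in>UNIV. cscale (h $ j) (H' (axis j 1)))"
        unfolding linear_sum[OF T_op_linear[OF s(1)]] T_op_cscale[OF s(1)]
        by (subst complex_homogeneous_expansion[OF has_derivative_bounded_linear[OF H] hom, of h]) (rule refl)
      also have "\<dots> = (\<Sum>j\<in>UNIV. cscale (h $ j) (T_op s p (\<mu> p) (E j) + H' (axis j 1)))"
        by (simp add: cscale_add_right sum.distrib)
      also have "\<dots> = ?E h" by (simp only: E[symmetric])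
      finally show ?thesis by simp
    qed
  qed
  have "((\<lambda>h. norm (g (p + h) - g p - ?E h) / norm h) \<longlongrightarrow> 0) (at 0)"
    using gE unfolding has_derivative_at by blast
  moreover have "\<forall>\<^sub>F h in at 0. norm (?N h / norm h)
      \<le> norm (g (p + h) - g p - ?E h) / norm h"
  proof -
    have "((\<lambda>h. p + h) \<longlongrightarrow> p) (at 0)" by (auto intro!: tendsto_eq_intros)
    then have "\<forall>\<^sub>F h in at 0. p + h \<in> S" using S by (rule topological_tendstoD)
    then show ?thesis
    proof (rule eventually_mono)
      fix h assume h: "p + h \<in> S"
      have "B (p + h) x - B p x - (\<Sum>j\<in>UNIV. h $ j * E j x) = (g (p + h) - g p - ?E h) x" if "x \<in> Omega" for x
        using Bg[OF h that] Bg[OF S(2) that] by (simp add: apply_bfun_sum)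
      note le = sup_norm_bfun_le[OF this]
      show "norm (?N h / norm h)
        \<le> norm (g (p + h) - g p - ?E h) / norm h"
        using le by (simp add: divide_right_mono)
    qed
  qed
  ultimately have "((\<lambda>h. ?N h / norm h) \<longlongrightarrow> 0) (at 0)"
    by (rule Lim_null_comparison[rotated])
  then show ?thesis
    by (intro exI[of _ "\<lambda>j. apply_bcontfun (E j)"]) (auto simp: C_space_def)
qed

end

lemma cell_potential_exists:
  fixes V :: "real ^ 'n \<Rightarrow> real"
  assumes meas: "V \<in> borel_measurable lebesgue"
    and q: "q \<ge> 1" "q > CARD('n) / 2" and Lq: "V \<in> Lp q Omega"
  shows "\<exists>\<kappa> \<eta> V'. cell_potential \<kappa> \<eta> V' q \<and> (AE x in lborel. V x = V' x)"
proof -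
  obtain \<kappa> \<eta> :: "real ^ 'n \<Rightarrow> real" where k: "kernel_pair \<kappa> \<eta>" using kernel_pair_exists by blast
  obtain V' where V' [measurable]: "V' \<in> borel_measurable borel" and VV': "AE x in lborel. V x = V' x"
    using completion_ex_borel_measurable_real[OF meas] by auto
  have m: "(\<lambda>y. indicator cell y * \<bar>V' y\<bar> powr q) \<in> borel_measurable lborel" by measurable
  have i: "integrable lebesgue (\<lambda>x. indicator Omega x *\<^sub>R (norm (V x) powr q))"
    using Lq by (simp add: Lp_def integrable_restrict_space)
  have "AE x in lborel. indicator Omega x *\<^sub>R (norm (V x) powr q) = indicator cell x * \<bar>V' x\<bar> powr q"
    using VV' AE_Omega_cell
  proof eventually_elim
    case (elim x)
    then show ?case using cell_subset_Omega[of x] by (auto simp: indicator_def)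
  qed
  then have "AE x in lebesgue. indicator Omega x *\<^sub>R (norm (V x) powr q) = indicator cell x * \<bar>V' x\<bar> powr q"
    by (rule AE_completion)
  then have "integrable lebesgue (\<lambda>y. indicator cell y * \<bar>V' y\<bar> powr q)"
    using integrable_cong_AE[OF borel_measurable_integrable[OF i] measurable_completion[OF m]] i by blast
  then have "integrable lborel (\<lambda>y. indicator cell y * \<bar>V' y\<bar> powr q)"
    using integrable_completion[OF m] by simp
  then have "cell_potential \<kappa> \<eta> V' q"
    using k q V' by (intro cell_potential.intro cell_potential_axioms.intro)
  with VV' show ?thesis by blast
qed

lemma holomorphic_scalar_cdiff:
  assumes "holomorphic_scalar U \<mu>" "p \<in> U"
  shows "cdiff_scalar \<mu> p"
proof -
  obtain a where a: "(\<mu> has_derivative (\<lambda>h. \<Sum>j\<in>UNIV. h $ j * a $ j)) (at p)"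
    using assms unfolding holomorphic_scalar_def by blast
  then show ?thesis unfolding cdiff_scalar_def
    by (intro exI[of _ "\<lambda>h. \<Sum>j\<in>UNIV. h $ j * a $ j"]) (simp add: sum_distrib_left mult.assoc)
qed

theorem theoremA1:
  fixes V :: "real ^ 'n \<Rightarrow> real"
  assumes "lattice_periodic V"
    and "V \<in> borel_measurable lebesgue"
    and "CARD('n) \<le> 3 \<Longrightarrow> V \<in> Lp 2 Omega"
    and "CARD('n) \<ge> 4 \<Longrightarrow> \<exists>q > real CARD('n) / 2. V \<in> Lp q Omega"
  shows
    "(\<forall>(p :: real ^ 'n) \<mu>. eigenvalue V (\<chi> j. complex_of_real (p $ j)) \<mu> \<longrightarrow>
        (\<forall>b. eigenfunction V (\<chi> j. complex_of_real (p $ j)) \<mu> b \<longrightarrow> (\<exists>g. C_rep Omega b g))) \<and>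
     (\<forall>(p0 :: real ^ 'n) (U :: (complex ^ 'n) set) (\<mu> :: complex ^ 'n \<Rightarrow> complex)
        (b :: complex ^ 'n \<Rightarrow> real ^ 'n \<Rightarrow> complex).
        open U \<longrightarrow> connected U \<longrightarrow> (\<chi> j. complex_of_real (p0 $ j)) \<in> U \<longrightarrow>
        holomorphic_scalar U \<mu> \<longrightarrow>
        (\<forall>p\<in>U. eigenfunction V p (\<mu> p) (b p)) \<longrightarrow>
        holomorphic_into (Lp 2 Omega) (Lp_norm 2 Omega) U b \<longrightarrow>
        (\<exists>B. (\<forall>p\<in>U. C_rep Omega (b p) (B p)) \<and>
             holomorphic_into (C_space Omega) (sup_norm Omega) U B))"
proof -
  have "\<exists>q\<ge>1. q > CARD('n) / 2 \<and> V \<in> Lp q Omega"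
  proof (cases "CARD('n) \<le> 3")
    case True
    then show ?thesis using assms(3) by (intro exI[of _ 2]) auto
  next
    case False
    then obtain q where "q > real CARD('n) / 2" "V \<in> Lp q Omega" using assms(4) by auto
    with False show ?thesis by (intro exI[of _ q]) auto
  qed
  then obtain q where q: "q \<ge> 1" "q > CARD('n) / 2" "V \<in> Lp q Omega" by blast
  obtain \<kappa> \<eta> V' where cp: "cell_potential \<kappa> \<eta> V' q" and VV': "AE x in lborel. V x = V' x"
    using cell_potential_exists[OF assms(2) q] by blast
  interpret cell_potential \<kappa> \<eta> V' q by (rule cp)
  note continuous = eigenfunction_continuous[OF assms(1) VV']
  show ?thesis
  proof (intro conjI allI impI)
    fix p \<mu> b assume "eigenfunction V (\<chi> j. complex_of_real (p $ j)) \<mu> b"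
    then show "\<exists>g. C_rep Omega b g" by (rule continuous)
  next
    fix p0 :: "real ^ 'n" and U \<mu> and b :: "complex ^ 'n \<Rightarrow> real ^ 'n \<Rightarrow> complex"
    assume U: "open U" and \<mu>: "holomorphic_scalar U \<mu>"
      and ef: "\<forall>p\<in>U. eigenfunction V p (\<mu> p) (b p)"
      and b: "holomorphic_into (Lp 2 Omega) (Lp_norm 2 Omega) U b"
    have "\<exists>g. C_rep Omega (b p) g" if "p \<in> U" for p
      using ef that by (intro continuous) auto
    then obtain B where B: "\<And>p. p \<in> U \<Longrightarrow> C_rep Omega (b p) (B p)" by metis
    have "holomorphic_into (C_space Omega) (sup_norm Omega) U B"
      unfolding holomorphic_into_def
    proof (intro conjI ballI)
      fix p assume p: "p \<in> U"
      show "B p \<in> C_space Omega" using B[OF p] by (simp add: C_rep_def)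
      obtain D :: "'n \<Rightarrow> real ^ 'n \<Rightarrow> complex" where D: "\<And>j. D j \<in> Lp 2 Omega"
        and lim: "((\<lambda>h. Lp_norm 2 Omega (\<lambda>x. b (p + h) x - b p x - (\<Sum>j\<in>UNIV. h $ j * D j x)) / norm h) \<longlongrightarrow> 0) (at 0)"
        using b p unfolding holomorphic_into_def by blast
      have bL: "\<And>q. q \<in> U \<Longrightarrow> b q \<in> Lp 2 Omega" using b unfolding holomorphic_into_def by blast
      show "\<exists>D :: 'n \<Rightarrow> real ^ 'n \<Rightarrow> complex. (\<forall>j. D j \<in> C_space Omega) \<and>
        ((\<lambda>h. sup_norm Omega (\<lambda>x. B (p + h) x - B p x - (\<Sum>j\<in>UNIV. h $ j * D j x)) / norm h) \<longlongrightarrow> 0) (at 0)"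
        by (rule eigenfunction_branch_differentiable[OF assms(1) VV' U p holomorphic_scalar_cdiff[OF \<mu> p]
              bspec[OF ef] bL D lim B])
    qed
    with B show "\<exists>B. (\<forall>p\<in>U. C_rep Omega (b p) (B p)) \<and> holomorphic_into (C_space Omega) (sup_norm Omega) U B"
      by blast
  qed
qed

end
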